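(* Let $i\in I$, let $h$ be a formal variable and set $\widetilde\Sigma_{i,a}=h\,\Sigma^e_{i,a}$, $a\in\mathbb C^\times$. The formulas $\boldsymbol\Theta_i(Y_{j,a}^{\pm1})=Y_{j,a}^{\pm1}$ ($j\neq i$) and $$\boldsymbol\Theta_i(Y_{i,a})=Y_{i,a}-h\frac{Y_{i,a}}{\widetilde\Sigma_{i,aq_i^{-1}}},\qquad \boldsymbol\Theta_i(Y_{i,a}^{-1})=Y_{i,a}^{-1}+h\frac{Y_{i,a}^{-1}A_{i,aq_i^{-1}}}{\widetilde\Sigma_{i,aq_i^{-3}}}$$ hold and give rise to a ring homomorphism $\boldsymbol\Theta_{i,h}:\mathcal Y\to\mathcal Y_{i,h}=\mathcal Y[\widetilde\Sigma_{i,a}^{-1},h]_{a\in\mathbb C^\times}$. In the limit $h\to0$ one has $$\boldsymbol\Theta_{i,h}=\mathrm{Id}+h\,S_i+h^2(\cdots),$$ where $S_i:\mathcal Y\to\mathcal Y_i$ is the $i$-th screening operator. Precisely: for every $P\in\mathcal Y$, $\boldsymbol\Theta_{i,h}(P)-P\in h\,\mathcal Y_{i,h}$, and the class of $h^{-1}(\boldsymbol\Theta_{i,h}(P)-P)$ in $\mathcal Y_{i,h}/h\mathcal Y_{i,h}$ is the image of $S_i(P)$ under the $\mathcal Y$-module map $\mathcal Y_i\to\mathcal Y_{i,h}/h\mathcal Y_{i,h}$ sending $S_{i,a}$ to the class of $-\widetilde\Sigma_{i,aq_i^{-1}}^{-1}$.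
   Context: Lie algebra data. Let $\mathfrak g$ be a finite-dimensional simple Lie algebra over $\mathbb C$ of rank $n$, $I=\{1,\dots,n\}$, with Cartan matrix $C=(C_{i,j})$ (conventions of Kac), simple roots $\alpha_i$, fundamental weights $\omega_i$, weight lattice $P=\bigoplus_i\mathbb Z\omega_i$, $Q^+=\bigoplus_i\mathbb Z_{\ge0}\alpha_i$. Let $d_1,\dots,d_n$ be relatively prime positive integers with $\mathrm{diag}(d_i)\,C$ symmetric. Fix $q\in\mathbb C^\times$ not a root of unity and set $q_i=q^{d_i}$. $\mathcal Y=\mathbb Z[Y_{i,a}^{\pm1}]_{i\in I,a\in\mathbb C^\times}$, and $\mathcal M$ is its multiplicative group of (Laurent) monomials, with weights $\omega(\prod Y_{i,a}^{u_{i,a}})=\sum u_{i,a}\omega_i$. Put $$A_{i,a}=Y_{i,aq_i^{-1}}Y_{i,aq_i}\Big(\prod_{j:\,C_{j,i}=-1}Y_{j,a}\prod_{j:\,C_{j,i}=-2}Y_{j,aq^{-1}}Y_{j,aq}\prod_{j:\,C_{j,i}=-3}Y_{j,aq^{-2}}Y_{j,a}Y_{j,aq^2}\Big)^{-1}.$$ $\widetilde{\mathcal Y}^e$ is the ring of formal series $\sum_{m\in S}a_mm$ ($a_m\in\mathbb Z$, $S\subset\mathcal M$) whose weights $\omega(m)$, $m\in S$, lie in a finite union of sets $\lambda_j-Q^+$ (with $\lambda_j\in P$), with finitely many $m$ with $a_m\neq0$ of each given weight. Set $\Sigma^e_{i,a}=\sum_{k\ge0}\prod_{0<j\le k}A^{-1}_{i,aq_i^{-2j+2}}\in\widetilde{\mathcal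 Y}^e$; it is invertible and satisfies $\Sigma^e_{i,a}=1+A_{i,a}^{-1}\Sigma^e_{i,aq_i^{-2}}$. The ring homomorphism $\boldsymbol\Theta_i:\mathcal Y\to\widetilde{\mathcal Y}^e$ is defined by $\boldsymbol\Theta_i(Y_{j,a}^{\pm1})=Y_{j,a}^{\pm1}$ for $j\ne i$ and $$\boldsymbol\Theta_i(Y_{i,a})=Y_{i,a}A_{i,aq_i^{-1}}^{-1}\frac{\Sigma^e_{i,aq_i^{-3}}}{\Sigma^e_{i,aq_i^{-1}}}.$$ The ring $\mathcal Y_{i,h}=\mathcal Y[\widetilde\Sigma_{i,a}^{-1},h]_{a\in\mathbb C^\times}$ is regarded as the subring of $\widetilde{\mathcal Y}^e[h,h^{-1}]$ generated by $\mathcal Y$, $h$ and the elements $\widetilde\Sigma_{i,a}^{-1}=h^{-1}(\Sigma^e_{i,a})^{-1}$. In it the relation $\widetilde\Sigma_{i,a}=h+A_{i,a}^{-1}\widetilde\Sigma_{i,aq_i^{-2}}$ becomes, for $h\to0$, the relation $\widetilde\Sigma_{i,a}^{-1}=A_{i,a}\widetilde\Sigma_{i,aq_i^{-2}}^{-1}$. Screening operator (Frenkel–Reshetikhin). $\mathcal Y_i$ is the $\mathcal Y$-module generated by symbols $S_{i,a}$, $a\in\mathbb C^\times$, with relations $S_{i,aq_i^2}=A_{i,aq_i}S_{i,a}$. The screening operator $S_i:\mathcal Y\to\mathcal Y_i$ is the derivation with $S_i(Y_{j,a})=\delta_{i,j}Y_{i,a}S_{i,a}$ and $S_i(Y_{j,a}^{-1})=-\delta_{i,j}Y_{i,a}^{-1}S_{i,a}$.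 *)

theory Defs
  imports
    Complex_Main
    "HOL-Library.Poly_Mapping"
    "HOL-Algebra.Generated_Rings"
    "HOL-Algebra.QuotRing"
begin

section \<open>The multiplicative group of nonzero complex numbers\<close>

typedef cstar = "{z :: complex. z \<noteq> 0}"
  by (rule exI[of _ 1]) simp

setup_lifting type_definition_cstar

instantiation cstar :: "{comm_monoid_mult, inverse}"
begin

lift_definition one_cstar :: cstar is 1 by simp
lift_definition times_cstar :: "cstar \<Rightarrow> cstar \<Rightarrow> cstar" is "(*)" by simp
lift_definition inverse_cstar :: "cstar \<Rightarrow> cstar" is inverse by simp
lift_definition divide_cstar :: "cstar \<Rightarrow> cstar \<Rightarrow> cstar" is "(/)" by simp

instance by standard (transfer; simp add: mult_ac)+

end


section \<open>Cartan matrices of simple Lie algebras\<close>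

text \<open>
  The index set \<open>I = {1, \<dots>, n}\<close> is a finite type \<open>'n\<close>.  In Kac's conventions
  \<open>C i j = \<langle>\<alpha>\<^sub>i\<^sup>\<or>, \<alpha>\<^sub>j\<rangle>\<close>, so that \<open>\<alpha>\<^sub>i = (\<Sum>j. C j i \<omega>\<^sub>j)\<close>.  The Cartan matrices of the
  finite-dimensional simple complex Lie algebras are exactly the indecomposable
  generalized Cartan matrices of finite type, i.e. those that have a positive definite
  symmetrization.
\<close>

definition simple_cartan_matrix :: "('n::finite \<Rightarrow> 'n \<Rightarrow> int) \<Rightarrow> bool" where
  "simple_cartan_matrix C \<longleftrightarrow>
     (\<forall>i. C i i = 2) \<and>
     (\<forall>i j. i \<noteq> j \<longrightarrow> C i j \<le> 0) \<and>
     (\<forall>i j. C i j = 0 \<longrightarrow> C j i = 0) \<and>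
     (\<exists>e :: 'n \<Rightarrow> real. (\<forall>i. e i > 0) \<and>
        (\<forall>i j. e i * of_int (C i j) = e j * of_int (C j i)) \<and>
        (\<forall>x :: 'n \<Rightarrow> real. (\<exists>i. x i \<noteq> 0) \<longrightarrow>
           (\<Sum>i\<in>UNIV. \<Sum>j\<in>UNIV. e i * of_int (C i j) * x i * x j) > 0)) \<and>
     \<not> (\<exists>J. J \<noteq> {} \<and> J \<noteq> UNIV \<and> (\<forall>i\<in>J. \<forall>j\<in>-J. C i j = 0))"

text \<open>A weight \<open>\<Sum>j. l j \<omega>\<^sub>j\<close> is given by its coefficients.\<close>

type_synonym 'n weight = "'n \<Rightarrow> int"

definition Q_plus :: "('n::finite \<Rightarrow> 'n \<Rightarrow> int) \<Rightarrow> 'n weight set" where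
  "Q_plus C = {l. \<exists>c :: 'n \<Rightarrow> nat. \<forall>j. l j = (\<Sum>i\<in>UNIV. int (c i) * C j i)}"


section \<open>Monomials, Laurent polynomials and formal series\<close>

text \<open>
  A Laurent monomial is encoded by its exponents; the group of monomials is therefore
  written additively.
\<close>

type_synonym 'n monomial = "('n \<times> cstar) \<Rightarrow>\<^sub>0 int"

type_synonym 'n series = "'n monomial \<Rightarrow> int"

definition Y_mon :: "'n \<Rightarrow> cstar \<Rightarrow> 'n monomial" where
  "Y_mon j a = Poly_Mapping.single (j, a) 1"

definition weight :: "'n monomial \<Rightarrow> 'n weight" where
  "weight m = (\<lambda>j. \<Sum>x\<in>{x \<in> Poly_Mapping.keys m. fst x = j}. Poly_Mapping.lookup m x)"

definition mseries :: "'n monomial \<Rightarrow> 'n series" where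
  "mseries m = (\<lambda>m'. if m' = m then 1 else 0)"

definition conv :: "'n series \<Rightarrow> 'n series \<Rightarrow> 'n series" where
  "conv f g = (\<lambda>m. \<Sum>u\<in>{u. f u \<noteq> 0 \<and> g (m - u) \<noteq> 0}. f u * g (m - u))"

definition Y_ring :: "'n series ring" where
  "Y_ring = \<lparr>carrier = {f. finite {m. f m \<noteq> 0}}, mult = conv, one = mseries 0,
             zero = (\<lambda>m. 0), add = (\<lambda>f g m. f m + g m)\<rparr>"

definition Ye_ring :: "('n::finite \<Rightarrow> 'n \<Rightarrow> int) \<Rightarrow> 'n series ring" where
  "Ye_ring C = Y_ring\<lparr>carrier :=
     {f. (\<exists>L. finite L \<and> (\<forall>m. f m \<noteq> 0 \<longrightarrow> (\<exists>l\<in>L. (\<lambda>j. l j - weight m j) \<in> Q_plus C))) \<and>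
         (\<forall>w. finite {m. f m \<noteq> 0 \<and> weight m = w})}\<rparr>"


section \<open>The elements \<open>A\<close> and \<open>\<Sigma>\<close>, and the homomorphism \<open>\<Theta>\<close>\<close>

definition A_mon :: "('n::finite \<Rightarrow> 'n \<Rightarrow> int) \<Rightarrow> ('n \<Rightarrow> nat) \<Rightarrow> cstar \<Rightarrow> 'n \<Rightarrow> cstar \<Rightarrow> 'n monomial"
  where
  "A_mon C d q i a =
     Y_mon i (a / q ^ d i) + Y_mon i (a * q ^ d i)
     - ((\<Sum>j | C j i = -1. Y_mon j a)
        + (\<Sum>j | C j i = -2. Y_mon j (a / q) + Y_mon j (a * q))
        + (\<Sum>j | C j i = -3. Y_mon j (a / q ^ 2) + Y_mon j a + Y_mon j (a * q ^ 2)))"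

definition Sigma_term ::
  "('n::finite \<Rightarrow> 'n \<Rightarrow> int) \<Rightarrow> ('n \<Rightarrow> nat) \<Rightarrow> cstar \<Rightarrow> 'n \<Rightarrow> cstar \<Rightarrow> nat \<Rightarrow> 'n monomial" where
  "Sigma_term C d q i a k = (\<Sum>j\<in>{0<..k}. - A_mon C d q i (a * (q ^ d i) powi (2 - 2 * int j)))"

text \<open>The formal sum of the monomials \<open>Sigma_term C d q i a k\<close> over all \<open>k\<close>.\<close>

definition Sigma_e ::
  "('n::finite \<Rightarrow> 'n \<Rightarrow> int) \<Rightarrow> ('n \<Rightarrow> nat) \<Rightarrow> cstar \<Rightarrow> 'n \<Rightarrow> cstar \<Rightarrow> 'n series" where
  "Sigma_e C d q i a = (\<lambda>m. int (card {k. Sigma_term C d q i a k = m}))"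

definition Theta ::
  "('n::finite \<Rightarrow> 'n \<Rightarrow> int) \<Rightarrow> ('n \<Rightarrow> nat) \<Rightarrow> cstar \<Rightarrow> 'n \<Rightarrow> 'n series \<Rightarrow> 'n series" where
  "Theta C d q i = (THE \<theta>. \<theta> \<in> extensional (carrier Y_ring) \<and>
     \<theta> \<in> ring_hom Y_ring (Ye_ring C) \<and>
     (\<forall>j a. j \<noteq> i \<longrightarrow> \<theta> (mseries (Y_mon j a)) = mseries (Y_mon j a) \<and>
                      \<theta> (mseries (- Y_mon j a)) = mseries (- Y_mon j a)) \<and>
     (\<forall>a. \<theta> (mseries (Y_mon i a)) =
        mseries (Y_mon i a) \<otimes>\<^bsub>Ye_ring C\<^esub> mseries (- A_mon C d q i (a / q ^ d i))
        \<otimes>\<^bsub>Ye_ring C\<^esub> (Sigma_e C d q i (a / (q ^ d i) ^ 3)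
          \<otimes>\<^bsub>Ye_ring C\<^esub> inv\<^bsub>Ye_ring C\<^esub> (Sigma_e C d q i (a / q ^ d i)))))"


section \<open>Laurent polynomials in \<open>h\<close>, and the deformed homomorphism\<close>

definition laurent_ring :: "('a, 'b) ring_scheme \<Rightarrow> (int \<Rightarrow> 'a) ring" where
  "laurent_ring R = \<lparr>
     carrier = {p. (\<forall>k. p k \<in> carrier R) \<and> finite {k. p k \<noteq> \<zero>\<^bsub>R\<^esub>}},
     mult = (\<lambda>p r k. \<Oplus>\<^bsub>R\<^esub>l\<in>{l. p l \<noteq> \<zero>\<^bsub>R\<^esub>}. p l \<otimes>\<^bsub>R\<^esub> r (k - l)),
     one = (\<lambda>k. if k = 0 then \<one>\<^bsub>R\<^esub> else \<zero>\<^bsub>R\<^esub>),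
     zero = (\<lambda>k. \<zero>\<^bsub>R\<^esub>),
     add = (\<lambda>p r k. p k \<oplus>\<^bsub>R\<^esub> r k)\<rparr>"

definition laurent_const :: "('a, 'b) ring_scheme \<Rightarrow> 'a \<Rightarrow> int \<Rightarrow> 'a" where
  "laurent_const R x = (\<lambda>k. if k = 0 then x else \<zero>\<^bsub>R\<^esub>)"

definition laurent_var :: "('a, 'b) ring_scheme \<Rightarrow> int \<Rightarrow> 'a" where
  "laurent_var R = (\<lambda>k. if k = 1 then \<one>\<^bsub>R\<^esub> else \<zero>\<^bsub>R\<^esub>)"

abbreviation Yeh_ring :: "('n::finite \<Rightarrow> 'n \<Rightarrow> int) \<Rightarrow> (int \<Rightarrow> 'n series) ring" where
  "Yeh_ring C \<equiv> laurent_ring (Ye_ring C)"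

abbreviation emb :: "('n::finite \<Rightarrow> 'n \<Rightarrow> int) \<Rightarrow> 'n series \<Rightarrow> int \<Rightarrow> 'n series" where
  "emb C \<equiv> laurent_const (Ye_ring C)"

abbreviation hvar :: "('n::finite \<Rightarrow> 'n \<Rightarrow> int) \<Rightarrow> int \<Rightarrow> 'n series" where
  "hvar C \<equiv> laurent_var (Ye_ring C)"

definition Sigma_h ::
  "('n::finite \<Rightarrow> 'n \<Rightarrow> int) \<Rightarrow> ('n \<Rightarrow> nat) \<Rightarrow> cstar \<Rightarrow> 'n \<Rightarrow> cstar \<Rightarrow> int \<Rightarrow> 'n series" where
  "Sigma_h C d q i a = hvar C \<otimes>\<^bsub>Yeh_ring C\<^esub> emb C (Sigma_e C d q i a)"

definition Yih_ring ::
  "('n::finite \<Rightarrow> 'n \<Rightarrow> int) \<Rightarrow> ('n \<Rightarrow> nat) \<Rightarrow> cstar \<Rightarrow> 'n \<Rightarrow> (int \<Rightarrow> 'n series) ring" where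
  "Yih_ring C d q i = (Yeh_ring C)\<lparr>carrier := generate_ring (Yeh_ring C)
     (emb C ` carrier Y_ring \<union> {hvar C} \<union>
      {inv\<^bsub>Yeh_ring C\<^esub> (Sigma_h C d q i a) | a. True})\<rparr>"

definition Theta_h ::
  "('n::finite \<Rightarrow> 'n \<Rightarrow> int) \<Rightarrow> ('n \<Rightarrow> nat) \<Rightarrow> cstar \<Rightarrow> 'n \<Rightarrow> 'n series \<Rightarrow> int \<Rightarrow> 'n series" where
  "Theta_h C d q i P = emb C (Theta C d q i P)"


section \<open>The screening operator\<close>

text \<open>
  The fields \<open>mult\<close> and \<open>one\<close> of a module record play no role.
\<close>

definition free_module :: "('a, 'b) ring_scheme \<Rightarrow> ('a, 's \<Rightarrow> 'a) module" where
  "free_module R = \<lparr>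
     carrier = {f. (\<forall>s. f s \<in> carrier R) \<and> finite {s. f s \<noteq> \<zero>\<^bsub>R\<^esub>}},
     mult = undefined, one = undefined,
     zero = (\<lambda>s. \<zero>\<^bsub>R\<^esub>),
     add = (\<lambda>f g s. f s \<oplus>\<^bsub>R\<^esub> g s),
     smult = (\<lambda>r f s. r \<otimes>\<^bsub>R\<^esub> f s)\<rparr>"

definition free_gen :: "('a, 'b) ring_scheme \<Rightarrow> 's \<Rightarrow> 's \<Rightarrow> 'a" where
  "free_gen R s = (\<lambda>t. if t = s then \<one>\<^bsub>R\<^esub> else \<zero>\<^bsub>R\<^esub>)"

definition quot_module :: "('a, 'c, 'm) module_scheme \<Rightarrow> 'c set \<Rightarrow> ('a, 'c set) module" where
  "quot_module M N = \<lparr>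
     carrier = a_rcosets\<^bsub>M\<^esub> N,
     mult = undefined, one = undefined,
     zero = N,
     add = set_add M,
     smult = (\<lambda>r Z. \<Union>x\<in>Z. N +>\<^bsub>M\<^esub> (r \<odot>\<^bsub>M\<^esub> x))\<rparr>"

definition mod_hom ::
  "('a, 'b) ring_scheme \<Rightarrow> ('a, 'c, 'm) module_scheme \<Rightarrow> ('a, 'e, 'k) module_scheme \<Rightarrow> ('c \<Rightarrow> 'e) set"
  where
  "mod_hom R M N = {\<phi>. \<phi> \<in> carrier M \<rightarrow> carrier N \<and>
     (\<forall>x\<in>carrier M. \<forall>y\<in>carrier M. \<phi> (x \<oplus>\<^bsub>M\<^esub> y) = \<phi> x \<oplus>\<^bsub>N\<^esub> \<phi> y) \<and>
     (\<forall>r\<in>carrier R. \<forall>x\<in>carrier M. \<phi> (r \<odot>\<^bsub>M\<^esub> x) = r \<odot>\<^bsub>N\<^esub> \<phi> x)}"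

definition derivations ::
  "('a, 'b) ring_scheme \<Rightarrow> ('a, 'c, 'm) module_scheme \<Rightarrow> ('a \<Rightarrow> 'c) set" where
  "derivations R M = {D. D \<in> carrier R \<rightarrow> carrier M \<and>
     (\<forall>x\<in>carrier R. \<forall>y\<in>carrier R. D (x \<oplus>\<^bsub>R\<^esub> y) = D x \<oplus>\<^bsub>M\<^esub> D y) \<and>
     (\<forall>x\<in>carrier R. \<forall>y\<in>carrier R.
        D (x \<otimes>\<^bsub>R\<^esub> y) = (x \<odot>\<^bsub>M\<^esub> D y) \<oplus>\<^bsub>M\<^esub> (y \<odot>\<^bsub>M\<^esub> D x))}"

abbreviation S_free :: "('n series, cstar \<Rightarrow> 'n series) module" where
  "S_free \<equiv> free_module Y_ring"

definition S_relations ::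
  "('n::finite \<Rightarrow> 'n \<Rightarrow> int) \<Rightarrow> ('n \<Rightarrow> nat) \<Rightarrow> cstar \<Rightarrow> 'n \<Rightarrow> (cstar \<Rightarrow> 'n series) set" where
  "S_relations C d q i =
     (\<lambda>N. submodule N Y_ring S_free) hull
     {free_gen Y_ring (a * (q ^ d i) ^ 2) \<ominus>\<^bsub>S_free\<^esub>
        (mseries (A_mon C d q i (a * q ^ d i)) \<odot>\<^bsub>S_free\<^esub> free_gen Y_ring a) | a. True}"

definition Yi_module ::
  "('n::finite \<Rightarrow> 'n \<Rightarrow> int) \<Rightarrow> ('n \<Rightarrow> nat) \<Rightarrow> cstar \<Rightarrow> 'n \<Rightarrow> ('n series, (cstar \<Rightarrow> 'n series) set) module"
  where
  "Yi_module C d q i = quot_module S_free (S_relations C d q i)"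

definition S_gen ::
  "('n::finite \<Rightarrow> 'n \<Rightarrow> int) \<Rightarrow> ('n \<Rightarrow> nat) \<Rightarrow> cstar \<Rightarrow> 'n \<Rightarrow> cstar \<Rightarrow> (cstar \<Rightarrow> 'n series) set"
  where
  "S_gen C d q i a = S_relations C d q i +>\<^bsub>S_free\<^esub> free_gen Y_ring a"

definition screening ::
  "('n::finite \<Rightarrow> 'n \<Rightarrow> int) \<Rightarrow> ('n \<Rightarrow> nat) \<Rightarrow> cstar \<Rightarrow> 'n \<Rightarrow> 'n series \<Rightarrow> (cstar \<Rightarrow> 'n series) set"
  where
  "screening C d q i = (THE D. D \<in> extensional (carrier Y_ring) \<and>
     D \<in> derivations Y_ring (Yi_module C d q i) \<and>
     (\<forall>j a. j \<noteq> i \<longrightarrow> D (mseries (Y_mon j a)) = \<zero>\<^bsub>Yi_module C d q i\<^esub> \<and>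
                      D (mseries (- Y_mon j a)) = \<zero>\<^bsub>Yi_module C d q i\<^esub>) \<and>
     (\<forall>a. D (mseries (Y_mon i a)) =
            mseries (Y_mon i a) \<odot>\<^bsub>Yi_module C d q i\<^esub> S_gen C d q i a \<and>
          D (mseries (- Y_mon i a)) =
            \<ominus>\<^bsub>Yi_module C d q i\<^esub> (mseries (- Y_mon i a) \<odot>\<^bsub>Yi_module C d q i\<^esub> S_gen C d q i a)))"


section \<open>The specialization at \<open>h = 0\<close>\<close>

definition h_ideal ::
  "('n::finite \<Rightarrow> 'n \<Rightarrow> int) \<Rightarrow> ('n \<Rightarrow> nat) \<Rightarrow> cstar \<Rightarrow> 'n \<Rightarrow> (int \<Rightarrow> 'n series) set" where
  "h_ideal C d q i = PIdl\<^bsub>Yih_ring C d q i\<^esub> (hvar C)"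

definition h_class ::
  "('n::finite \<Rightarrow> 'n \<Rightarrow> int) \<Rightarrow> ('n \<Rightarrow> nat) \<Rightarrow> cstar \<Rightarrow> 'n \<Rightarrow> (int \<Rightarrow> 'n series) \<Rightarrow> (int \<Rightarrow> 'n series) set"
  where
  "h_class C d q i x = h_ideal C d q i +>\<^bsub>Yih_ring C d q i\<^esub> x"

text \<open>The ring \<open>Yih_ring / h Yih_ring\<close>, with its structure of a module over \<open>Y_ring\<close>.\<close>

definition Yi0_module ::
  "('n::finite \<Rightarrow> 'n \<Rightarrow> int) \<Rightarrow> ('n \<Rightarrow> nat) \<Rightarrow> cstar \<Rightarrow> 'n \<Rightarrow> ('n series, (int \<Rightarrow> 'n series) set) module"
  where
  "Yi0_module C d q i = ring.extend (Yih_ring C d q i Quot h_ideal C d q i)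
     \<lparr>smult = (\<lambda>P Z. h_class C d q i (emb C P) \<otimes>\<^bsub>Yih_ring C d q i Quot h_ideal C d q i\<^esub> Z)\<rparr>"

end

(*
  The recursion Sigma_a = 1 + A_a^-1 Sigma_{a q_i^-2} turns the definition of Theta(Y_{i,a}) into
  Y_{i,a} - Y_{i,a} / Sigma_{a q_i^-1}, and multiplying out shows that the claimed formula for
  Theta(Y_{i,a}^-1) is its inverse.  Since Theta is multiplicative, D(P) = h^-1 (Theta(P) - P)
  satisfies D(PR) = Theta(P) D(R) + R D(P).  Hence D maps Y into Y_{i,h}, because it does so on the
  generators, and modulo h it is a derivation, because Theta(P) = P + h D(P) is congruent to P.
  The screening operator followed by S_{i,a} -> - Sigma~_{a q_i^-1}^-1 is a derivation too, and a
  derivation of Y is determined by its values on the Y_{j,a}.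
*)
theory Submission
  imports Defs "HOL-Algebra.Free_Abelian_Groups"
begin

section \<open>Rings of Laurent polynomials\<close>

text \<open>\<open>Theta\<close> and \<open>screening\<close> are definite descriptions, so every
  statement about them rests on existence and uniqueness. For \<open>Theta\<close> this is the
  universal property of the Laurent polynomial ring: a choice of units extends uniquely to a
  homomorphism. The prescribed image of Y_{i,a} must therefore be a unit of the completed ring,
  which is why the ring axioms of \<open>Ye_ring\<close> and the invertibility of Sigma are settled
  beforehand. Both rest on the positive definiteness of C, which makes the simple roots independent
  and bounds the entries of C below by -3. For \<open>screening\<close> the candidate is a
  logarithmic derivative. Two points are delicate. The rule for D(PR) gives D(Y^-1) = - Theta(Y)^-1
  Y^-1 D(Y), so D(Y_{i,a}^-1) is seen to lie in Y_{i,h} only through the explicit formula for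
  Theta(Y_{i,a}^-1), which has no Sigma in a numerator. And the map out of Y_i must respect S_{i,a
  q_i^2} = A_{i,a q_i} S_{i,a}; this is what the recursion of Sigma says about the inverses of
  Sigma~ modulo h.\<close>

lemma (in abelian_monoid) finsum_swap:
  assumes "finite A" "finite B" "\<And>a b. a \<in> A \<Longrightarrow> b \<in> B \<Longrightarrow> f a b \<in> carrier G"
  shows "(\<Oplus>a\<in>A. \<Oplus>b\<in>B. f a b) = (\<Oplus>b\<in>B. \<Oplus>a\<in>A. f a b)"
  using assms(1,3)
proof (induction A)
  case empty
  then show ?case by (simp add: finsum_zero)
next
  case (insert x A)
  have "(\<Oplus>a\<in>insert x A. \<Oplus>b\<in>B. f a b) = (\<Oplus>b\<in>B. f x b) \<oplus> (\<Oplus>a\<in>A. \<Oplus>b\<in>B. f a b)"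
    using insert assms(2) by (intro finsum_insert) (auto intro!: finsum_closed)
  also have "\<dots> = (\<Oplus>b\<in>B. f x b) \<oplus> (\<Oplus>b\<in>B. \<Oplus>a\<in>A. f a b)"
    using insert by simp
  also have "\<dots> = (\<Oplus>b\<in>B. f x b \<oplus> (\<Oplus>a\<in>A. f a b))"
    using insert by (intro finsum_addf[symmetric]) (auto intro!: finsum_closed)
  also have "\<dots> = (\<Oplus>b\<in>B. \<Oplus>a\<in>insert x A. f a b)"
    using insert by (intro finsum_cong') (auto intro!: finsum_insert[symmetric] finsum_closed)
  finally show ?case .
qed

lemma laurent_ring_simps:
  "carrier (laurent_ring R) = {p. (\<forall>k. p k \<in> carrier R) \<and> finite {k. p k \<noteq> \<zero>\<^bsub>R\<^esub>}}"
  "\<one>\<^bsub>laurent_ring R\<^esub> = (\<lambda>k. if k = 0 then \<one>\<^bsub>R\<^esub> else \<zero>\<^bsub>R\<^esub>)"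
  "\<zero>\<^bsub>laurent_ring R\<^esub> = (\<lambda>k. \<zero>\<^bsub>R\<^esub>)"
  "p \<oplus>\<^bsub>laurent_ring R\<^esub> r = (\<lambda>k. p k \<oplus>\<^bsub>R\<^esub> r k)"
  by (simp_all add: laurent_ring_def)

context cring
begin

text \<open>The defining sum runs over the support of \<open>p\<close> alone. Replacing it by any
  finite set that contains the indices of the nonzero terms allows two products to be compared over
  a common index set.\<close>

lemma laurent_mult_eq:
  assumes "p \<in> carrier (laurent_ring R)" "r \<in> carrier (laurent_ring R)"
    and "finite A" "\<And>l. p l \<noteq> \<zero> \<Longrightarrow> r (k - l) \<noteq> \<zero> \<Longrightarrow> l \<in> A"
  shows "(p \<otimes>\<^bsub>laurent_ring R\<^esub> r) k = (\<Oplus>l\<in>A. p l \<otimes> r (k - l))"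
proof -
  have p: "\<And>l. p l \<in> carrier R" "finite {l. p l \<noteq> \<zero>}" and r: "\<And>l. r l \<in> carrier R"
    using assms by (auto simp: laurent_ring_simps)
  have "(p \<otimes>\<^bsub>laurent_ring R\<^esub> r) k = (\<Oplus>l\<in>{l. p l \<noteq> \<zero>}. p l \<otimes> r (k - l))"
    by (simp add: laurent_ring_def)
  also have "\<dots> = (\<Oplus>l\<in>A. p l \<otimes> r (k - l))"
  proof (rule add.finprod_mono_neutral_cong)
    show "p l \<otimes> r (k - l) = \<zero>" if "l \<in> {l. p l \<noteq> \<zero>} - A" for l
      using that p(1) r assms(4)[of l] by (cases "r (k - l) = \<zero>") auto
  qed (use p r assms(3) in auto)
  finally show ?thesis .
qed

lemma laurent_mult_closed:
  assumes p: "p \<in> carrier (laurent_ring R)" and r: "r \<in> carrier (laurent_ring R)"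
  shows "p \<otimes>\<^bsub>laurent_ring R\<^esub> r \<in> carrier (laurent_ring R)"
proof -
  have p': "\<And>l. p l \<in> carrier R" "finite {l. p l \<noteq> \<zero>}"
    and r': "\<And>l. r l \<in> carrier R" "finite {l. r l \<noteq> \<zero>}"
    using p r by (auto simp: laurent_ring_simps)
  have eq: "(p \<otimes>\<^bsub>laurent_ring R\<^esub> r) k = (\<Oplus>l\<in>{l. p l \<noteq> \<zero>}. p l \<otimes> r (k - l))" for k
    by (simp add: laurent_ring_def)
  have "{k. (p \<otimes>\<^bsub>laurent_ring R\<^esub> r) k \<noteq> \<zero>}
          \<subseteq> (\<lambda>(a,b). a + b) ` ({l. p l \<noteq> \<zero>} \<times> {l. r l \<noteq> \<zero>})" (is "?L \<subseteq> ?R")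
  proof
    fix k assume "k \<in> ?L"
    then obtain l where "p l \<noteq> \<zero>" "r (k - l) \<noteq> \<zero>"
      unfolding eq using add.finprod_one_eqI[of "{l. p l \<noteq> \<zero>}" "\<lambda>l. p l \<otimes> r (k - l)"] p' r' by force
    then show "k \<in> ?R"
      by (intro image_eqI[of _ _ "(l, k - l)"]) auto
  qed
  then have "finite ?L"
    by (rule finite_subset) (use p' r' in auto)
  moreover have "(p \<otimes>\<^bsub>laurent_ring R\<^esub> r) k \<in> carrier R" for k
    unfolding eq using p' r' by (auto intro!: finsum_closed)
  ultimately show ?thesis by (simp add: laurent_ring_simps)
qed

lemma laurent_mult_comm:
  assumes p: "p \<in> carrier (laurent_ring R)" and r: "r \<in> carrier (laurent_ring R)"
  shows "p \<otimes>\<^bsub>laurent_ring R\<^esub> r = r \<otimes>\<^bsub>laurent_ring R\<^esub> p"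
proof
  fix k
  have p': "\<And>l. p l \<in> carrier R" "finite {l. p l \<noteq> \<zero>}"
    and r': "\<And>l. r l \<in> carrier R" "finite {l. r l \<noteq> \<zero>}"
    using p r by (auto simp: laurent_ring_simps)
  have "(p \<otimes>\<^bsub>laurent_ring R\<^esub> r) k = (\<Oplus>l\<in>(\<lambda>l. k - l) ` {l. r l \<noteq> \<zero>}. p l \<otimes> r (k - l))"
    by (rule laurent_mult_eq[OF p r]) (use r' in force)+
  also have "\<dots> = (\<Oplus>l\<in>{l. r l \<noteq> \<zero>}. p (k - l) \<otimes> r (k - (k - l)))"
    by (rule finsum_reindex) (use p' r' in \<open>auto simp: inj_on_def\<close>)
  also have "\<dots> = (\<Oplus>l\<in>{l. r l \<noteq> \<zero>}. r l \<otimes> p (k - l))"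
    by (rule finsum_cong') (use p' r' in \<open>auto simp: m_comm\<close>)
  also have "\<dots> = (r \<otimes>\<^bsub>laurent_ring R\<^esub> p) k"
    by (simp add: laurent_ring_def)
  finally show "(p \<otimes>\<^bsub>laurent_ring R\<^esub> r) k = (r \<otimes>\<^bsub>laurent_ring R\<^esub> p) k" .
qed

lemma laurent_mult_assoc:
  assumes p: "p \<in> carrier (laurent_ring R)" and r: "r \<in> carrier (laurent_ring R)"
    and s: "s \<in> carrier (laurent_ring R)"
  shows "p \<otimes>\<^bsub>laurent_ring R\<^esub> r \<otimes>\<^bsub>laurent_ring R\<^esub> s = p \<otimes>\<^bsub>laurent_ring R\<^esub> (r \<otimes>\<^bsub>laurent_ring R\<^esub> s)"
proof
  fix k
  define A B where "A = {l. p l \<noteq> \<zero>}" and "B = {l. r l \<noteq> \<zero>}"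
  \<comment> \<open>\<open>D\<close> contains the support of the product of \<open>p\<close> and
    \<open>r\<close>. With \<open>j\<close> in \<open>A\<close> the exponent taken from
    \<open>p\<close> and \<open>l\<close> in \<open>D\<close> the joint exponent from
    \<open>p\<close> and \<open>r\<close>, both bracketings become the same double sum, summed in
    opposite orders.\<close>
  define D where "D = (\<lambda>(a,b). a + b) ` (A \<times> B)"
  have p': "\<And>l. p l \<in> carrier R" and fA: "finite A"
    and r': "\<And>l. r l \<in> carrier R" and fB: "finite B" and s': "\<And>l. s l \<in> carrier R"
    using p r s by (auto simp: laurent_ring_simps A_def B_def)
  have fD: "finite D" using fA fB by (simp add: D_def)
  note pr = laurent_mult_closed[OF p r] and rs = laurent_mult_closed[OF r s]
  have eq: "(p \<otimes>\<^bsub>laurent_ring R\<^esub> r) l = (\<Oplus>j\<in>A. p j \<otimes> r (l - j))" for l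
    by (simp add: laurent_ring_def A_def)
  have supp: "l \<in> D" if "(p \<otimes>\<^bsub>laurent_ring R\<^esub> r) l \<noteq> \<zero>" for l
  proof -
    from that obtain j where "p j \<noteq> \<zero>" "r (l - j) \<noteq> \<zero>"
      unfolding eq using add.finprod_one_eqI[of A "\<lambda>j. p j \<otimes> r (l - j)"] p' r' by (force simp: A_def)
    then show ?thesis
      unfolding D_def A_def B_def by (intro image_eqI[of _ _ "(j, l - j)"]) auto
  qed
  have inner: "(r \<otimes>\<^bsub>laurent_ring R\<^esub> s) (k - j) = (\<Oplus>l\<in>D. r (l - j) \<otimes> s (k - l))" if "j \<in> A" for j
  proof -
    have "(r \<otimes>\<^bsub>laurent_ring R\<^esub> s) (k - j) = (\<Oplus>l\<in>(\<lambda>l. l - j) ` D. r l \<otimes> s (k - j - l))"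
    proof (rule laurent_mult_eq[OF r s])
      fix l assume "r l \<noteq> \<zero>"
      then have "j + l \<in> D"
        using that unfolding D_def B_def by (intro image_eqI[of _ _ "(j, l)"]) auto
      then show "l \<in> (\<lambda>l. l - j) ` D" by (intro image_eqI[of _ _ "j + l"]) auto
    qed (use fD in simp)
    also have "\<dots> = (\<Oplus>l\<in>D. r (l - j) \<otimes> s (k - j - (l - j)))"
      by (rule finsum_reindex) (use r' s' in \<open>auto simp: inj_on_def\<close>)
    finally show ?thesis by simp
  qed
  have "(p \<otimes>\<^bsub>laurent_ring R\<^esub> r \<otimes>\<^bsub>laurent_ring R\<^esub> s) k
      = (\<Oplus>l\<in>D. (\<Oplus>j\<in>A. p j \<otimes> r (l - j)) \<otimes> s (k - l))"
    by (subst laurent_mult_eq[OF pr s fD]) (use supp in \<open>auto simp: eq\<close>)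
  also have "\<dots> = (\<Oplus>l\<in>D. \<Oplus>j\<in>A. p j \<otimes> (r (l - j) \<otimes> s (k - l)))"
    using p' r' s' fA
    by (intro finsum_cong') (auto simp: finsum_ldistr m_assoc intro!: finsum_closed finsum_cong')
  also have "\<dots> = (\<Oplus>j\<in>A. \<Oplus>l\<in>D. p j \<otimes> (r (l - j) \<otimes> s (k - l)))"
    using fA fD p' r' s' by (intro finsum_swap) auto
  also have "\<dots> = (\<Oplus>j\<in>A. p j \<otimes> (r \<otimes>\<^bsub>laurent_ring R\<^esub> s) (k - j))"
    using p' r' s' fD rs
    by (intro finsum_cong') (auto simp: inner finsum_rdistr intro!: finsum_closed)
  also have "\<dots> = (p \<otimes>\<^bsub>laurent_ring R\<^esub> (r \<otimes>\<^bsub>laurent_ring R\<^esub> s)) k"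
    by (subst laurent_mult_eq[OF p rs fA]) (auto simp: A_def)
  finally show "(p \<otimes>\<^bsub>laurent_ring R\<^esub> r \<otimes>\<^bsub>laurent_ring R\<^esub> s) k
      = (p \<otimes>\<^bsub>laurent_ring R\<^esub> (r \<otimes>\<^bsub>laurent_ring R\<^esub> s)) k" .
qed

lemma laurent_const_closed:
  assumes "x \<in> carrier R"
  shows "laurent_const R x \<in> carrier (laurent_ring R)"
proof -
  have "finite {k. laurent_const R x k \<noteq> \<zero>}"
    by (rule finite_subset[of _ "{0}"]) (auto simp: laurent_const_def)
  then show ?thesis using assms by (auto simp: laurent_ring_simps laurent_const_def)
qed

lemma laurent_const_mult_eq:
  assumes "x \<in> carrier R" "p \<in> carrier (laurent_ring R)"
  shows "laurent_const R x \<otimes>\<^bsub>laurent_ring R\<^esub> p = (\<lambda>k. x \<otimes> p k)"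
proof
  fix k
  have "(laurent_const R x \<otimes>\<^bsub>laurent_ring R\<^esub> p) k = (\<Oplus>l\<in>{0}. laurent_const R x l \<otimes> p (k - l))"
    by (rule laurent_mult_eq) (use assms laurent_const_closed in \<open>auto simp: laurent_const_def split: if_splits\<close>)
  then show "(laurent_const R x \<otimes>\<^bsub>laurent_ring R\<^esub> p) k = x \<otimes> p k"
    using assms by (simp add: laurent_const_def laurent_ring_simps finsum_insert finsum_empty)
qed

lemma cring_laurent_ring: "cring (laurent_ring R)"
proof (rule cringI)
  let ?L = "laurent_ring R"
  show "abelian_group ?L"
  proof (rule abelian_groupI)
    fix p r assume pr: "p \<in> carrier ?L" "r \<in> carrier ?L"
    have "finite {k. p k \<oplus> r k \<noteq> \<zero>}"
      by (rule finite_subset[of _ "{k. p k \<noteq> \<zero>} \<union> {k. r k \<noteq> \<zero>}"])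
        (use pr in \<open>auto simp: laurent_ring_simps\<close>)
    then show "p \<oplus>\<^bsub>?L\<^esub> r \<in> carrier ?L"
      using pr by (auto simp: laurent_ring_simps)
    show "p \<oplus>\<^bsub>?L\<^esub> r = r \<oplus>\<^bsub>?L\<^esub> p"
      using pr by (auto simp: laurent_ring_simps a_comm)
  next
    fix p assume p: "p \<in> carrier ?L"
    have "finite {k. \<ominus> p k \<noteq> \<zero>}"
      by (rule finite_subset[of _ "{k. p k \<noteq> \<zero>}"]) (use p in \<open>auto simp: laurent_ring_simps\<close>)
    then show "\<exists>r\<in>carrier ?L. r \<oplus>\<^bsub>?L\<^esub> p = \<zero>\<^bsub>?L\<^esub>"
      using p by (intro bexI[of _ "\<lambda>k. \<ominus> p k"]) (auto simp: laurent_ring_simps l_neg)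
  qed (auto simp: laurent_ring_simps a_assoc)
  have one: "\<one>\<^bsub>?L\<^esub> = laurent_const R \<one>"
    by (auto simp: laurent_ring_simps laurent_const_def)
  show "Group.comm_monoid ?L"
  proof (rule comm_monoidI)
    fix p assume "p \<in> carrier ?L"
    then show "\<one>\<^bsub>?L\<^esub> \<otimes>\<^bsub>?L\<^esub> p = p"
      unfolding one by (subst laurent_const_mult_eq) (auto simp: laurent_ring_simps)
  qed (auto simp: laurent_mult_closed laurent_mult_assoc one laurent_const_closed intro: laurent_mult_comm)
  fix p r s assume prs: "p \<in> carrier ?L" "r \<in> carrier ?L" "s \<in> carrier ?L"
  then have "p \<oplus>\<^bsub>?L\<^esub> r \<in> carrier ?L"
    using abelian_group.axioms(1)[OF \<open>abelian_group ?L\<close>] by (simp add: abelian_monoid.a_closed)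
  show "(p \<oplus>\<^bsub>?L\<^esub> r) \<otimes>\<^bsub>?L\<^esub> s = p \<otimes>\<^bsub>?L\<^esub> s \<oplus>\<^bsub>?L\<^esub> r \<otimes>\<^bsub>?L\<^esub> s"
  proof
    fix k
    define A where "A = {k. p k \<noteq> \<zero>} \<union> {k. r k \<noteq> \<zero>}"
    have fA: "finite A" using prs by (auto simp: laurent_ring_simps A_def)
    have c: "\<And>l. p l \<in> carrier R" "\<And>l. r l \<in> carrier R" "\<And>l. s l \<in> carrier R"
      using prs by (auto simp: laurent_ring_simps)
    have "((p \<oplus>\<^bsub>?L\<^esub> r) \<otimes>\<^bsub>?L\<^esub> s) k = (\<Oplus>l\<in>A. (p \<oplus>\<^bsub>?L\<^esub> r) l \<otimes> s (k - l))"
      by (rule laurent_mult_eq) (use prs fA \<open>p \<oplus>\<^bsub>?L\<^esub> r \<in> carrier ?L\<close> in \<open>auto simp: A_def laurent_ring_simps\<close>)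
    also have "\<dots> = (\<Oplus>l\<in>A. p l \<otimes> s (k - l) \<oplus> r l \<otimes> s (k - l))"
      using c by (intro finsum_cong') (auto simp: laurent_ring_simps l_distr)
    also have "\<dots> = (\<Oplus>l\<in>A. p l \<otimes> s (k - l)) \<oplus> (\<Oplus>l\<in>A. r l \<otimes> s (k - l))"
      using c by (intro finsum_addf) auto
    also have "\<dots> = (p \<otimes>\<^bsub>?L\<^esub> s \<oplus>\<^bsub>?L\<^esub> r \<otimes>\<^bsub>?L\<^esub> s) k"
      using laurent_mult_eq[OF prs(1,3) fA, of k] laurent_mult_eq[OF prs(2,3) fA, of k]
      by (simp add: laurent_ring_simps(4) A_def)
    finally show "((p \<oplus>\<^bsub>?L\<^esub> r) \<otimes>\<^bsub>?L\<^esub> s) k = (p \<otimes>\<^bsub>?L\<^esub> s \<oplus>\<^bsub>?L\<^esub> r \<otimes>\<^bsub>?L\<^esub> s) k" .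
  qed
qed

lemma laurent_const_hom: "laurent_const R \<in> ring_hom R (laurent_ring R)"
proof (rule ring_hom_memI)
  fix x y assume xy: "x \<in> carrier R" "y \<in> carrier R"
  show "laurent_const R (x \<otimes> y) = laurent_const R x \<otimes>\<^bsub>laurent_ring R\<^esub> laurent_const R y"
    using xy by (subst laurent_const_mult_eq) (simp_all add: laurent_const_closed, simp add: laurent_const_def fun_eq_iff)
  show "laurent_const R (x \<oplus> y) = laurent_const R x \<oplus>\<^bsub>laurent_ring R\<^esub> laurent_const R y"
    using xy by (auto simp: laurent_ring_simps laurent_const_def)
qed (auto simp: laurent_const_closed, auto simp: laurent_const_def laurent_ring_simps)

lemma laurent_var_closed: "laurent_var R \<in> carrier (laurent_ring R)"
proof -
  have "finite {k. laurent_var R k \<noteq> \<zero>}"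
    by (rule finite_subset[of _ "{1}"]) (auto simp: laurent_var_def)
  then show ?thesis by (auto simp: laurent_ring_simps laurent_var_def)
qed

lemma laurent_var_Unit: "laurent_var R \<in> Units (laurent_ring R)"
proof -
  interpret L: cring "laurent_ring R" by (rule cring_laurent_ring)
  define p where "p = (\<lambda>k::int. if k = -1 then \<one> else \<zero>)"
  have "finite {k. p k \<noteq> \<zero>}"
    by (rule finite_subset[of _ "{-1}"]) (auto simp: p_def)
  then have p: "p \<in> carrier (laurent_ring R)" by (auto simp: laurent_ring_simps p_def)
  have "laurent_var R \<otimes>\<^bsub>laurent_ring R\<^esub> p = \<one>\<^bsub>laurent_ring R\<^esub>"
  proof
    fix k
    have "(laurent_var R \<otimes>\<^bsub>laurent_ring R\<^esub> p) k = (\<Oplus>l\<in>{1}. laurent_var R l \<otimes> p (k - l))"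
      by (rule laurent_mult_eq) (use p laurent_var_closed in \<open>auto simp: laurent_var_def split: if_splits\<close>)
    then show "(laurent_var R \<otimes>\<^bsub>laurent_ring R\<^esub> p) k = \<one>\<^bsub>laurent_ring R\<^esub> k"
      by (auto simp: finsum_insert finsum_empty laurent_var_def p_def laurent_ring_simps)
  qed
  then show ?thesis
    using p laurent_var_closed L.m_comm unfolding Units_def by force
qed

end


section \<open>Free modules, quotient modules and restriction of scalars\<close>

lemma free_module_simps:
  "carrier (free_module R) = {f. (\<forall>s. f s \<in> carrier R) \<and> finite {s. f s \<noteq> \<zero>\<^bsub>R\<^esub>}}"
  "\<zero>\<^bsub>free_module R\<^esub> = (\<lambda>s. \<zero>\<^bsub>R\<^esub>)"
  "f \<oplus>\<^bsub>free_module R\<^esub> g = (\<lambda>s. f s \<oplus>\<^bsub>R\<^esub> g s)"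
  "r \<odot>\<^bsub>free_module R\<^esub> f = (\<lambda>s. r \<otimes>\<^bsub>R\<^esub> f s)"
  by (simp_all add: free_module_def)

context cring
begin

lemma module_free_module: "module R (free_module R :: ('a, 's \<Rightarrow> 'a) module)"
proof (rule moduleI)
  let ?F = "free_module R :: ('a, 's \<Rightarrow> 'a) module"
  show "abelian_group ?F"
  proof (rule abelian_groupI)
    fix f g assume fg: "f \<in> carrier ?F" "g \<in> carrier ?F"
    have "finite {s. f s \<oplus> g s \<noteq> \<zero>}"
      by (rule finite_subset[of _ "{s. f s \<noteq> \<zero>} \<union> {s. g s \<noteq> \<zero>}"])
        (use fg in \<open>auto simp: free_module_simps\<close>)
    then show "f \<oplus>\<^bsub>?F\<^esub> g \<in> carrier ?F"
      using fg by (auto simp: free_module_simps)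
    show "f \<oplus>\<^bsub>?F\<^esub> g = g \<oplus>\<^bsub>?F\<^esub> f"
      using fg by (auto simp: free_module_simps a_comm)
  next
    fix f assume f: "f \<in> carrier ?F"
    have "finite {s. \<ominus> f s \<noteq> \<zero>}"
      by (rule finite_subset[of _ "{s. f s \<noteq> \<zero>}"]) (use f in \<open>auto simp: free_module_simps\<close>)
    then show "\<exists>g\<in>carrier ?F. g \<oplus>\<^bsub>?F\<^esub> f = \<zero>\<^bsub>?F\<^esub>"
      using f by (intro bexI[of _ "\<lambda>s. \<ominus> f s"]) (auto simp: free_module_simps l_neg)
  qed (auto simp: free_module_simps a_assoc)
  fix r f assume rf: "r \<in> carrier R" "f \<in> carrier ?F"
  have "finite {s. r \<otimes> f s \<noteq> \<zero>}"
    by (rule finite_subset[of _ "{s. f s \<noteq> \<zero>}"]) (use rf in \<open>auto simp: free_module_simps\<close>)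
  then show "r \<odot>\<^bsub>?F\<^esub> f \<in> carrier ?F"
    using rf by (auto simp: free_module_simps)
qed (auto simp: free_module_simps is_cring l_distr r_distr m_assoc)

lemma free_gen_closed: "free_gen R s \<in> carrier (free_module R)"
proof -
  have "finite {t. free_gen R s t \<noteq> \<zero>}"
    by (rule finite_subset[of _ "{s}"]) (auto simp: free_gen_def)
  then show ?thesis by (auto simp: free_module_simps free_gen_def)
qed

end

lemma (in module) free_module_lift:
  fixes v :: "'s \<Rightarrow> 'c"
  assumes v: "\<And>s. v s \<in> carrier M"
  obtains \<phi> where "\<phi> \<in> mod_hom R (free_module R) M" "\<And>s. \<phi> (free_gen R s) = v s"
proof
  let ?F = "free_module R :: ('a, 's \<Rightarrow> 'a) module"
  interpret F: module R ?F by (rule R.module_free_module)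
  define \<phi> where "\<phi> = (\<lambda>f. \<Oplus>\<^bsub>M\<^esub>s\<in>{s. f s \<noteq> \<zero>}. f s \<odot>\<^bsub>M\<^esub> v s)"
  \<comment> \<open>The support of a sum or of a multiple may be smaller than expected, so
    additivity and linearity are checked over a larger common set.\<close>
  have \<phi>_eq: "\<phi> f = (\<Oplus>\<^bsub>M\<^esub>s\<in>A. f s \<odot>\<^bsub>M\<^esub> v s)"
    if "f \<in> carrier ?F" "finite A" "{s. f s \<noteq> \<zero>} \<subseteq> A" for f A
    unfolding \<phi>_def
    by (rule M.add.finprod_mono_neutral_cong_left) (use that v in \<open>auto simp: free_module_simps\<close>)
  show "\<phi> \<in> mod_hom R ?F M"
    unfolding mod_hom_def
  proof (intro CollectI conjI ballI)
    show "\<phi> \<in> carrier ?F \<rightarrow> carrier M"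
      using v by (auto simp: \<phi>_def free_module_simps intro!: M.finsum_closed)
    fix f g assume fg: "f \<in> carrier ?F" "g \<in> carrier ?F"
    define A where "A = {s. f s \<noteq> \<zero>} \<union> {s. g s \<noteq> \<zero>}"
    have A: "finite A" using fg by (auto simp: A_def free_module_simps)
    have c: "\<And>s. f s \<in> carrier R" "\<And>s. g s \<in> carrier R"
      using fg by (auto simp: free_module_simps)
    have "\<phi> (f \<oplus>\<^bsub>?F\<^esub> g) = (\<Oplus>\<^bsub>M\<^esub>s\<in>A. (f \<oplus>\<^bsub>?F\<^esub> g) s \<odot>\<^bsub>M\<^esub> v s)"
      by (rule \<phi>_eq[OF F.a_closed[OF fg] A]) (auto simp: A_def free_module_simps(3))
    also have "\<dots> = (\<Oplus>\<^bsub>M\<^esub>s\<in>A. f s \<odot>\<^bsub>M\<^esub> v s \<oplus>\<^bsub>M\<^esub> g s \<odot>\<^bsub>M\<^esub> v s)"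
      using c v by (intro M.finsum_cong') (auto simp: free_module_simps smult_l_distr)
    also have "\<dots> = (\<Oplus>\<^bsub>M\<^esub>s\<in>A. f s \<odot>\<^bsub>M\<^esub> v s) \<oplus>\<^bsub>M\<^esub> (\<Oplus>\<^bsub>M\<^esub>s\<in>A. g s \<odot>\<^bsub>M\<^esub> v s)"
      using c v by (intro M.finsum_addf) auto
    also have "\<dots> = \<phi> f \<oplus>\<^bsub>M\<^esub> \<phi> g"
      using \<phi>_eq[OF fg(1) A] \<phi>_eq[OF fg(2) A] by (auto simp: A_def)
    finally show "\<phi> (f \<oplus>\<^bsub>?F\<^esub> g) = \<phi> f \<oplus>\<^bsub>M\<^esub> \<phi> g" .
  next
    fix r f assume rf: "r \<in> carrier R" "f \<in> carrier ?F"
    define A where "A = {s. f s \<noteq> \<zero>}"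
    have A: "finite A" and c: "\<And>s. f s \<in> carrier R"
      using rf by (auto simp: A_def free_module_simps)
    have "\<phi> (r \<odot>\<^bsub>?F\<^esub> f) = (\<Oplus>\<^bsub>M\<^esub>s\<in>A. (r \<odot>\<^bsub>?F\<^esub> f) s \<odot>\<^bsub>M\<^esub> v s)"
      by (rule \<phi>_eq[OF F.smult_closed[OF rf] A]) (use rf in \<open>auto simp: A_def free_module_simps(4)\<close>)
    also have "\<dots> = (\<Oplus>\<^bsub>M\<^esub>s\<in>A. r \<odot>\<^bsub>M\<^esub> (f s \<odot>\<^bsub>M\<^esub> v s))"
      using rf c v by (intro M.finsum_cong') (auto simp: free_module_simps smult_assoc1)
    also have "\<dots> = r \<odot>\<^bsub>M\<^esub> \<phi> f"
      unfolding \<phi>_def A_def[symmetric] using A rf c v by (intro finsum_smult_ldistr[symmetric]) auto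
    finally show "\<phi> (r \<odot>\<^bsub>?F\<^esub> f) = r \<odot>\<^bsub>M\<^esub> \<phi> f" .
  qed
  fix s
  have "\<phi> (free_gen R s) = (\<Oplus>\<^bsub>M\<^esub>t\<in>{s}. free_gen R s t \<odot>\<^bsub>M\<^esub> v t)"
    by (rule \<phi>_eq) (auto simp: R.free_gen_closed, simp add: free_gen_def split: if_splits)
  then show "\<phi> (free_gen R s) = v s"
    using v[of s] by (simp add: free_gen_def M.finsum_insert M.finsum_empty)
qed

section \<open>Quotient modules and their universal property\<close>

lemma quot_module_simps:
  "carrier (quot_module M N) = a_rcosets\<^bsub>M\<^esub> N"
  "\<zero>\<^bsub>quot_module M N\<^esub> = N"
  "Z \<oplus>\<^bsub>quot_module M N\<^esub> Z' = Z <+>\<^bsub>M\<^esub> Z'"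
  by (simp_all add: quot_module_def)

context module
begin

lemma submodule_abelian_subgroup:
  assumes "submodule N R M"
  shows "abelian_subgroup N M"
  using assms M.abelian_group_axioms
  by (intro abelian_subgroupI3 additive_subgroupI) (auto simp: submodule_def)

lemma quot_module_coset:
  assumes "submodule N R M" "x \<in> carrier M"
  shows "N +>\<^bsub>M\<^esub> x \<in> carrier (quot_module M N)"
  using assms submoduleE(1)[OF assms(1)]
  by (simp add: quot_module_simps M.a_rcosetsI)

lemma quot_module_cases:
  assumes "Z \<in> carrier (quot_module M N)"
  obtains x where "x \<in> carrier M" "Z = N +>\<^bsub>M\<^esub> x"
  using assms by (auto simp: quot_module_simps A_RCOSETS_def')

lemma quot_module_add_coset:
  assumes "submodule N R M" "x \<in> carrier M" "y \<in> carrier M"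
  shows "(N +>\<^bsub>M\<^esub> x) \<oplus>\<^bsub>quot_module M N\<^esub> (N +>\<^bsub>M\<^esub> y) = N +>\<^bsub>M\<^esub> (x \<oplus>\<^bsub>M\<^esub> y)"
  using abelian_subgroup.a_rcos_sum[OF submodule_abelian_subgroup[OF assms(1)] assms(2,3)]
  by (simp add: quot_module_simps)

lemma coset_eqI:
  assumes "submodule N R M" "x \<in> carrier M" "y \<in> N +>\<^bsub>M\<^esub> x"
  shows "N +>\<^bsub>M\<^esub> y = N +>\<^bsub>M\<^esub> x"
  using M.a_repr_independence[OF assms(3,2)] assms(1) by (simp add: submodule_def)

text \<open>In \<open>quot_module\<close> the action is a union over all representatives, so
  computing it means showing that all cosets in the union coincide: for y = n + x with n in N, the
  elements r y and r x differ by r n, which lies in N.\<close>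

lemma quot_module_smult_coset:
  assumes N: "submodule N R M" and r: "r \<in> carrier R" and x: "x \<in> carrier M"
  shows "r \<odot>\<^bsub>quot_module M N\<^esub> (N +>\<^bsub>M\<^esub> x) = N +>\<^bsub>M\<^esub> (r \<odot>\<^bsub>M\<^esub> x)"
proof -
  interpret N: abelian_subgroup N M by (rule submodule_abelian_subgroup[OF N])
  have "N +>\<^bsub>M\<^esub> (r \<odot>\<^bsub>M\<^esub> y) = N +>\<^bsub>M\<^esub> (r \<odot>\<^bsub>M\<^esub> x)" if y: "y \<in> N +>\<^bsub>M\<^esub> x" for y
  proof -
    obtain n where n: "n \<in> N" "y = n \<oplus>\<^bsub>M\<^esub> x"
      using y unfolding a_r_coset_def' by blast
    have "n \<in> carrier M" by (rule subsetD[OF submoduleE(1)[OF N] n(1)])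
    then have "r \<odot>\<^bsub>M\<^esub> y = r \<odot>\<^bsub>M\<^esub> n \<oplus>\<^bsub>M\<^esub> r \<odot>\<^bsub>M\<^esub> x"
      using n r x by (simp add: smult_r_distr)
    moreover have "r \<odot>\<^bsub>M\<^esub> n \<in> N" using submoduleE(4)[OF N r n(1)] .
    ultimately have "r \<odot>\<^bsub>M\<^esub> y \<in> N +>\<^bsub>M\<^esub> (r \<odot>\<^bsub>M\<^esub> x)"
      unfolding a_r_coset_def' by blast
    then show ?thesis by (rule coset_eqI[OF N smult_closed[OF r x]])
  qed
  moreover have "x \<in> N +>\<^bsub>M\<^esub> x" using x by (rule N.a_rcos_self)
  ultimately have "(\<Union>y\<in>N +>\<^bsub>M\<^esub> x. N +>\<^bsub>M\<^esub> (r \<odot>\<^bsub>M\<^esub> y)) = N +>\<^bsub>M\<^esub> (r \<odot>\<^bsub>M\<^esub> x)"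
    by blast
  then show ?thesis by (simp add: quot_module_def)
qed

lemma module_quot_module:
  assumes N: "submodule N R M"
  shows "module R (quot_module M N)"
proof (rule moduleI)
  let ?Q = "quot_module M N"
  interpret N: abelian_subgroup N M by (rule submodule_abelian_subgroup[OF N])
  \<comment> \<open>The additive part of the quotient is the factor group \<open>M A_Mod N\<close>
    in another record, so its group axioms carry over; only the laws of the scalar action are
    checked by hand.\<close>
  interpret A: comm_group "M A_Mod N" by (rule N.a_factorgroup_is_comm_group)
  have A: "carrier (M A_Mod N) = carrier ?Q" "monoid.mult (M A_Mod N) = add ?Q" "one (M A_Mod N) = \<zero>\<^bsub>?Q\<^esub>"
    by (simp_all add: A_FactGroup_def' quot_module_def)
  show "abelian_group ?Q"
    using A.m_closed A.m_assoc A.m_comm A.one_closed A.l_one A.l_inv_ex unfolding A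
    by (intro abelian_groupI) auto
  note Q = quot_module_add_coset[OF N] quot_module_smult_coset[OF N] quot_module_coset[OF N]
  show "cring R" by (rule R.is_cring)
  fix r r' Z Z' assume r: "r \<in> carrier R" "Z \<in> carrier ?Q"
  obtain x where x: "x \<in> carrier M" "Z = N +>\<^bsub>M\<^esub> x" using r(2) by (rule quot_module_cases)
  show "r \<odot>\<^bsub>?Q\<^esub> Z \<in> carrier ?Q"
    using r x by (simp add: Q)
  show "r \<odot>\<^bsub>?Q\<^esub> (Z \<oplus>\<^bsub>?Q\<^esub> Z') = r \<odot>\<^bsub>?Q\<^esub> Z \<oplus>\<^bsub>?Q\<^esub> r \<odot>\<^bsub>?Q\<^esub> Z'" if Z': "Z' \<in> carrier ?Q"
  proof -
    obtain y where "y \<in> carrier M" "Z' = N +>\<^bsub>M\<^esub> y" using Z' by (rule quot_module_cases)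
    then show ?thesis using r x by (simp add: Q smult_r_distr)
  qed
  assume r': "r' \<in> carrier R"
  show "(r \<oplus> r') \<odot>\<^bsub>?Q\<^esub> Z = r \<odot>\<^bsub>?Q\<^esub> Z \<oplus>\<^bsub>?Q\<^esub> r' \<odot>\<^bsub>?Q\<^esub> Z"
    and "(r \<otimes> r') \<odot>\<^bsub>?Q\<^esub> Z = r \<odot>\<^bsub>?Q\<^esub> (r' \<odot>\<^bsub>?Q\<^esub> Z)"
    using r r' x by (simp_all add: Q smult_l_distr smult_assoc1)
next
  fix Z assume "Z \<in> carrier (quot_module M N)"
  then obtain x where "x \<in> carrier M" "Z = N +>\<^bsub>M\<^esub> x" by (rule quot_module_cases)
  then show "\<one> \<odot>\<^bsub>quot_module M N\<^esub> Z = Z"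
    by (simp add: quot_module_smult_coset[OF N])
qed

lemma quot_module_lift:
  assumes N: "submodule N R M" and K: "module R K"
    and \<phi>: "\<phi> \<in> mod_hom R M K" and ker: "\<And>x. x \<in> N \<Longrightarrow> \<phi> x = \<zero>\<^bsub>K\<^esub>"
  obtains \<psi> where "\<psi> \<in> mod_hom R (quot_module M N) K"
    "\<And>x. x \<in> carrier M \<Longrightarrow> \<psi> (N +>\<^bsub>M\<^esub> x) = \<phi> x"
proof
  interpret K: module R K by (rule K)
  interpret N: abelian_subgroup N M by (rule submodule_abelian_subgroup[OF N])
  \<comment> \<open>The representative is arbitrary; \<open>ker\<close> makes the value independent
    of it.\<close>
  define \<psi> where "\<psi> = (\<lambda>Z. \<phi> (SOME x. x \<in> Z))"
  have cl: "\<phi> x \<in> carrier K" if "x \<in> carrier M" for x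
    using \<phi> that by (auto simp: mod_hom_def)
  show \<psi>: "\<psi> (N +>\<^bsub>M\<^esub> x) = \<phi> x" if x: "x \<in> carrier M" for x
  proof -
    have "(SOME y. y \<in> N +>\<^bsub>M\<^esub> x) \<in> N +>\<^bsub>M\<^esub> x"
      using N.a_rcos_self[OF x] by (rule someI)
    then obtain n where n: "n \<in> N" "(SOME y. y \<in> N +>\<^bsub>M\<^esub> x) = n \<oplus>\<^bsub>M\<^esub> x"
      by (auto simp: a_r_coset_def')
    have "n \<in> carrier M" using n submoduleE(1)[OF N] by auto
    then have "\<phi> (n \<oplus>\<^bsub>M\<^esub> x) = \<phi> n \<oplus>\<^bsub>K\<^esub> \<phi> x"
      using \<phi> x by (auto simp: mod_hom_def)
    then show ?thesis using n ker[OF n(1)] cl[OF x] by (simp add: \<psi>_def)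
  qed
  note Q = quot_module_add_coset[OF N] quot_module_smult_coset[OF N]
  show "\<psi> \<in> mod_hom R (quot_module M N) K"
    unfolding mod_hom_def
  proof (intro CollectI conjI ballI funcsetI)
    fix Z assume "Z \<in> carrier (quot_module M N)"
    then obtain x where x: "x \<in> carrier M" "Z = N +>\<^bsub>M\<^esub> x" by (rule quot_module_cases)
    show "\<psi> Z \<in> carrier K" using x cl \<psi> by simp
    { fix Z' assume "Z' \<in> carrier (quot_module M N)"
      then obtain y where "y \<in> carrier M" "Z' = N +>\<^bsub>M\<^esub> y" by (rule quot_module_cases)
      then show "\<psi> (Z \<oplus>\<^bsub>quot_module M N\<^esub> Z') = \<psi> Z \<oplus>\<^bsub>K\<^esub> \<psi> Z'"
        using x \<phi> by (simp add: Q \<psi>) (simp add: mod_hom_def) }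
    fix r assume "r \<in> carrier R"
    then show "\<psi> (r \<odot>\<^bsub>quot_module M N\<^esub> Z) = r \<odot>\<^bsub>K\<^esub> \<psi> Z"
      using x \<phi> by (simp add: Q \<psi>) (simp add: mod_hom_def)
  qed
qed

text \<open>Nonemptiness matters because the empty intersection is the whole type rather than
  \<open>carrier M\<close>.\<close>

lemma submodule_Inter:
  assumes "\<A> \<noteq> {}" "\<And>N. N \<in> \<A> \<Longrightarrow> submodule N R M"
  shows "submodule (\<Inter>\<A>) R M"
proof (rule submoduleI)
  note E = submoduleE[OF assms(2)]
  show "\<Inter>\<A> \<subseteq> carrier M" using assms(1) E(1) by blast
  show "\<zero>\<^bsub>M\<^esub> \<in> \<Inter>\<A>"
    using subgroup.one_closed[OF submodule.axioms(1)[OF assms(2)]] by simp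
  show "\<ominus>\<^bsub>M\<^esub> x \<in> \<Inter>\<A>" if "x \<in> \<Inter>\<A>" for x
    using that E(3) by simp
  show "x \<oplus>\<^bsub>M\<^esub> y \<in> \<Inter>\<A>" if "x \<in> \<Inter>\<A>" "y \<in> \<Inter>\<A>" for x y
    using that E(5) by simp
  show "r \<odot>\<^bsub>M\<^esub> x \<in> \<Inter>\<A>" if "r \<in> carrier R" "x \<in> \<Inter>\<A>" for r x
    using that E(4) by simp
qed

text \<open>The family intersected by the hull is not empty: \<open>carrier M\<close> is a submodule
  that contains \<open>S\<close>.\<close>

lemma submodule_hull:
  assumes "S \<subseteq> carrier M"
  shows "submodule ((\<lambda>N. submodule N R M) hull S) R M"
  unfolding hull_def
  by (rule submodule_Inter) (use assms carrier_is_submodule in auto)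

lemma mod_hom_zero:
  assumes "module R K" "\<phi> \<in> mod_hom R M K"
  shows "\<phi> \<zero>\<^bsub>M\<^esub> = \<zero>\<^bsub>K\<^esub>"
proof -
  interpret K: module R K by fact
  have "\<phi> (\<zero> \<odot>\<^bsub>M\<^esub> \<zero>\<^bsub>M\<^esub>) = \<zero> \<odot>\<^bsub>K\<^esub> \<phi> \<zero>\<^bsub>M\<^esub>" "\<phi> \<zero>\<^bsub>M\<^esub> \<in> carrier K"
    using assms(2) by (auto simp: mod_hom_def simp del: smult_l_null smult_r_null)
  then show ?thesis by simp
qed

lemma mod_hom_uminus:
  assumes "module R K" "\<phi> \<in> mod_hom R M K" "x \<in> carrier M"
  shows "\<phi> (\<ominus>\<^bsub>M\<^esub> x) = \<ominus>\<^bsub>K\<^esub> \<phi> x"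
proof -
  interpret K: module R K by fact
  have "\<phi> (\<ominus>\<^bsub>M\<^esub> x) \<oplus>\<^bsub>K\<^esub> \<phi> x = \<phi> (\<ominus>\<^bsub>M\<^esub> x \<oplus>\<^bsub>M\<^esub> x)"
    using assms(2,3) by (auto simp: mod_hom_def)
  also have "\<dots> = \<zero>\<^bsub>K\<^esub>"
    using assms mod_hom_zero by (simp add: M.l_neg)
  finally show ?thesis
    using assms(2,3) by (intro K.minus_equality[symmetric]) (auto simp: mod_hom_def)
qed

text \<open>Together with \<open>hull_minimal\<close> this reduces the vanishing of a linear map on
  a generated submodule to its vanishing on the generators.\<close>

lemma submodule_mod_hom_kernel:
  assumes "module R K" "\<phi> \<in> mod_hom R M K"
  shows "submodule {x \<in> carrier M. \<phi> x = \<zero>\<^bsub>K\<^esub>} R M"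
proof -
  interpret K: module R K by fact
  show ?thesis
    using assms
    by (intro submoduleI) (auto simp: mod_hom_zero mod_hom_uminus, auto simp: mod_hom_def)
qed

end

text \<open>Applied to the embedding of Y into Y_{i,h} followed by reduction modulo h, it makes the
  quotient ring a module over Y.\<close>

lemma (in cring) module_restrict_scalars:
  assumes "cring S" "\<epsilon> \<in> ring_hom R S"
  shows "module R (ring.extend S \<lparr>smult = \<lambda>r x. \<epsilon> r \<otimes>\<^bsub>S\<^esub> x\<rparr>)" (is "module R ?M")
proof -
  interpret S: cring S by fact
  have [simp]: "carrier ?M = carrier S" "add ?M = add S" "\<zero>\<^bsub>?M\<^esub> = \<zero>\<^bsub>S\<^esub>"
    "smult ?M = (\<lambda>r x. \<epsilon> r \<otimes>\<^bsub>S\<^esub> x)"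
    by (simp_all add: ring.defs)
  have "abelian_group ?M"
    using S.a_assoc S.a_comm S.l_neg by (intro abelian_groupI) auto
  then show ?thesis
    using ring_hom_closed[OF assms(2)] ring_hom_add[OF assms(2)] ring_hom_mult[OF assms(2)]
      ring_hom_one[OF assms(2)]
    by (intro moduleI is_cring) (auto simp: S.l_distr S.r_distr S.m_assoc)
qed


section \<open>Arithmetic of nonzero complex numbers\<close>

lemma Rep_cstar_power: "Rep_cstar (x ^ n) = Rep_cstar x ^ n"
  by (induction n) (simp_all add: one_cstar.rep_eq times_cstar.rep_eq)

lemma Rep_cstar_power_int: "Rep_cstar (x powi n) = Rep_cstar x powi n"
  by (simp add: power_int_def Rep_cstar_power inverse_cstar.rep_eq)

lemma Rep_cstar_nonzero: "Rep_cstar x \<noteq> 0"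
  using Rep_cstar by auto

lemmas Rep_cstar_simps = Rep_cstar_inject[symmetric] Rep_cstar_power Rep_cstar_power_int
  times_cstar.rep_eq divide_cstar.rep_eq one_cstar.rep_eq Rep_cstar_nonzero

text \<open>The type \<open>cstar\<close> is only a commutative monoid with inverse operations, so
  the identities are checked in the complex numbers. They are the shifts of the spectral parameter
  met in the recursion of Sigma, in the formulas for Theta and in the defining relation of
  Y_i.\<close>

lemma cstar_shift:
  fixes a Q :: cstar
  shows "a / Q / Q ^ 2 = a / Q ^ 3" "a * Q ^ 2 / Q = a * Q" "a * Q / Q ^ 2 = a / Q"
    "a * Q powi (2 - 2 * int (Suc j)) = a / Q ^ 2 * Q powi (2 - 2 * int j)"
    "a * Q powi (2 - 2 * int 1) = a"
proof -
  have "Rep_cstar Q powi (2 - 2 * int (Suc j)) = Rep_cstar Q powi ((2 - 2 * int j) - 2)"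
    by simp
  also have "\<dots> = Rep_cstar Q powi (2 - 2 * int j) / Rep_cstar Q ^ 2"
    by (subst power_int_diff) (simp_all add: Rep_cstar_nonzero)
  finally show "a * Q powi (2 - 2 * int (Suc j)) = a / Q ^ 2 * Q powi (2 - 2 * int j)"
    by (simp add: Rep_cstar_simps)
qed (simp_all add: Rep_cstar_simps power2_eq_square power3_eq_cube field_simps)


section \<open>Rings of formal series\<close>

text \<open>The counterpart of \<open>laurent_mult_eq\<close> for series: convolutions are compared
  over any finite set large enough for both.\<close>

lemma conv_eq_sum:
  assumes "finite K" "\<And>u. f u \<noteq> 0 \<Longrightarrow> g (m - u) \<noteq> 0 \<Longrightarrow> u \<in> K"
  shows "conv f g m = (\<Sum>u\<in>K. f u * g (m - u))"
  unfolding conv_def by (rule sum.mono_neutral_left) (use assms in auto)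

lemma conv_nonzeroE:
  assumes "conv f g m \<noteq> 0"
  obtains u where "f u \<noteq> 0" "g (m - u) \<noteq> 0"
proof -
  have "{u. f u \<noteq> 0 \<and> g (m - u) \<noteq> 0} \<noteq> {}"
    using assms unfolding conv_def by (metis sum.empty)
  then show ?thesis using that by blast
qed

lemma conv_mseries: "conv (mseries u) g = (\<lambda>m. g (m - u))"
proof
  fix m
  have "conv (mseries u) g m = (\<Sum>v\<in>{u}. mseries u v * g (m - v))"
    by (rule conv_eq_sum) (auto simp: mseries_def split: if_splits)
  then show "conv (mseries u) g m = g (m - u)" by (simp add: mseries_def)
qed

lemma conv_mseries_mseries: "conv (mseries u) (mseries v) = mseries (u + v)"
  by (simp only: conv_mseries) (simp add: mseries_def fun_eq_iff diff_eq_eq add.commute)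

text \<open>Both \<open>Y_ring\<close> and \<open>Ye_ring C\<close> consist of all series whose
  support belongs to a certain family of sets, with the same operations. With the family as a
  parameter, one proof gives the ring axioms of both.\<close>

definition series_ring :: "'n monomial set set \<Rightarrow> 'n series ring" where
  "series_ring \<S> = Y_ring\<lparr>carrier := {f. {m. f m \<noteq> 0} \<in> \<S>}\<rparr>"

lemma series_ring_simps:
  "carrier (series_ring \<S>) = {f. {m. f m \<noteq> 0} \<in> \<S>}"
  "f \<otimes>\<^bsub>series_ring \<S>\<^esub> g = conv f g"
  "f \<oplus>\<^bsub>series_ring \<S>\<^esub> g = (\<lambda>m. f m + g m)"
  "\<one>\<^bsub>series_ring \<S>\<^esub> = mseries 0"
  "\<zero>\<^bsub>series_ring \<S>\<^esub> = (\<lambda>m. 0)"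
  by (simp_all add: series_ring_def Y_ring_def)

text \<open>What a family of supports must satisfy for convolution to define a ring: it is an ideal
  of sets, contains the finite ones, is closed under sumsets, and leaves each monomial only finitely
  many decompositions. The last condition is what makes \<open>conv\<close> meaningful, since a sum
  over an infinite set is 0 by convention.\<close>

locale support_family =
  fixes \<S> :: "'n monomial set set"
  assumes finite_mem: "finite S \<Longrightarrow> S \<in> \<S>"
    and subset_mem: "S \<in> \<S> \<Longrightarrow> T \<subseteq> S \<Longrightarrow> T \<in> \<S>"
    and Un_mem: "S \<in> \<S> \<Longrightarrow> T \<in> \<S> \<Longrightarrow> S \<union> T \<in> \<S>"
    and plus_mem: "S \<in> \<S> \<Longrightarrow> T \<in> \<S> \<Longrightarrow> (\<lambda>(u, v). u + v) ` (S \<times> T) \<in> \<S>"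
    and finite_decompositions: "S \<in> \<S> \<Longrightarrow> T \<in> \<S> \<Longrightarrow> finite {u \<in> S. m - u \<in> T}"
begin

abbreviation "R \<equiv> series_ring \<S>"

lemma conv_closed:
  assumes "f \<in> carrier R" "g \<in> carrier R"
  shows "conv f g \<in> carrier R"
proof -
  have "{m. conv f g m \<noteq> 0} \<subseteq> (\<lambda>(u, v). u + v) ` ({m. f m \<noteq> 0} \<times> {m. g m \<noteq> 0})"
  proof
    fix m assume "m \<in> {m. conv f g m \<noteq> 0}"
    then obtain u where "f u \<noteq> 0" "g (m - u) \<noteq> 0" by (auto elim: conv_nonzeroE)
    then show "m \<in> (\<lambda>(u, v). u + v) ` ({m. f m \<noteq> 0} \<times> {m. g m \<noteq> 0})"
      by (intro image_eqI[of _ _ "(u, m - u)"]) auto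
  qed
  then show ?thesis
    using assms by (auto simp: series_ring_simps intro: subset_mem plus_mem)
qed

lemma conv_comm:
  assumes "f \<in> carrier R" "g \<in> carrier R"
  shows "conv f g = conv g f"
proof
  fix m
  define K where "K = {u \<in> {m. g m \<noteq> 0}. m - u \<in> {m. f m \<noteq> 0}}"
  have K: "finite K"
    unfolding K_def by (rule finite_decompositions) (use assms in \<open>auto simp: series_ring_simps\<close>)
  have "conv f g m = (\<Sum>u\<in>(\<lambda>u. m - u) ` K. f u * g (m - u))"
  proof (rule conv_eq_sum)
    show "u \<in> (\<lambda>u. m - u) ` K" if "f u \<noteq> 0" "g (m - u) \<noteq> 0" for u
      using that by (intro image_eqI[of _ _ "m - u"]) (auto simp: K_def)
  qed (use K in simp)
  also have "\<dots> = (\<Sum>u\<in>K. f (m - u) * g (m - (m - u)))"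
    by (subst sum.reindex) (auto simp: inj_on_def)
  also have "\<dots> = (\<Sum>u\<in>K. g u * f (m - u))"
    by (simp add: mult.commute)
  also have "\<dots> = conv g f m"
    by (rule conv_eq_sum[symmetric]) (use K in \<open>auto simp: K_def\<close>)
  finally show "conv f g m = conv g f m" .
qed

lemma conv_assoc:
  assumes f: "f \<in> carrier R" and g: "g \<in> carrier R" and h: "h \<in> carrier R"
  shows "conv (conv f g) h = conv f (conv g h)"
proof
  fix m
  define S T U where "S = {m. f m \<noteq> 0}" and "T = {m. g m \<noteq> 0}" and "U = {m. h m \<noteq> 0}"
  have mem: "S \<in> \<S>" "T \<in> \<S>" "U \<in> \<S>"
    using f g h by (auto simp: series_ring_simps S_def T_def U_def)
  \<comment> \<open>Decompositions of \<open>m\<close> into three monomials, bracketed in two ways: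
    \<open>W\<close> and \<open>A\<close> first split off the last monomial and then divide
    \<open>w\<close> into \<open>u\<close> and \<open>w - u\<close>, whereas \<open>B\<close> and
    \<open>D\<close> split off \<open>u\<close> and then \<open>v\<close>. The two index sets
    correspond by w = u + v.\<close>
  define W where "W = {w \<in> (\<lambda>(u, v). u + v) ` (S \<times> T). m - w \<in> U}"
  define A where "A w = {u \<in> S. w - u \<in> T}" for w
  define B where "B = {u \<in> S. m - u \<in> (\<lambda>(u, v). u + v) ` (T \<times> U)}"
  define D where "D u = {v \<in> T. m - u - v \<in> U}" for u
  have fin: "finite W" "finite (A w)" "finite B" "finite (D u)" for w u
    unfolding W_def A_def B_def D_def using mem plus_mem finite_decompositions by blast+
  have "conv (conv f g) h m = (\<Sum>w\<in>W. conv f g w * h (m - w))"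
  proof (rule conv_eq_sum[OF fin(1)])
    fix w assume "conv f g w \<noteq> 0" "h (m - w) \<noteq> 0"
    moreover from this obtain u where "f u \<noteq> 0" "g (w - u) \<noteq> 0" by (auto elim: conv_nonzeroE)
    ultimately show "w \<in> W"
      unfolding W_def S_def T_def U_def by (auto intro!: image_eqI[of _ _ "(u, w - u)"])
  qed
  also have "\<dots> = (\<Sum>w\<in>W. \<Sum>u\<in>A w. f u * g (w - u) * h (m - w))"
    by (intro sum.cong refl, subst conv_eq_sum[OF fin(2)])
      (auto simp: A_def S_def T_def sum_distrib_right)
  also have "\<dots> = (\<Sum>(w, u)\<in>Sigma W A. f u * g (w - u) * h (m - w))"
    using fin by (intro sum.Sigma) auto
  also have "\<dots> = (\<Sum>(u, v)\<in>Sigma B D. f u * g v * h (m - u - v))"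
  proof -
    have "(u + v, u) \<in> Sigma W A" if "(u, v) \<in> Sigma B D" for u v
    proof -
      have "u + v \<in> (\<lambda>(u, v). u + v) ` (S \<times> T)"
        using that by (intro image_eqI[of _ _ "(u, v)"]) (auto simp: B_def D_def)
      then show ?thesis
        using that by (auto simp: W_def A_def B_def D_def diff_diff_eq)
    qed
    moreover have "(u, w - u) \<in> Sigma B D" if "(w, u) \<in> Sigma W A" for u w
    proof -
      have "m - u \<in> (\<lambda>(u, v). u + v) ` (T \<times> U)"
        using that by (intro image_eqI[of _ _ "(w - u, m - w)"]) (auto simp: W_def A_def)
      then show ?thesis
        using that by (auto simp: W_def A_def B_def D_def)
    qed
    ultimately show ?thesis
      by (intro sum.reindex_bij_witness[of _ "\<lambda>(u, v). (u + v, u)" "\<lambda>(w, u). (u, w - u)"]) auto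
  qed
  also have "\<dots> = (\<Sum>u\<in>B. \<Sum>v\<in>D u. f u * g v * h (m - u - v))"
    using fin by (intro sum.Sigma[symmetric]) auto
  also have "\<dots> = (\<Sum>u\<in>B. f u * conv g h (m - u))"
    by (intro sum.cong refl, subst conv_eq_sum[OF fin(4)])
      (auto simp: D_def T_def U_def sum_distrib_left mult.assoc)
  also have "\<dots> = conv f (conv g h) m"
  proof (rule conv_eq_sum[OF fin(3), symmetric])
    fix u assume "f u \<noteq> 0" "conv g h (m - u) \<noteq> 0"
    moreover from this obtain v where "g v \<noteq> 0" "h (m - u - v) \<noteq> 0" by (auto elim: conv_nonzeroE)
    ultimately show "u \<in> B"
      unfolding B_def S_def T_def U_def by (auto intro!: image_eqI[of _ _ "(v, m - u - v)"])
  qed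
  finally show "conv (conv f g) h m = conv f (conv g h) m" .
qed

lemma add_closed:
  assumes "f \<in> carrier R" "g \<in> carrier R"
  shows "(\<lambda>m. f m + g m) \<in> carrier R"
proof -
  have "{m. f m + g m \<noteq> 0} \<subseteq> {m. f m \<noteq> 0} \<union> {m. g m \<noteq> 0}" by auto
  then show ?thesis
    using assms unfolding series_ring_simps mem_Collect_eq by (blast intro: subset_mem Un_mem)
qed

lemma conv_add_left:
  assumes f: "f \<in> carrier R" and g: "g \<in> carrier R" and h: "h \<in> carrier R"
  shows "conv (\<lambda>m. f m + g m) h = (\<lambda>m. conv f h m + conv g h m)"
proof
  fix m
  define K where "K = {u \<in> {m. f m \<noteq> 0} \<union> {m. g m \<noteq> 0}. m - u \<in> {m. h m \<noteq> 0}}"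
  have K: "finite K"
    unfolding K_def by (rule finite_decompositions) (use f g h Un_mem in \<open>auto simp: series_ring_simps\<close>)
  have "conv (\<lambda>m. f m + g m) h m = (\<Sum>u\<in>K. (f u + g u) * h (m - u))"
    by (rule conv_eq_sum[OF K]) (auto simp: K_def)
  also have "\<dots> = (\<Sum>u\<in>K. f u * h (m - u)) + (\<Sum>u\<in>K. g u * h (m - u))"
    by (simp add: distrib_right sum.distrib)
  also have "\<dots> = conv f h m + conv g h m"
    by (subst (1 2) conv_eq_sum[OF K]) (auto simp: K_def)
  finally show "conv (\<lambda>m. f m + g m) h m = conv f h m + conv g h m" .
qed

lemma mseries_closed: "mseries u \<in> carrier R"
  by (auto simp: series_ring_simps mseries_def intro: finite_mem)

lemma cring_series_ring: "cring R"
proof (rule cringI)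
  show "abelian_group R"
  proof (rule abelian_groupI)
    fix f assume "f \<in> carrier R"
    then show "\<exists>g\<in>carrier R. g \<oplus>\<^bsub>R\<^esub> f = \<zero>\<^bsub>R\<^esub>"
      by (intro bexI[of _ "\<lambda>m. - f m"]) (auto simp: series_ring_simps)
  qed (use add_closed finite_mem in \<open>auto simp: series_ring_simps\<close>)
  show "Group.comm_monoid R"
    by (rule comm_monoidI)
      (use conv_closed conv_comm conv_assoc mseries_closed in \<open>auto simp: series_ring_simps(2,4) conv_mseries\<close>)
qed (use conv_add_left in \<open>auto simp: series_ring_simps(2,3)\<close>)

end

lemma Y_ring_eq: "Y_ring = series_ring {S. finite S}"
  by (simp add: series_ring_def Y_ring_def)

lemma support_family_finite: "support_family {S. finite S}"
  by unfold_locales (auto intro: finite_subset)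

lemma cring_Y_ring: "cring (Y_ring :: 'n series ring)"
  unfolding Y_ring_eq by (rule support_family.cring_series_ring[OF support_family_finite])

lemma Y_ring_simps:
  "carrier Y_ring = {f. finite {m. f m \<noteq> 0}}"
  "f \<otimes>\<^bsub>Y_ring\<^esub> g = conv f g"
  "f \<oplus>\<^bsub>Y_ring\<^esub> g = (\<lambda>m. f m + g m)"
  "\<one>\<^bsub>Y_ring\<^esub> = mseries 0"
  "\<zero>\<^bsub>Y_ring\<^esub> = (\<lambda>m. 0)"
  by (simp_all add: Y_ring_def)


section \<open>Weights\<close>

text \<open>Exponents can cancel in a product, so the weights of two monomials and of their product
  are computed over one common set of variables.\<close>

lemma weight_eq_sum:
  assumes "finite A" "Poly_Mapping.keys m \<subseteq> A"
  shows "weight m j = (\<Sum>x\<in>{x \<in> A. fst x = j}. Poly_Mapping.lookup m x)"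
  unfolding weight_def
  by (rule sum.mono_neutral_left) (use assms in \<open>auto simp: in_keys_iff\<close>)

lemma weight_add: "weight (m + m') j = weight m j + weight m' j"
proof -
  let ?A = "Poly_Mapping.keys m \<union> Poly_Mapping.keys m'"
  have "finite ?A" "Poly_Mapping.keys (m + m') \<subseteq> ?A" by (auto simp: keys_add)
  then show ?thesis
    by (simp add: weight_eq_sum[of ?A] lookup_add sum.distrib)
qed

lemma weight_zero [simp]: "weight 0 j = 0"
  by (simp add: weight_def)

lemma weight_uminus: "weight (- m) j = - weight m j"
  using weight_add[of m "- m" j] by simp

lemma weight_diff: "weight (m - m') j = weight m j - weight m' j"
  using weight_add[of m "- m'" j] by (simp add: weight_uminus)

lemma weight_sum: "weight (\<Sum>x\<in>A. f x) j = (\<Sum>x\<in>A. weight (f x) j)"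
  by (induction A rule: infinite_finite_induct) (simp_all add: weight_add)

lemma weight_Y_mon: "weight (Y_mon k a) j = (if k = j then 1 else 0)"
proof -
  have "weight (Y_mon k a) j
      = (\<Sum>x\<in>{x \<in> {(k, a)}. fst x = j}. Poly_Mapping.lookup (Y_mon k a) x)"
    by (rule weight_eq_sum) (auto simp: Y_mon_def)
  also have "{x \<in> {(k, a)}. fst x = j} = (if k = j then {(k, a)} else {})" by auto
  finally show ?thesis by (simp add: Y_mon_def)
qed

section \<open>Consequences of the positive definiteness of the Cartan matrix\<close>

lemma simple_cartan_matrix_positive:
  fixes C :: "'n::finite \<Rightarrow> 'n \<Rightarrow> int"
  assumes "simple_cartan_matrix C"
  shows "\<exists>e :: 'n \<Rightarrow> real. (\<forall>i. e i > 0) \<and>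
     (\<forall>i j. e i * of_int (C i j) = e j * of_int (C j i)) \<and>
     (\<forall>x :: 'n \<Rightarrow> real. (\<exists>i. x i \<noteq> 0) \<longrightarrow>
        (\<Sum>i\<in>UNIV. \<Sum>j\<in>UNIV. e i * of_int (C i j) * x i * x j) > 0)"
  using assms unfolding simple_cartan_matrix_def by (elim conjE)

text \<open>The symmetrized form at the vector c equals the sum over i of e_i c_i (C c)_i. This is 0
  when C c = 0, so positive definiteness forces c = 0.\<close>

lemma simple_roots_independent:
  fixes C :: "'n::finite \<Rightarrow> 'n \<Rightarrow> int"
  assumes "simple_cartan_matrix C" "\<And>j. (\<Sum>i\<in>UNIV. c i * C j i) = 0"
  shows "c i = 0"
proof (rule ccontr)
  assume c: "c i \<noteq> 0"
  obtain e :: "'n \<Rightarrow> real" where e: "\<forall>i. e i > 0"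
    "\<forall>i j. e i * of_int (C i j) = e j * of_int (C j i)"
    "\<forall>x :: 'n \<Rightarrow> real. (\<exists>i. x i \<noteq> 0) \<longrightarrow>
       (\<Sum>i\<in>UNIV. \<Sum>j\<in>UNIV. e i * of_int (C i j) * x i * x j) > 0"
    using simple_cartan_matrix_positive[OF assms(1)] by (elim exE conjE)
  let ?x = "\<lambda>i. real_of_int (c i)"
  have "(\<Sum>i\<in>UNIV. \<Sum>j\<in>UNIV. e i * of_int (C i j) * ?x i * ?x j)
      = (\<Sum>i\<in>UNIV. e i * ?x i * of_int (\<Sum>j\<in>UNIV. c j * C i j))"
    unfolding of_int_sum sum_distrib_left by (intro sum.cong refl) (simp add: mult_ac)
  also have "\<dots> = 0" by (simp only: assms(2)) simp
  finally show False using e(3)[rule_format, of ?x] c by auto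
qed

text \<open>The definition of A_{i,a} has factors for the entries -1, -2 and -3 only; this bound
  shows that they exhaust the negative entries. A smaller entry would make the form nonpositive on a
  nonzero vector supported on i and j.\<close>

lemma simple_cartan_matrix_ge:
  fixes C :: "'n::finite \<Rightarrow> 'n \<Rightarrow> int"
  assumes C: "simple_cartan_matrix C"
  shows "C j i \<ge> -3"
proof (rule ccontr)
  assume neg: "\<not> C j i \<ge> -3"
  obtain e :: "'n \<Rightarrow> real" where e: "\<forall>i. e i > 0"
    "\<forall>i j. e i * of_int (C i j) = e j * of_int (C j i)"
    "\<forall>x :: 'n \<Rightarrow> real. (\<exists>i. x i \<noteq> 0) \<longrightarrow>
       (\<Sum>i\<in>UNIV. \<Sum>j\<in>UNIV. e i * of_int (C i j) * x i * x j) > 0"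
    using simple_cartan_matrix_positive[OF C] by (elim exE conjE)
  note sym = e(2)[rule_format] and e_pos = e(1)[rule_format]
  have diag: "C k k = 2" for k using C by (auto simp: simple_cartan_matrix_def)
  have ij: "i \<noteq> j" using neg diag by force
  then have "C i j \<le> 0" "C i j \<noteq> 0"
    using C neg unfolding simple_cartan_matrix_def by force+
  then have Cij: "real_of_int (C i j) \<le> -1" by simp
  define c where "c = - real_of_int (C j i)"
  have c: "c \<ge> 4" using neg by (simp add: c_def)
  have "e i * of_int (C i j) \<le> e i * (-1)" using Cij e_pos[of i] by (intro mult_left_mono) auto
  then have ei: "e i \<le> e j * c" using sym[of i j] by (simp add: c_def)
  \<comment> \<open>For x_i = 1 the form is 2 e_i - 2 e_j c x_j + 2 e_j x_j^2, which is least at x_j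
    = c / 2. Since e_i \<le> e_j c, its value there is at most e_j c (4 - c) / 2, and c \<ge>
    4.\<close>
  define x where "x k = (if k = j then c / 2 else if k = i then 1 else 0)" for k
  have "(\<Sum>k\<in>UNIV. \<Sum>l\<in>UNIV. e k * of_int (C k l) * x k * x l)
      = (\<Sum>k\<in>{i, j}. \<Sum>l\<in>UNIV. e k * of_int (C k l) * x k * x l)"
    by (intro sum.mono_neutral_right) (auto simp: x_def)
  also have "\<dots> = (\<Sum>k\<in>{i, j}. \<Sum>l\<in>{i, j}. e k * of_int (C k l) * x k * x l)"
    by (intro sum.cong refl sum.mono_neutral_right) (auto simp: x_def)
  also have "\<dots> = 2 * e i + e i * of_int (C i j) * (c / 2) + e j * of_int (C j i) * (c / 2)
      + 2 * e j * (c / 2)\<^sup>2"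
    using ij by (simp add: x_def diag power2_eq_square)
  also have "\<dots> = 2 * e i - e j * c\<^sup>2 / 2"
    unfolding sym[of i j] by (simp add: c_def power2_eq_square algebra_simps)
  also have "\<dots> \<le> 2 * (e j * c) - e j * c\<^sup>2 / 2" using ei by simp
  also have "\<dots> = e j * c * (4 - c) / 2" by (simp add: power2_eq_square algebra_simps)
  also have "\<dots> \<le> 0" using c e_pos[of j] by (simp add: mult_nonneg_nonpos)
  moreover have "x i \<noteq> 0" by (simp add: x_def ij)
  ultimately show False using e(3)[rule_format, of x] by force
qed

text \<open>In the basis of fundamental weights this is the simple root \<alpha>_i: an entry -k in
  column i contributes exactly k variables Y_j to the denominator. The grading it induces controls
  all arguments about Sigma.\<close>

lemma weight_A_mon:
  fixes C :: "'n::finite \<Rightarrow> 'n \<Rightarrow> int"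
  assumes C: "simple_cartan_matrix C"
  shows "weight (A_mon C d q i a) j = C j i"
proof -
  have if_sum: "(\<Sum>k | P k. if k = j then x else 0) = (if P j then x else 0)" for P and x :: int
    by (subst sum.delta) auto
  have "weight (A_mon C d q i a) j = (if i = j then 2 else 0)
      - ((if C j i = -1 then 1 else 0) + (if C j i = -2 then 2 else 0) + (if C j i = -3 then 3 else 0))"
    by (simp add: A_mon_def weight_add weight_diff weight_sum weight_Y_mon sum.distrib if_sum)
  moreover have "C i i = 2" "i \<noteq> j \<Longrightarrow> C j i \<le> 0"
    using C by (auto simp: simple_cartan_matrix_def)
  moreover have "C j i \<ge> -3" by (rule simple_cartan_matrix_ge[OF C])
  ultimately show ?thesis by (cases "i = j") auto
qed

section \<open>Decompositions in the cone of nonnegative combinations of simple roots\<close>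

lemma Q_plus_zero: "(\<lambda>j. 0) \<in> Q_plus C"
  unfolding Q_plus_def by (auto intro!: exI[of _ "\<lambda>i. 0"])

lemma Q_plus_add:
  assumes "l \<in> Q_plus C" "l' \<in> Q_plus C"
  shows "(\<lambda>j. l j + l' j) \<in> Q_plus C"
proof -
  obtain c c' :: "'a \<Rightarrow> nat" where "\<And>j. l j = (\<Sum>i\<in>UNIV. int (c i) * C j i)"
    "\<And>j. l' j = (\<Sum>i\<in>UNIV. int (c' i) * C j i)"
    using assms unfolding Q_plus_def by auto
  then show ?thesis
    unfolding Q_plus_def by (auto intro!: exI[of _ "\<lambda>i. c i + c' i"] simp: distrib_right sum.distrib)
qed

lemma finite_functions_le: "finite {c :: 'n::finite \<Rightarrow> nat. \<forall>i. c i \<le> k i}"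
proof -
  have "{c :: 'n \<Rightarrow> nat. \<forall>i. c i \<le> k i} = (\<Pi>\<^sub>E i\<in>UNIV. {..k i})"
    by auto
  then show ?thesis by (simp add: finite_PiE)
qed

text \<open>If g is the sum of two elements of the cone, independence of the simple roots makes
  their coefficients add up to those of g. The coefficients of each summand therefore lie in a
  finite box.\<close>

lemma finite_Q_plus_decompositions:
  fixes C :: "'n::finite \<Rightarrow> 'n \<Rightarrow> int"
  assumes C: "simple_cartan_matrix C"
  shows "finite {l \<in> Q_plus C. (\<lambda>j. g j - l j) \<in> Q_plus C}" (is "finite ?D")
proof (cases "?D = {}")
  case False
  define wt where "wt c = (\<lambda>j. \<Sum>i\<in>UNIV. int (c i) * C j i)" for c :: "'n \<Rightarrow> nat"
  from False obtain l where "l \<in> Q_plus C" "(\<lambda>j. g j - l j) \<in> Q_plus C" by auto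
  then have "(\<lambda>j. l j + (g j - l j)) \<in> Q_plus C" by (rule Q_plus_add)
  then obtain k where k: "\<And>j. g j = (\<Sum>i\<in>UNIV. int (k i) * C j i)"
    unfolding Q_plus_def by auto
  have "?D \<subseteq> wt ` {c. \<forall>i. c i \<le> k i}"
  proof
    fix l assume "l \<in> ?D"
    then obtain c c' where c: "\<And>j. l j = (\<Sum>i\<in>UNIV. int (c i) * C j i)"
      and c': "\<And>j. g j - l j = (\<Sum>i\<in>UNIV. int (c' i) * C j i)"
      unfolding Q_plus_def by auto
    have "int (c i) + int (c' i) - int (k i) = 0" for i
      by (rule simple_roots_independent[OF C])
        (simp add: distrib_right left_diff_distrib sum.distrib sum_subtractf c[symmetric] c'[symmetric] k[symmetric])
    then have "c i \<le> k i" for i by (smt (verit) of_nat_0_le_iff of_nat_le_iff)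
    moreover have "l = wt c" by (auto simp: wt_def c)
    ultimately show "l \<in> wt ` {c. \<forall>i. c i \<le> k i}" by auto
  qed
  then show ?thesis by (rule finite_subset) (simp add: finite_functions_le)
qed (simp only: finite.emptyI)


section \<open>The completed ring of series\<close>

text \<open>The condition on supports from \<open>Ye_ring\<close>, stated for sets, so that the
  completed ring becomes an instance of \<open>series_ring\<close>.\<close>

definition cone_bounded :: "('n::finite \<Rightarrow> 'n \<Rightarrow> int) \<Rightarrow> 'n monomial set set" where
  "cone_bounded C = {S. (\<exists>L. finite L \<and> (\<forall>m\<in>S. \<exists>l\<in>L. (\<lambda>j. l j - weight m j) \<in> Q_plus C)) \<and>
     (\<forall>w. finite {m \<in> S. weight m = w})}"

lemma Ye_ring_eq: "Ye_ring C = series_ring (cone_bounded C)"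
  by (simp add: Ye_ring_def series_ring_def cone_bounded_def)

text \<open>Put b = l - w'. Then b and l' - (w - w') lie in the cone and add up to l + l' - w, so
  each of the finitely many pairs (l, l') admits finitely many b.\<close>

lemma finite_weight_decompositions:
  fixes C :: "'n::finite \<Rightarrow> 'n \<Rightarrow> int"
  assumes C: "simple_cartan_matrix C" and "finite L" "finite L'"
  shows "finite {w'. (\<exists>l\<in>L. (\<lambda>j. l j - w' j) \<in> Q_plus C) \<and>
    (\<exists>l\<in>L'. (\<lambda>j. l j - (w j - w' j)) \<in> Q_plus C)}" (is "finite ?D")
proof -
  define E where "E l l' = {b \<in> Q_plus C. (\<lambda>j. (l j + l' j - w j) - b j) \<in> Q_plus C}" for l l'
  have "?D \<subseteq> (\<Union>l\<in>L. \<Union>l'\<in>L'. (\<lambda>b j. l j - b j) ` E l l')"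
  proof
    fix w' assume "w' \<in> ?D"
    then obtain l l' where l: "l \<in> L" "l' \<in> L'" "(\<lambda>j. l j - w' j) \<in> Q_plus C"
      "(\<lambda>j. l' j - (w j - w' j)) \<in> Q_plus C" by auto
    have "(\<lambda>j. (l j + l' j - w j) - (l j - w' j)) = (\<lambda>j. l' j - (w j - w' j))" by auto
    then have "(\<lambda>j. l j - w' j) \<in> E l l'" using l by (simp add: E_def)
    then have "w' \<in> (\<lambda>b j. l j - b j) ` E l l'"
      by (rule image_eqI[rotated]) auto
    then show "w' \<in> (\<Union>l\<in>L. \<Union>l'\<in>L'. (\<lambda>b j. l j - b j) ` E l l')" using l by blast
  qed
  moreover have "finite (E l l')" for l l'
    unfolding E_def by (rule finite_Q_plus_decompositions[OF C])
  then have "finite (\<Union>l\<in>L. \<Union>l'\<in>L'. (\<lambda>b j. l j - b j) ` E l l')"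
    using assms by (intro finite_UN_I finite_imageI) auto
  ultimately show ?thesis by (rule finite_subset)
qed

text \<open>Finiteness for products comes in two stages: a given weight splits in finitely many ways
  into a weight below \<open>L\<close> and a weight below \<open>L'\<close>, and each such weight is
  carried by finitely many monomials of \<open>S\<close> and of \<open>T\<close>.\<close>

lemma support_family_cone_bounded:
  fixes C :: "'n::finite \<Rightarrow> 'n \<Rightarrow> int"
  assumes C: "simple_cartan_matrix C"
  shows "support_family (cone_bounded C)"
proof
  fix S T :: "'n monomial set"
  show "S \<in> cone_bounded C" if "finite S"
  proof -
    have "\<exists>l\<in>weight ` S. (\<lambda>j. l j - weight m j) \<in> Q_plus C" if "m \<in> S" for m
      using that Q_plus_zero[of C] by (intro bexI[of _ "weight m"]) auto
    then show ?thesis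
      unfolding cone_bounded_def using that by (auto intro!: exI[of _ "weight ` S"])
  qed
  show "T \<in> cone_bounded C" if "S \<in> cone_bounded C" "T \<subseteq> S"
  proof -
    have "finite {m \<in> T. weight m = w}" for w
      using that by (auto simp: cone_bounded_def intro: finite_subset[of _ "{m \<in> S. weight m = w}"])
    then show ?thesis using that unfolding cone_bounded_def by blast
  qed
  assume S: "S \<in> cone_bounded C" and T: "T \<in> cone_bounded C"
  obtain L where L: "finite L" "\<And>m. m \<in> S \<Longrightarrow> \<exists>l\<in>L. (\<lambda>j. l j - weight m j) \<in> Q_plus C"
    and fS: "\<And>w. finite {m \<in> S. weight m = w}" using S unfolding cone_bounded_def by auto
  obtain L' where L': "finite L'" "\<And>m. m \<in> T \<Longrightarrow> \<exists>l\<in>L'. (\<lambda>j. l j - weight m j) \<in> Q_plus C"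
    and fT: "\<And>w. finite {m \<in> T. weight m = w}" using T unfolding cone_bounded_def by auto
  show "S \<union> T \<in> cone_bounded C"
  proof -
    have "finite {m \<in> S \<union> T. weight m = w}" for w
    proof -
      have "{m \<in> S \<union> T. weight m = w} = {m \<in> S. weight m = w} \<union> {m \<in> T. weight m = w}" by auto
      then show ?thesis using fS fT by simp
    qed
    moreover have "\<exists>l\<in>L \<union> L'. (\<lambda>j. l j - weight m j) \<in> Q_plus C" if "m \<in> S \<union> T" for m
      using that L L' by blast
    ultimately show ?thesis
      unfolding cone_bounded_def using L(1) L'(1) by (auto intro!: exI[of _ "L \<union> L'"])
  qed
  \<comment> \<open>A finite set containing every weight that the first factor can have in a product
    of total weight \<open>w\<close>.\<close>
  define D where "D w = {w'. (\<exists>l\<in>L. (\<lambda>j. l j - w' j) \<in> Q_plus C) \<and>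
    (\<exists>l\<in>L'. (\<lambda>j. l j - (w j - w' j)) \<in> Q_plus C)}" for w
  have fD: "finite (D w)" for w
    unfolding D_def by (rule finite_weight_decompositions[OF C L(1) L'(1)])
  have D: "weight u \<in> D (\<lambda>j. weight u j + weight v j)" if "u \<in> S" "v \<in> T" for u v
    using L(2)[OF that(1)] L'(2)[OF that(2)] by (simp add: D_def)
  show "(\<lambda>(u, v). u + v) ` (S \<times> T) \<in> cone_bounded C"
  proof -
    define LL where "LL = (\<lambda>(l, l') j. l j + l' j) ` (L \<times> L')"
    have "\<exists>l\<in>LL. (\<lambda>j. l j - weight m j) \<in> Q_plus C" if m: "m \<in> (\<lambda>(u, v). u + v) ` (S \<times> T)" for m
    proof -
      obtain u v where uv: "u \<in> S" "v \<in> T" "m = u + v" using m by auto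
      obtain l l' where l: "l \<in> L" "l' \<in> L'" "(\<lambda>j. l j - weight u j) \<in> Q_plus C"
        "(\<lambda>j. l' j - weight v j) \<in> Q_plus C" using L(2)[OF uv(1)] L'(2)[OF uv(2)] by auto
      have "(\<lambda>j. (l j - weight u j) + (l' j - weight v j)) \<in> Q_plus C"
        by (rule Q_plus_add[OF l(3,4)])
      moreover have "(\<lambda>j. (l j - weight u j) + (l' j - weight v j)) = (\<lambda>j. l j + l' j - weight m j)"
        by (auto simp: uv weight_add)
      ultimately show ?thesis using l by (auto simp: LL_def)
    qed
    moreover have "finite {m \<in> (\<lambda>(u, v). u + v) ` (S \<times> T). weight m = w}" for w
    proof -
      have "{m \<in> (\<lambda>(u, v). u + v) ` (S \<times> T). weight m = w} \<subseteq>
        (\<Union>w'\<in>D w. (\<lambda>(u, v). u + v) ` ({u \<in> S. weight u = w'} \<times> {v \<in> T. weight v = (\<lambda>j. w j - w' j)}))"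
      proof
        fix m assume "m \<in> {m \<in> (\<lambda>(u, v). u + v) ` (S \<times> T). weight m = w}"
        then obtain u v where uv: "u \<in> S" "v \<in> T" "m = u + v" "weight (u + v) = w" by auto
        then have w: "w = (\<lambda>j. weight u j + weight v j)" by (auto simp: weight_add)
        have "weight u \<in> D w" using D[OF uv(1,2)] w by simp
        moreover have "weight v = (\<lambda>j. w j - weight u j)" by (simp add: w)
        ultimately show "m \<in> (\<Union>w'\<in>D w. (\<lambda>(u, v). u + v) `
            ({u \<in> S. weight u = w'} \<times> {v \<in> T. weight v = (\<lambda>j. w j - w' j)}))"
          using uv(1-3) by blast
      qed
      moreover have "finite (\<Union>w'\<in>D w. (\<lambda>(u, v). u + v) `
            ({u \<in> S. weight u = w'} \<times> {v \<in> T. weight v = (\<lambda>j. w j - w' j)}))"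
        using fD fS fT by blast
      ultimately show ?thesis by (rule finite_subset)
    qed
    moreover have "finite LL" using L(1) L'(1) by (simp add: LL_def)
    ultimately show ?thesis unfolding cone_bounded_def by blast
  qed
  show "finite {u \<in> S. m - u \<in> T}" for m
  proof -
    have "{u \<in> S. m - u \<in> T} \<subseteq> (\<Union>w\<in>D (weight m). {u \<in> S. weight u = w})"
    proof
      fix u assume u: "u \<in> {u \<in> S. m - u \<in> T}"
      have "(\<lambda>j. weight u j + weight (m - u) j) = weight m" by (simp add: weight_diff)
      then show "u \<in> (\<Union>w\<in>D (weight m). {u \<in> S. weight u = w})" using D[of u "m - u"] u by auto
    qed
    then show ?thesis by (rule finite_subset) (use fD fS in blast)
  qed
qed

lemma cring_Ye_ring:
  fixes C :: "'n::finite \<Rightarrow> 'n \<Rightarrow> int"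
  shows "simple_cartan_matrix C \<Longrightarrow> cring (Ye_ring C)"
  unfolding Ye_ring_eq
  by (rule support_family.cring_series_ring[OF support_family_cone_bounded])

lemma mseries_in_Ye_ring: "simple_cartan_matrix C \<Longrightarrow> mseries m \<in> carrier (Ye_ring C)"
  unfolding Ye_ring_eq
  by (rule support_family.mseries_closed[OF support_family_cone_bounded])

lemma Ye_ring_simps:
  "f \<otimes>\<^bsub>Ye_ring C\<^esub> g = conv f g"
  "f \<oplus>\<^bsub>Ye_ring C\<^esub> g = (\<lambda>m. f m + g m)"
  "\<one>\<^bsub>Ye_ring C\<^esub> = mseries 0"
  "\<zero>\<^bsub>Ye_ring C\<^esub> = (\<lambda>m. 0)"
  by (simp_all add: Ye_ring_eq series_ring_simps)

lemma Y_ring_subset_Ye_ring: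
  assumes "simple_cartan_matrix C"
  shows "carrier Y_ring \<subseteq> carrier (Ye_ring C)"
  using support_family.finite_mem[OF support_family_cone_bounded[OF assms]]
  by (auto simp: Y_ring_simps Ye_ring_eq series_ring_simps)


section \<open>Laurent polynomials: induction, homomorphisms, derivations\<close>

lemma mseries_in_Y_ring: "mseries m \<in> carrier Y_ring"
  by (simp add: Y_ring_simps mseries_def)

lemma Y_ring_uminus:
  assumes "f \<in> carrier Y_ring"
  shows "\<ominus>\<^bsub>Y_ring\<^esub> f = (\<lambda>m. - f m)"
proof -
  interpret Y: cring Y_ring by (rule cring_Y_ring)
  show ?thesis using assms by (intro Y.minus_equality) (auto simp: Y_ring_simps)
qed

lemma mseries_mult: "mseries u \<otimes>\<^bsub>Y_ring\<^esub> mseries v = mseries (u + v)"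
  by (simp add: Y_ring_simps conv_mseries_mseries)

text \<open>One monomial at a time is removed from the support. Zero and integer multiples need no
  cases of their own: zero is 1 - 1, and multiples arise by repeated \<open>add\<close> and
  \<open>uminus\<close>.\<close>

lemma Y_ring_additive_induct [consumes 1, case_names mseries add uminus]:
  assumes f: "f \<in> carrier Y_ring"
    and mseries: "\<And>m. P (mseries m)"
    and add: "\<And>f g. f \<in> carrier Y_ring \<Longrightarrow> g \<in> carrier Y_ring \<Longrightarrow> P f \<Longrightarrow> P g \<Longrightarrow> P (f \<oplus>\<^bsub>Y_ring\<^esub> g)"
    and uminus: "\<And>f. f \<in> carrier Y_ring \<Longrightarrow> P f \<Longrightarrow> P (\<ominus>\<^bsub>Y_ring\<^esub> f)"
  shows "P f"
proof -
  have zero: "P (\<lambda>m. 0)"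
  proof -
    have "P (mseries 0 \<oplus>\<^bsub>Y_ring\<^esub> \<ominus>\<^bsub>Y_ring\<^esub> mseries 0)"
      by (intro add uminus mseries mseries_in_Y_ring cring.cring_simprules[OF cring_Y_ring])
    then show ?thesis by (simp add: Y_ring_uminus mseries_in_Y_ring Y_ring_simps(3))
  qed
  have single_closed: "(\<lambda>x. c * mseries m x) \<in> carrier Y_ring" for c m
    by (simp add: Y_ring_simps mseries_def)
  have single: "P (\<lambda>x. c * mseries m x)" for c m
  proof (induction c rule: int_induct[of _ 0])
    case base
    then show ?case using zero by simp
  next
    case (step1 c)
    then show ?case using add[OF single_closed mseries_in_Y_ring step1(2) mseries, of m]
      by (simp add: Y_ring_simps(3) distrib_right)
  next
    case (step2 c)
    have "P (\<ominus>\<^bsub>Y_ring\<^esub> mseries m)" by (intro uminus mseries mseries_in_Y_ring)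
    moreover have "\<ominus>\<^bsub>Y_ring\<^esub> mseries m \<in> carrier Y_ring"
      by (intro mseries_in_Y_ring cring.cring_simprules[OF cring_Y_ring])
    ultimately show ?case using add[OF single_closed _ step2(2), of "\<ominus>\<^bsub>Y_ring\<^esub> mseries m"]
      by (simp add: Y_ring_simps(3) Y_ring_uminus mseries_in_Y_ring left_diff_distrib)
  qed
  have "\<forall>f. {m. f m \<noteq> 0} \<subseteq> S \<longrightarrow> P f" if "finite S" for S :: "'a monomial set"
    using that
  proof (induction S)
    case empty
    have "f = (\<lambda>m. 0)" if "{m. f m \<noteq> 0} \<subseteq> {}" for f :: "'a series"
      using that by auto
    then show ?case using zero by metis
  next
    case (insert m S)
    show ?case
    proof (intro allI impI)
      fix f :: "'a series" assume f: "{x. f x \<noteq> 0} \<subseteq> insert m S"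
      define g where "g = (\<lambda>x. if x = m then 0 else f x)"
      have g: "{x. g x \<noteq> 0} \<subseteq> S" using f by (auto simp: g_def)
      then have "g \<in> carrier Y_ring" "P g"
        using insert by (auto simp: Y_ring_simps intro: finite_subset)
      then have "P (g \<oplus>\<^bsub>Y_ring\<^esub> (\<lambda>x. f m * mseries m x))"
        by (intro add single single_closed)
      also have "g \<oplus>\<^bsub>Y_ring\<^esub> (\<lambda>x. f m * mseries m x) = f"
        by (auto simp: Y_ring_simps(3) g_def mseries_def)
      finally show "P f" .
    qed
  qed
  then show ?thesis using f by (auto simp: Y_ring_simps)
qed

lemma Y_ring_induct [consumes 1, case_names gen inv add uminus mult]:
  assumes f: "f \<in> carrier Y_ring"
    and gen: "\<And>j a. P (mseries (Y_mon j a))" and inv: "\<And>j a. P (mseries (- Y_mon j a))"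
    and add: "\<And>f g. f \<in> carrier Y_ring \<Longrightarrow> g \<in> carrier Y_ring \<Longrightarrow> P f \<Longrightarrow> P g \<Longrightarrow> P (f \<oplus>\<^bsub>Y_ring\<^esub> g)"
    and uminus: "\<And>f. f \<in> carrier Y_ring \<Longrightarrow> P f \<Longrightarrow> P (\<ominus>\<^bsub>Y_ring\<^esub> f)"
    and mult: "\<And>f g. f \<in> carrier Y_ring \<Longrightarrow> g \<in> carrier Y_ring \<Longrightarrow> P f \<Longrightarrow> P g \<Longrightarrow> P (f \<otimes>\<^bsub>Y_ring\<^esub> g)"
  shows "P f"
  using f
proof (induction rule: Y_ring_additive_induct)
  case (mseries m)
  have mult': "P (mseries (u + v))" if "P (mseries u)" "P (mseries v)" for u v
    using mult[OF mseries_in_Y_ring mseries_in_Y_ring that] by (simp add: mseries_mult)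
  \<comment> \<open>Induction over the free abelian group of monomials passes from \<open>u\<close>
    and \<open>v\<close> to \<open>u - v\<close>, so the claim is carried for a monomial together
    with its inverse.\<close>
  have "P (mseries m) \<and> P (mseries (- m))"
    using subset_UNIV
  proof (induction m rule: frag_induction)
    case zero
    \<comment> \<open>The unit is obtained as Y * Y^-1 for an arbitrary variable.\<close>
    show ?case using mult'[OF gen[of undefined undefined] inv[of undefined undefined]] by simp
  next
    case (one x)
    show ?case using gen[of "fst x" "snd x"] inv[of "fst x" "snd x"] by (simp add: Y_mon_def)
  next
    case (diff u v)
    then show ?case using mult'[of u "- v"] mult'[of v "- u"] by simp
  qed
  then show ?case ..
qed (use add uminus in auto)

text \<open>Through \<open>Abs_poly_mapping\<close> a Laurent polynomial is an element of the free
  abelian group on the monomials, to which the universal property of that group applies.\<close>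

lemma Abs_poly_mapping_Y_ring:
  assumes "f \<in> carrier Y_ring"
  shows "Poly_Mapping.lookup (Abs_poly_mapping f) = f"
  using assms by (simp add: Y_ring_simps)

text \<open>The universal property of free abelian groups enters twice: multiplicatively, sending
  the group of monomials to the units of \<open>R\<close>, and additively, sending integer
  combinations of monomials to \<open>R\<close>. Multiplicativity of the result follows from the
  case of monomials by additivity in each factor.\<close>

lemma Y_ring_hom_exists:
  fixes u :: "'n \<Rightarrow> cstar \<Rightarrow> 'c" and R :: "('c, 'r) ring_scheme"
  assumes R: "cring R" and u: "\<And>j a. u j a \<in> Units R"
  obtains \<theta> where "\<theta> \<in> ring_hom Y_ring R" "\<forall>j a. \<theta> (mseries (Y_mon j a)) = u j a"
proof -
  interpret R: cring R by (rule R)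
  interpret Y: cring "Y_ring :: 'n series ring" by (rule cring_Y_ring)
  interpret U: comm_group "units_of R" by (rule R.units_comm_group)
  obtain \<tau> where \<tau>: "\<tau> \<in> hom (free_Abelian_group UNIV) (units_of R)"
    and \<tau>_gen: "\<And>x. \<tau> (frag_of x) = u (fst x) (snd x)"
    using U.free_Abelian_group_universal[of "\<lambda>x. u (fst x) (snd x)" UNIV] u
    by (auto simp: units_of_carrier)
  have \<tau>_unit: "\<tau> m \<in> Units R" for m
    using hom_in_carrier[OF \<tau>, of m] by (simp add: units_of_carrier)
  then have \<tau>_closed: "\<tau> m \<in> carrier R" for m by (rule R.Units_closed)
  have \<tau>_add: "\<tau> (m + m') = \<tau> m \<otimes>\<^bsub>R\<^esub> \<tau> m'" for m m'
    using hom_mult[OF \<tau>, of m m'] by (simp add: units_of_mult)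
  have \<tau>_zero: "\<tau> 0 = \<one>\<^bsub>R\<^esub>"
  proof -
    have "\<tau> 0 \<otimes>\<^bsub>R\<^esub> \<tau> 0 = \<tau> 0 \<otimes>\<^bsub>R\<^esub> \<one>\<^bsub>R\<^esub>" using \<tau>_add[of 0 0] \<tau>_closed by simp
    then show ?thesis using \<tau>_unit \<tau>_closed by (subst (asm) R.Units_l_cancel) auto
  qed
  obtain \<eta> where \<eta>: "\<eta> \<in> hom (free_Abelian_group UNIV) (add_monoid R)"
    and \<eta>_gen: "\<And>m. \<eta> (frag_of m) = \<tau> m"
    using R.add.free_Abelian_group_universal[of \<tau> UNIV] \<tau>_closed by auto
  define \<theta> where "\<theta> f = \<eta> (Abs_poly_mapping f)" for f
  have \<theta>_closed: "\<theta> f \<in> carrier R" for f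
    using hom_in_carrier[OF \<eta>, of "Abs_poly_mapping f"] by (simp add: \<theta>_def)
  have \<theta>_add: "\<theta> (f \<oplus>\<^bsub>Y_ring\<^esub> g) = \<theta> f \<oplus>\<^bsub>R\<^esub> \<theta> g" if "f \<in> carrier Y_ring" "g \<in> carrier Y_ring" for f g
  proof -
    have "Abs_poly_mapping (f \<oplus>\<^bsub>Y_ring\<^esub> g) = Abs_poly_mapping f + Abs_poly_mapping g"
      by (rule poly_mapping_eqI)
        (simp add: Abs_poly_mapping_Y_ring that lookup_add Y.a_closed, simp add: Y_ring_simps)
    then show ?thesis
      using hom_mult[OF \<eta>, of "Abs_poly_mapping f" "Abs_poly_mapping g"] by (simp add: \<theta>_def)
  qed
  have \<theta>_mseries: "\<theta> (mseries m) = \<tau> m" for m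
  proof -
    have "Abs_poly_mapping (mseries m) = frag_of m"
      by (rule poly_mapping_eqI)
        (simp add: Abs_poly_mapping_Y_ring mseries_in_Y_ring, simp add: mseries_def lookup_single when_def)
    then show ?thesis by (simp add: \<theta>_def \<eta>_gen)
  qed
  have \<theta>_zero: "\<theta> \<zero>\<^bsub>Y_ring\<^esub> = \<zero>\<^bsub>R\<^esub>"
    using \<theta>_add[of "\<zero>\<^bsub>Y_ring\<^esub>" "\<zero>\<^bsub>Y_ring\<^esub>"] \<theta>_closed R.add.r_cancel_one' by fastforce
  have \<theta>_uminus: "\<theta> (\<ominus>\<^bsub>Y_ring\<^esub> f) = \<ominus>\<^bsub>R\<^esub> \<theta> f" if f: "f \<in> carrier Y_ring" for f
    using \<theta>_add[of "\<ominus>\<^bsub>Y_ring\<^esub> f" f] \<theta>_closed f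
    by (intro R.minus_equality[symmetric]) (auto simp: \<theta>_zero Y.l_neg)
  have mono: "\<theta> (mseries m \<otimes>\<^bsub>Y_ring\<^esub> g) = \<theta> (mseries m) \<otimes>\<^bsub>R\<^esub> \<theta> g" if "g \<in> carrier Y_ring" for m g
    using that
  proof (induction rule: Y_ring_additive_induct)
    case (mseries m')
    then show ?case by (simp add: mseries_mult \<theta>_mseries \<tau>_add)
  qed (simp_all add: mseries_in_Y_ring \<theta>_closed \<theta>_add \<theta>_uminus Y.r_distr R.r_distr Y.r_minus R.r_minus)
  have mult: "\<theta> (f \<otimes>\<^bsub>Y_ring\<^esub> g) = \<theta> f \<otimes>\<^bsub>R\<^esub> \<theta> g" if "f \<in> carrier Y_ring" "g \<in> carrier Y_ring" for f g
    using that
  proof (induction rule: Y_ring_additive_induct)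
    case (mseries m)
    then show ?case by (rule mono)
  qed (simp_all add: \<theta>_closed \<theta>_add \<theta>_uminus Y.l_distr R.l_distr Y.l_minus R.l_minus)
  have "\<theta> \<in> ring_hom Y_ring R"
    by (rule ring_hom_memI) (use \<theta>_closed \<theta>_add mult \<theta>_mseries[of 0] \<tau>_zero in \<open>auto simp: Y_ring_simps(4)\<close>)
  moreover have "\<forall>j a. \<theta> (mseries (Y_mon j a)) = u j a"
    using \<tau>_gen by (simp add: \<theta>_mseries Y_mon_def)
  ultimately show thesis by (rule that)
qed

lemma ring_hom_uminus:
  assumes "ring R" "ring S" "\<theta> \<in> ring_hom R S" "x \<in> carrier R"
  shows "\<theta> (\<ominus>\<^bsub>R\<^esub> x) = \<ominus>\<^bsub>S\<^esub> \<theta> x"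
proof -
  interpret ring_hom_ring R S \<theta> by (rule ring_hom_ringI2[OF assms(1-3)])
  show ?thesis by (rule hom_a_inv[OF assms(4)])
qed

text \<open>Agreement at the variables suffices: at the inverse of a variable both maps take the
  inverse of the same element.\<close>

lemma Y_ring_hom_eqI:
  assumes R: "cring R" and \<theta>: "\<theta> \<in> ring_hom Y_ring R" and \<theta>': "\<theta>' \<in> ring_hom Y_ring R"
    and eq: "\<And>j a. \<theta> (mseries (Y_mon j a)) = \<theta>' (mseries (Y_mon j a))"
    and f: "f \<in> carrier (Y_ring :: 'n series ring)"
  shows "\<theta> f = \<theta>' f"
  using f
proof (induction rule: Y_ring_induct)
  interpret R: cring R by (rule R)
  interpret Y: cring "Y_ring :: 'n series ring" by (rule cring_Y_ring)
  case (inv j a)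
  let ?u = "mseries (Y_mon j a)" and ?v = "mseries (- Y_mon j a)"
  have uv: "?v \<otimes>\<^bsub>Y_ring\<^esub> ?u = \<one>\<^bsub>Y_ring\<^esub>" by (simp add: mseries_mult Y_ring_simps(4))
  have "\<theta> ?v \<otimes>\<^bsub>R\<^esub> \<theta> ?u = \<one>\<^bsub>R\<^esub>" "\<theta>' ?v \<otimes>\<^bsub>R\<^esub> \<theta> ?u = \<one>\<^bsub>R\<^esub>"
    using ring_hom_mult[OF \<theta>, of ?v ?u] ring_hom_mult[OF \<theta>', of ?v ?u]
      ring_hom_one[OF \<theta>] ring_hom_one[OF \<theta>'] by (simp_all add: mseries_in_Y_ring uv eq)
  moreover have "\<theta> ?v \<in> carrier R" "\<theta>' ?v \<in> carrier R" "\<theta> ?u \<in> carrier R"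
    using ring_hom_closed[OF \<theta>] ring_hom_closed[OF \<theta>'] mseries_in_Y_ring by blast+
  ultimately show ?case using R.inv_unique R.m_comm by metis
next
  case (uminus f)
  then show ?case
    using ring_hom_uminus[OF cring.axioms(1)[OF cring_Y_ring] cring.axioms(1)[OF R] \<theta>]
      ring_hom_uminus[OF cring.axioms(1)[OF cring_Y_ring] cring.axioms(1)[OF R] \<theta>'] by metis
qed (use eq in \<open>simp_all add: ring_hom_add[OF \<theta>] ring_hom_add[OF \<theta>'] ring_hom_mult[OF \<theta>] ring_hom_mult[OF \<theta>']\<close>)

section \<open>Derivations into a module\<close>

context module
begin

lemma derivationD:
  assumes "D \<in> derivations R M"
  shows "x \<in> carrier R \<Longrightarrow> D x \<in> carrier M"
    and "x \<in> carrier R \<Longrightarrow> y \<in> carrier R \<Longrightarrow> D (x \<oplus> y) = D x \<oplus>\<^bsub>M\<^esub> D y"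
    and "x \<in> carrier R \<Longrightarrow> y \<in> carrier R \<Longrightarrow> D (x \<otimes> y) = x \<odot>\<^bsub>M\<^esub> D y \<oplus>\<^bsub>M\<^esub> y \<odot>\<^bsub>M\<^esub> D x"
  using assms by (auto simp: derivations_def)

lemma derivation_zero:
  assumes "D \<in> derivations R M"
  shows "D \<zero> = \<zero>\<^bsub>M\<^esub>"
  using derivationD(2)[OF assms, of \<zero> \<zero>] derivationD(1)[OF assms, of \<zero>] M.add.r_cancel_one' by fastforce

lemma derivation_uminus:
  assumes "D \<in> derivations R M" "x \<in> carrier R"
  shows "D (\<ominus> x) = \<ominus>\<^bsub>M\<^esub> D x"
  using derivationD(2)[OF assms(1), of "\<ominus> x" x] derivationD(1)[OF assms(1)] assms(2)
  by (intro M.minus_equality[symmetric]) (auto simp: derivation_zero[OF assms(1)] R.l_neg)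

lemma derivation_one:
  assumes "D \<in> derivations R M"
  shows "D \<one> = \<zero>\<^bsub>M\<^esub>"
  using derivationD(3)[OF assms, of \<one> \<one>] derivationD(1)[OF assms, of \<one>] M.add.r_cancel_one' by fastforce

text \<open>Act with v on 0 = D(1) = u D(v) + v D(u).\<close>

lemma derivation_inverse:
  assumes D: "D \<in> derivations R M" and uv: "u \<in> carrier R" "v \<in> carrier R" "u \<otimes> v = \<one>"
  shows "D v = \<ominus>\<^bsub>M\<^esub> ((v \<otimes> v) \<odot>\<^bsub>M\<^esub> D u)"
proof -
  note cl = derivationD(1)[OF D]
  have vu: "v \<otimes> u = \<one>" using uv R.m_comm by simp
  have "u \<odot>\<^bsub>M\<^esub> D v \<oplus>\<^bsub>M\<^esub> v \<odot>\<^bsub>M\<^esub> D u = \<zero>\<^bsub>M\<^esub>"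
    using derivationD(3)[OF D uv(1,2)] uv(3) derivation_one[OF D] by simp
  then have "v \<odot>\<^bsub>M\<^esub> (u \<odot>\<^bsub>M\<^esub> D v \<oplus>\<^bsub>M\<^esub> v \<odot>\<^bsub>M\<^esub> D u) = \<zero>\<^bsub>M\<^esub>" using uv by simp
  moreover have "v \<odot>\<^bsub>M\<^esub> (u \<odot>\<^bsub>M\<^esub> D v \<oplus>\<^bsub>M\<^esub> v \<odot>\<^bsub>M\<^esub> D u) = D v \<oplus>\<^bsub>M\<^esub> (v \<otimes> v) \<odot>\<^bsub>M\<^esub> D u"
    using uv cl by (simp add: smult_r_distr smult_assoc1[symmetric] vu)
  ultimately show ?thesis using uv cl by (intro M.minus_equality[symmetric]) auto
qed

end

lemma derivation_eqI:
  assumes M: "module (Y_ring :: 'n series ring) M"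
    and D: "D \<in> derivations Y_ring M" and D': "D' \<in> derivations Y_ring M"
    and eq: "\<And>j a. D (mseries (Y_mon j a)) = D' (mseries (Y_mon j a))"
    and f: "f \<in> carrier Y_ring"
  shows "D f = D' f"
  using f
proof (induction rule: Y_ring_induct)
  interpret M: module "Y_ring :: 'n series ring" M by (rule M)
  case (inv j a)
  have "mseries (Y_mon j a) \<otimes>\<^bsub>Y_ring\<^esub> mseries (- Y_mon j a) = \<one>\<^bsub>Y_ring\<^esub>"
    by (simp add: mseries_mult Y_ring_simps(4))
  then show ?case
    using M.derivation_inverse[OF D mseries_in_Y_ring mseries_in_Y_ring]
      M.derivation_inverse[OF D' mseries_in_Y_ring mseries_in_Y_ring] eq by metis
qed (use eq in \<open>simp_all add: module.derivationD(2,3)[OF M D] module.derivationD(2,3)[OF M D']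
      module.derivation_uminus[OF M D] module.derivation_uminus[OF M D']\<close>)


section \<open>The series \<open>\<Sigma>\<close>\<close>

text \<open>
  The degree-\<open>n\<close> part of the inverse of \<open>\<Sum>k. T k\<close>, where the monomial \<open>T k\<close> has degree
  \<open>k\<close> and \<open>T 0 = 1\<close>: compare the terms of degree \<open>n\<close> in the product.
\<close>

fun inverse_coeff :: "(nat \<Rightarrow> 'n monomial) \<Rightarrow> nat \<Rightarrow> 'n series" where
  "inverse_coeff T n m =
     (if n = 0 then mseries 0 m else - (\<Sum>k<n. inverse_coeff T k (m - T (n - k))))"

declare inverse_coeff.simps [simp del]

locale cartan_datum =
  fixes C :: "'n::finite \<Rightarrow> 'n \<Rightarrow> int" and d :: "'n \<Rightarrow> nat" and q :: cstar and i :: 'n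
  assumes simple_cartan: "simple_cartan_matrix C"
begin

abbreviation "Q \<equiv> q ^ d i"
abbreviation "A \<equiv> A_mon C d q i"
abbreviation "term \<equiv> Sigma_term C d q i"
abbreviation "\<Sigma> \<equiv> Sigma_e C d q i"
abbreviation "E \<equiv> Ye_ring C"

sublocale E: cring E by (rule cring_Ye_ring[OF simple_cartan])

lemma diagonal: "C i i = 2"
  using simple_cartan by (simp add: simple_cartan_matrix_def)

lemma carrier_E: "carrier E = {f. {m. f m \<noteq> 0} \<in> cone_bounded C}"
  by (simp add: Ye_ring_eq series_ring_simps)

text \<open>All weights lie in the single cone below 0. Since C i i = 2, the weight -k \<alpha>_i
  has i-th coordinate -2k, so it determines k and with it the finite piece
  \<open>G k\<close>.\<close>

lemma cone_boundedI:
  assumes fin: "\<And>k. finite (G k)" and S: "S \<subseteq> (\<Union>k. G k)"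
    and weight: "\<And>k m j. m \<in> G k \<Longrightarrow> weight m j = - int k * C j i"
  shows "S \<in> cone_bounded C"
proof -
  have "(\<lambda>j. 0 - weight m j) \<in> Q_plus C" if m: "m \<in> S" for m
  proof -
    obtain k where k: "m \<in> G k" using S m by auto
    have "int k * C j i = (\<Sum>l\<in>UNIV. int (if l = i then k else 0) * C j l)" for j
    proof -
      have "(\<Sum>l\<in>UNIV. int (if l = i then k else 0) * C j l) = (\<Sum>l\<in>{i}. int (if l = i then k else 0) * C j l)"
        by (rule sum.mono_neutral_right) auto
      then show ?thesis by simp
    qed
    then show ?thesis
      unfolding Q_plus_def using weight[OF k] by (auto intro!: exI[of _ "\<lambda>l. if l = i then k else 0"])
  qed
  moreover have "finite {m \<in> S. weight m = w}" for w
  proof (rule finite_subset)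
    show "{m \<in> S. weight m = w} \<subseteq> G (nat (- w i div 2))"
    proof
      fix m assume m: "m \<in> {m \<in> S. weight m = w}"
      then obtain k where k: "m \<in> G k" using S by auto
      then have "w i = - int k * 2" using weight[OF k, of i] m diagonal by auto
      then have "nat (- w i div 2) = k" by simp
      then show "m \<in> G (nat (- w i div 2))" using k by simp
    qed
  qed (rule fin)
  ultimately show ?thesis
    unfolding cone_bounded_def by (auto intro!: exI[of _ "{\<lambda>j. 0}"])
qed

text \<open>The monomials \<open>T k\<close> have distinct degrees in the grading by the weights -k
  \<alpha>_i, and the term of degree 0 is 1. Such a series can be inverted degree by degree, and the
  grading also keeps the support of the inverse within the completed ring.\<close>

lemma graded_series_Unit:
  assumes T0: "T 0 = 0" and wT: "\<And>k j. weight (T k) j = - int k * C j i"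
  shows "(\<lambda>m. if m \<in> range T then 1 else 0) \<in> Units E" (is "?S \<in> _")
proof -
  let ?g = "inverse_coeff T"
  \<comment> \<open>This is the sum of all \<open>inverse_coeff T n\<close>, written without an
    infinite sum: the only degree that can contribute at \<open>m\<close> is read off from the i-th
    coordinate -2n of its weight.\<close>
  define G where "G m = ?g (nat (- weight m i div 2)) m" for m
  have wg: "\<forall>m j. ?g n m \<noteq> 0 \<longrightarrow> weight m j = - int n * C j i" for n
  proof (induction n rule: less_induct)
    case (less n)
    show ?case
    proof (intro allI impI)
      fix m j assume m: "?g n m \<noteq> 0"
      show "weight m j = - int n * C j i"
      proof (cases "n = 0")
        case True
        then show ?thesis using m by (simp add: inverse_coeff.simps mseries_def split: if_splits)
      next
        case False
        then have "(\<Sum>k<n. ?g k (m - T (n - k))) \<noteq> 0"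
          using m by (simp add: inverse_coeff.simps[of T n])
        then obtain k where k: "k < n" "?g k (m - T (n - k)) \<noteq> 0"
          by (metis (no_types, lifting) lessThan_iff sum.neutral)
        have "weight (m - T (n - k)) j = - int k * C j i" using less[OF k(1)] k(2) by blast
        then show ?thesis using k(1) by (simp add: weight_diff wT of_nat_diff algebra_simps)
      qed
    qed
  qed
  have fg: "finite {m. ?g n m \<noteq> 0}" for n
  proof (induction n rule: less_induct)
    case (less n)
    show ?case
    proof (cases "n = 0")
      case True
      then show ?thesis by (simp add: inverse_coeff.simps mseries_def)
    next
      case False
      have "{m. ?g n m \<noteq> 0} \<subseteq> (\<Union>k<n. (\<lambda>u. u + T (n - k)) ` {m. ?g k m \<noteq> 0})"
      proof
        fix m assume "m \<in> {m. ?g n m \<noteq> 0}"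
        then have "(\<Sum>k<n. ?g k (m - T (n - k))) \<noteq> 0"
          using False by (simp add: inverse_coeff.simps[of T n])
        then obtain k where k: "k < n" "?g k (m - T (n - k)) \<noteq> 0"
          by (metis (no_types, lifting) lessThan_iff sum.neutral)
        then have "m \<in> (\<lambda>u. u + T (n - k)) ` {m. ?g k m \<noteq> 0}"
          by (intro image_eqI[of _ _ "m - T (n - k)"]) auto
        then show "m \<in> (\<Union>k<n. (\<lambda>u. u + T (n - k)) ` {m. ?g k m \<noteq> 0})" using k(1) by blast
      qed
      then show ?thesis by (rule finite_subset) (use less in auto)
    qed
  qed
  have G_eq: "G m = ?g n m" if "weight m i = - int n * C i i" for m n
    using that by (simp add: G_def diagonal)
  have wG: "weight m j = - int (nat (- weight m i div 2)) * C j i" if "G m \<noteq> 0" for m j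
    using that wg unfolding G_def by blast
  have SE: "?S \<in> carrier E"
    unfolding carrier_E
    by (rule CollectI, rule cone_boundedI[of "\<lambda>k. {T k}"]) (auto simp: wT)
  have GE: "G \<in> carrier E"
    unfolding carrier_E
    by (rule CollectI, rule cone_boundedI[of "\<lambda>k. {m. ?g k m \<noteq> 0}"]) (use fg wg in \<open>auto simp: G_def\<close>)
  have "conv ?S G m = mseries 0 m" for m
  \<comment> \<open>Outside the weights -n \<alpha>_i both coefficients vanish.\<close>
  proof (cases "\<exists>n. \<forall>j. weight m j = - int n * C j i")
    case False
    have "conv ?S G m = 0"
    proof (rule ccontr)
      assume "conv ?S G m \<noteq> 0"
      then obtain u where u: "?S u \<noteq> 0" "G (m - u) \<noteq> 0" by (rule conv_nonzeroE)
      then obtain k where k: "u = T k" by (auto split: if_splits)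
      define l where "l = nat (- weight (m - u) i div 2)"
      have "weight m j = - int (l + k) * C j i" for j
        using wG[OF u(2), of j] unfolding l_def[symmetric]
        by (simp add: weight_diff k wT algebra_simps)
      then show False using False by blast
    qed
    moreover have "m \<noteq> 0"
    proof
      assume "m = 0"
      then have "\<forall>j. weight m j = - int 0 * C j i" by simp
      then show False using False by blast
    qed
    ultimately show ?thesis by (simp add: mseries_def)
  next
    case True
    then obtain n where n: "\<And>j. weight m j = - int n * C j i" by blast
    have inj: "inj_on (\<lambda>l. T (n - l)) {..n}"
    proof (rule inj_onI)
      fix k l assume kl: "k \<in> {..n}" "l \<in> {..n}" "T (n - k) = T (n - l)"
      have "- int (n - k) * C i i = - int (n - l) * C i i"
        using wT[of "n - k" i] wT[of "n - l" i] kl(3) by metis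
      then have "n - k = n - l" by (simp add: diagonal)
      then show "k = l" using kl(1,2) by (simp add: eq_diff_iff)
    qed
    have "conv ?S G m = (\<Sum>u\<in>(\<lambda>l. T (n - l)) ` {..n}. ?S u * G (m - u))"
    proof (rule conv_eq_sum)
      fix u assume u: "?S u \<noteq> 0" "G (m - u) \<noteq> 0"
      then obtain k where k: "u = T k" by (auto split: if_splits)
      define l where "l = nat (- weight (m - u) i div 2)"
      have "weight (m - u) i = - int l * C i i" using wG[OF u(2), of i] by (simp add: l_def)
      then have "n = l + k" using n[of i] by (simp add: weight_diff k wT diagonal)
      then show "u \<in> (\<lambda>l. T (n - l)) ` {..n}" using k by (intro image_eqI[of _ _ l]) auto
    qed simp
    also have "\<dots> = (\<Sum>l\<le>n. G (m - T (n - l)))"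
      by (subst sum.reindex[OF inj]) simp
    also have "\<dots> = (\<Sum>l\<le>n. ?g l (m - T (n - l)))"
      by (intro sum.cong refl G_eq) (auto simp: weight_diff wT n of_nat_diff algebra_simps)
    \<comment> \<open>The term l = n is \<open>?g n m\<close> because T 0 = 0; for n > 0 the
      recursion defines it as the negative of the remaining sum.\<close>
    also have "\<dots> = ?g n m + (\<Sum>l<n. ?g l (m - T (n - l)))"
      by (simp add: lessThan_Suc_atMost[symmetric] T0)
    also have "\<dots> = mseries 0 m"
    proof (cases "n = 0")
      case False
      then have "m \<noteq> 0" using n[of i] diagonal by auto
      then show ?thesis using False by (simp add: inverse_coeff.simps[of T n] mseries_def)
    qed (simp add: inverse_coeff.simps)
    finally show ?thesis .
  qed
  then have "?S \<otimes>\<^bsub>E\<^esub> G = \<one>\<^bsub>E\<^esub>" by (auto simp: Ye_ring_simps)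
  moreover from this have "G \<otimes>\<^bsub>E\<^esub> ?S = \<one>\<^bsub>E\<^esub>" using E.m_comm[OF SE GE] by simp
  ultimately show ?thesis using SE GE unfolding Units_def by blast
qed

section \<open>The terms of Sigma, its invertibility and its recursion\<close>

lemma weight_term: "weight (term a k) j = - int k * C j i"
  by (simp add: Sigma_term_def weight_sum weight_uminus weight_A_mon[OF simple_cartan])

lemma term_0: "term a 0 = 0"
  by (simp add: Sigma_term_def)

text \<open>The defining product gains its last factor when k grows, whereas the recursion of Sigma
  splits off the first one; induction exchanges the two.\<close>

lemma term_Suc: "term a (Suc k) = - A a + term (a / Q ^ 2) k"
proof (induction k)
  case 0
  have "{0<..Suc 0} = {Suc 0}" by auto
  then show ?case using cstar_shift(5)[of a Q] by (simp add: Sigma_term_def)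
next
  case (Suc k)
  have ins: "{0<..Suc n} = insert (Suc n) {0<..n}" for n by auto
  have step: "term b (Suc n) = - A (b * Q powi (2 - 2 * int (Suc n))) + term b n" for b n
    by (simp add: Sigma_term_def ins)
  have "term a (Suc (Suc k)) = - A (a / Q ^ 2 * Q powi (2 - 2 * int (Suc k))) + (- A a + term (a / Q ^ 2) k)"
    by (simp only: step[of a "Suc k"] cstar_shift(4)[of a Q "Suc k"] Suc)
  also have "\<dots> = - A a + term (a / Q ^ 2) (Suc k)"
    by (simp only: step) (simp only: ac_simps)
  finally show ?case .
qed

text \<open>The monomials \<open>term a k\<close> have the distinct weights -k \<alpha>_i, so none
  is counted twice.\<close>

lemma Sigma_e_eq: "\<Sigma> a = (\<lambda>m. if m \<in> range (term a) then 1 else 0)"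
proof
  fix m
  show "\<Sigma> a m = (if m \<in> range (term a) then 1 else 0)"
  proof (cases "m \<in> range (term a)")
    case True
    then obtain k where k: "m = term a k" by auto
    have "{l. term a l = m} = {k}"
    proof -
      have "l = k" if "term a l = term a k" for l
      proof -
        have "- int l * C i i = - int k * C i i"
          using weight_term[of a l i] weight_term[of a k i] that by metis
        then show ?thesis by (simp add: diagonal)
      qed
      then show ?thesis using k by auto
    qed
    then show ?thesis using True by (simp add: Sigma_e_def)
  next
    case False
    then have "{l. term a l = m} = {}" by auto
    then show ?thesis using False by (simp add: Sigma_e_def)
  qed
qed

lemma Sigma_Unit: "\<Sigma> a \<in> Units E"
  unfolding Sigma_e_eq using term_0 weight_term by (rule graded_series_Unit)

lemma Sigma_closed: "\<Sigma> a \<in> carrier E"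
  using Sigma_Unit by (rule E.Units_closed)

lemma Sigma_recursion: "\<Sigma> a = \<one>\<^bsub>E\<^esub> \<oplus>\<^bsub>E\<^esub> mseries (- A a) \<otimes>\<^bsub>E\<^esub> \<Sigma> (a / Q ^ 2)"
proof
  fix m
  have range: "m \<in> range (term a) \<longleftrightarrow> m = 0 \<or> m + A a \<in> range (term (a / Q ^ 2))"
  proof
    assume "m \<in> range (term a)"
    then obtain k where "m = term a k" by auto
    then show "m = 0 \<or> m + A a \<in> range (term (a / Q ^ 2))"
      by (cases k) (auto simp: term_0 term_Suc)
  next
    assume "m = 0 \<or> m + A a \<in> range (term (a / Q ^ 2))"
    then show "m \<in> range (term a)"
    proof
      assume "m + A a \<in> range (term (a / Q ^ 2))"
      then obtain k where k: "m + A a = term (a / Q ^ 2) k" by auto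
      have "m = term a (Suc k)" unfolding term_Suc k[symmetric] by simp
      then show ?thesis by blast
    qed (use term_0[of a] rangeI[of "term a" 0] in simp)
  qed
  \<comment> \<open>The constant term 1 must not reappear in the second summand, as its coefficient
    would then be 2. Such a coincidence would equate the weight \<alpha>_i of \<open>A a\<close>
    with some -k \<alpha>_i.\<close>
  have "0 + A a \<notin> range (term (a / Q ^ 2))"
  proof
    assume "0 + A a \<in> range (term (a / Q ^ 2))"
    then obtain k where "A a = term (a / Q ^ 2) k" by auto
    then have "C i i = - int k * C i i"
      using weight_A_mon[OF simple_cartan, of d q i a i] weight_term[of "a / Q ^ 2" k i] by metis
    then show False by (simp add: diagonal)
  qed
  then have "\<Sigma> a m = mseries 0 m + \<Sigma> (a / Q ^ 2) (m + A a)"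
    unfolding Sigma_e_eq mseries_def using range by auto
  then show "\<Sigma> a m = (\<one>\<^bsub>E\<^esub> \<oplus>\<^bsub>E\<^esub> mseries (- A a) \<otimes>\<^bsub>E\<^esub> \<Sigma> (a / Q ^ 2)) m"
    by (simp add: Ye_ring_simps conv_mseries)
qed

end


section \<open>The homomorphism \<open>\<Theta>\<close>\<close>

lemma ring_hom_restrict:
  assumes "ring R" "\<theta> \<in> ring_hom R S"
  shows "restrict \<theta> (carrier R) \<in> ring_hom R S"
proof -
  interpret R: ring R by fact
  show ?thesis
    by (rule ring_hom_memI)
      (simp_all add: ring_hom_closed[OF assms(2)] ring_hom_mult[OF assms(2)]
        ring_hom_add[OF assms(2)] ring_hom_one[OF assms(2)])
qed

text \<open>Here \<open>y\<close> stands for Y_{i,b}, \<open>a\<close> for A_{i,b q_i^-1}, primes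
  mark inverses, and \<open>s\<close>, \<open>t\<close> are Sigma at b q_i^-1 and b q_i^-3. The
  second identity rests on the factorization y' + y' a / t = y' (a / t) (1 + a' t) = y' (a / t)
  s.\<close>

lemma (in cring) deformation_identities:
  assumes cl: "y \<in> carrier R" "y' \<in> carrier R" "a \<in> carrier R" "a' \<in> carrier R"
    and s: "s \<in> Units R" "t \<in> Units R"
    and inv: "y \<otimes> y' = \<one>" "a \<otimes> a' = \<one>" and rec: "s = \<one> \<oplus> a' \<otimes> t"
  shows "y \<otimes> a' \<otimes> (t \<otimes> inv s) = y \<ominus> y \<otimes> inv s" (is ?A)
    and "(y \<otimes> a' \<otimes> (t \<otimes> inv s)) \<otimes> (y' \<oplus> y' \<otimes> a \<otimes> inv t) = \<one>" (is ?B)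
proof -
  have c: "s \<in> carrier R" "t \<in> carrier R" "inv s \<in> carrier R" "inv t \<in> carrier R"
    using s by auto
  have a't: "a' \<otimes> t = s \<ominus> \<one>" unfolding rec using cl c by algebra
  have "y \<otimes> a' \<otimes> (t \<otimes> inv s) = y \<otimes> (a' \<otimes> t) \<otimes> inv s" using cl c by (simp add: m_assoc)
  also have "\<dots> = y \<otimes> (s \<otimes> inv s) \<ominus> y \<otimes> inv s" unfolding a't using cl c by algebra
  finally show ?A using s cl by simp
  have "y' \<oplus> y' \<otimes> a \<otimes> inv t = y' \<otimes> ((a \<otimes> a') \<otimes> (t \<otimes> inv t)) \<oplus> y' \<otimes> a \<otimes> inv t"
    using cl s inv by simp
  also have "\<dots> = y' \<otimes> a \<otimes> inv t \<otimes> (\<one> \<oplus> a' \<otimes> t)" using cl c by algebra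
  finally have "y' \<oplus> y' \<otimes> a \<otimes> inv t = y' \<otimes> a \<otimes> inv t \<otimes> s" unfolding rec .
  then have "(y \<otimes> a' \<otimes> (t \<otimes> inv s)) \<otimes> (y' \<oplus> y' \<otimes> a \<otimes> inv t)
      = (y \<otimes> y') \<otimes> (a \<otimes> a') \<otimes> (t \<otimes> inv t) \<otimes> (s \<otimes> inv s)"
    using cl c by (simp add: m_ac)
  then show ?B using s inv by simp
qed

context cartan_datum
begin

sublocale Y: cring "Y_ring :: 'n series ring" by (rule cring_Y_ring)

lemma mseries_E: "mseries m \<in> carrier E"
  by (rule mseries_in_Ye_ring[OF simple_cartan])

lemma mseries_E_mult: "mseries u \<otimes>\<^bsub>E\<^esub> mseries v = mseries (u + v)"
  by (simp add: Ye_ring_simps conv_mseries_mseries)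

lemma mseries_E_inverse: "mseries m \<otimes>\<^bsub>E\<^esub> mseries (- m) = \<one>\<^bsub>E\<^esub>"
  by (simp only: mseries_E_mult) (simp add: Ye_ring_simps)

lemma mseries_E_Unit: "mseries m \<in> Units E"
  using mseries_E_inverse[of m] mseries_E_inverse[of "- m"] mseries_E unfolding Units_def by auto

section \<open>The image of Y_{i,a} under Theta and its inverse\<close>

abbreviation Y_image :: "cstar \<Rightarrow> 'n series" where
  "Y_image a \<equiv> mseries (Y_mon i a) \<otimes>\<^bsub>E\<^esub> mseries (- A (a / Q))
     \<otimes>\<^bsub>E\<^esub> (\<Sigma> (a / Q ^ 3) \<otimes>\<^bsub>E\<^esub> inv\<^bsub>E\<^esub> \<Sigma> (a / Q))"

lemma Y_image_eq:
  "Y_image a = mseries (Y_mon i a) \<ominus>\<^bsub>E\<^esub> mseries (Y_mon i a) \<otimes>\<^bsub>E\<^esub> inv\<^bsub>E\<^esub> \<Sigma> (a / Q)"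
  and Y_image_inverse:
  "Y_image a \<otimes>\<^bsub>E\<^esub> (mseries (- Y_mon i a) \<oplus>\<^bsub>E\<^esub>
     mseries (- Y_mon i a) \<otimes>\<^bsub>E\<^esub> mseries (A (a / Q)) \<otimes>\<^bsub>E\<^esub> inv\<^bsub>E\<^esub> \<Sigma> (a / Q ^ 3)) = \<one>\<^bsub>E\<^esub>"
proof -
  have rec: "\<Sigma> (a / Q) = \<one>\<^bsub>E\<^esub> \<oplus>\<^bsub>E\<^esub> mseries (- A (a / Q)) \<otimes>\<^bsub>E\<^esub> \<Sigma> (a / Q ^ 3)"
    using Sigma_recursion[of "a / Q"] by (simp only: cstar_shift(1))
  note id = E.deformation_identities[OF mseries_E mseries_E mseries_E mseries_E Sigma_Unit Sigma_Unit
      mseries_E_inverse mseries_E_inverse rec]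
  show "Y_image a = mseries (Y_mon i a) \<ominus>\<^bsub>E\<^esub> mseries (Y_mon i a) \<otimes>\<^bsub>E\<^esub> inv\<^bsub>E\<^esub> \<Sigma> (a / Q)"
    by (rule id(1))
  show "Y_image a \<otimes>\<^bsub>E\<^esub> (mseries (- Y_mon i a) \<oplus>\<^bsub>E\<^esub>
     mseries (- Y_mon i a) \<otimes>\<^bsub>E\<^esub> mseries (A (a / Q)) \<otimes>\<^bsub>E\<^esub> inv\<^bsub>E\<^esub> \<Sigma> (a / Q ^ 3)) = \<one>\<^bsub>E\<^esub>"
    by (rule id(2))
qed

lemma hom_inverse_unique:
  assumes \<theta>: "\<theta> \<in> ring_hom Y_ring E" and v: "v \<in> carrier E" "\<theta> (mseries m) \<otimes>\<^bsub>E\<^esub> v = \<one>\<^bsub>E\<^esub>"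
  shows "\<theta> (mseries (- m)) = v"
proof -
  have cl: "\<theta> (mseries u) \<in> carrier E" for u
    by (rule ring_hom_closed[OF \<theta> mseries_in_Y_ring])
  have "mseries (- m) \<otimes>\<^bsub>Y_ring\<^esub> mseries m = \<one>\<^bsub>Y_ring\<^esub>"
    by (simp add: mseries_mult Y_ring_simps(4))
  then have "\<theta> (mseries (- m)) \<otimes>\<^bsub>E\<^esub> \<theta> (mseries m) = \<one>\<^bsub>E\<^esub>"
    using ring_hom_mult[OF \<theta> mseries_in_Y_ring mseries_in_Y_ring, of "- m" m] ring_hom_one[OF \<theta>]
    by simp
  then show ?thesis by (rule E.inv_unique[OF _ v(2) cl cl v(1)])
qed

abbreviation "\<Theta> \<equiv> Theta C d q i"

lemma Theta:
  "\<Theta> \<in> ring_hom Y_ring E"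
  "j \<noteq> i \<Longrightarrow> \<Theta> (mseries (Y_mon j a)) = mseries (Y_mon j a)"
  "j \<noteq> i \<Longrightarrow> \<Theta> (mseries (- Y_mon j a)) = mseries (- Y_mon j a)"
  "\<Theta> (mseries (Y_mon i a)) = Y_image a"
proof -
  define u where "u j a = (if j = i then Y_image a else mseries (Y_mon j a))" for j a
  have "Y_image a \<in> Units E" for a
    by (rule E.Units_m_closed E.Units_inv_Units mseries_E_Unit Sigma_Unit)+
  then have u: "u j a \<in> Units E" for j a
    unfolding u_def by (simp only: mseries_E_Unit simp_thms split: if_split)
  obtain \<theta> where \<theta>: "\<theta> \<in> ring_hom Y_ring E" "\<forall>j a. \<theta> (mseries (Y_mon j a)) = u j a"
    by (rule Y_ring_hom_exists[OF E.is_cring u])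
  \<comment> \<open>The description in \<open>Theta_def\<close> asks for an extensional function,
    which fixes the values outside the carrier and so makes uniqueness possible.\<close>
  define \<theta>' where "\<theta>' = restrict \<theta> (carrier Y_ring)"
  have \<theta>': "\<theta>' \<in> ring_hom Y_ring E"
    unfolding \<theta>'_def by (rule ring_hom_restrict[OF Y.ring_axioms \<theta>(1)])
  have \<theta>'_gen: "\<theta>' (mseries (Y_mon j a)) = u j a" for j a
    by (simp add: \<theta>'_def \<theta>(2) mseries_in_Y_ring)
  let ?P = "\<lambda>\<theta>. \<theta> \<in> extensional (carrier Y_ring) \<and> \<theta> \<in> ring_hom Y_ring E \<and>
     (\<forall>j a. j \<noteq> i \<longrightarrow> \<theta> (mseries (Y_mon j a)) = mseries (Y_mon j a) \<and>
                      \<theta> (mseries (- Y_mon j a)) = mseries (- Y_mon j a)) \<and>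
     (\<forall>a. \<theta> (mseries (Y_mon i a)) = Y_image a)"
  have "?P \<theta>'"
  proof (intro conjI allI impI)
    show "\<theta>' \<in> extensional (carrier Y_ring)" by (simp add: \<theta>'_def)
    show "\<theta>' \<in> ring_hom Y_ring E" by (rule \<theta>')
    show "\<theta>' (mseries (Y_mon j a)) = mseries (Y_mon j a)" if "j \<noteq> i" for j a
      using that by (simp only: \<theta>'_gen u_def simp_thms if_False)
    show "\<theta>' (mseries (Y_mon i a)) = Y_image a" for a
      by (simp only: \<theta>'_gen u_def simp_thms if_True)
    show "\<theta>' (mseries (- Y_mon j a)) = mseries (- Y_mon j a)" if "j \<noteq> i" for j a
      by (rule hom_inverse_unique[OF \<theta>' mseries_E]) (simp only: \<theta>'_gen u_def that if_False mseries_E_inverse)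
  qed
  moreover have "\<eta> = \<theta>'" if "?P \<eta>" for \<eta>
  proof (rule extensionalityI[of \<eta> "carrier (Y_ring :: 'n series ring)" \<theta>'])
    show "\<eta> \<in> extensional (carrier Y_ring)" using that by (elim conjE)
    show "\<theta>' \<in> extensional (carrier Y_ring)" by (simp add: \<theta>'_def)
    fix f :: "'n series" assume f: "f \<in> carrier Y_ring"
    show "\<eta> f = \<theta>' f"
    proof (rule Y_ring_hom_eqI[OF E.is_cring _ \<theta>' _ f])
      show "\<eta> (mseries (Y_mon j a)) = \<theta>' (mseries (Y_mon j a))" for j a
        using that by (cases "j = i") (simp_all only: \<theta>'_gen u_def simp_thms if_True if_False)
      show "\<eta> \<in> ring_hom Y_ring E" using that by (elim conjE)
    qed
  qed
  ultimately have "?P \<Theta>"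
    unfolding Theta_def by (rule theI)
  then show "\<Theta> \<in> ring_hom Y_ring E"
    "j \<noteq> i \<Longrightarrow> \<Theta> (mseries (Y_mon j a)) = mseries (Y_mon j a)"
    "j \<noteq> i \<Longrightarrow> \<Theta> (mseries (- Y_mon j a)) = mseries (- Y_mon j a)"
    "\<Theta> (mseries (Y_mon i a)) = Y_image a" by (simp_all only: simp_thms)
qed

lemma Theta_inv:
  "\<Theta> (mseries (- Y_mon i a)) = mseries (- Y_mon i a) \<oplus>\<^bsub>E\<^esub>
     mseries (- Y_mon i a) \<otimes>\<^bsub>E\<^esub> mseries (A (a / Q)) \<otimes>\<^bsub>E\<^esub> inv\<^bsub>E\<^esub> \<Sigma> (a / Q ^ 3)"
  by (rule hom_inverse_unique[OF Theta(1)])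
    (simp_all only: Theta(4) Y_image_inverse mseries_E Sigma_Unit E.Units_inv_closed E.m_closed E.a_closed)


section \<open>The deformed homomorphism\<close>

abbreviation "H \<equiv> Yeh_ring C"
abbreviation "\<iota> \<equiv> emb C"
abbreviation "h \<equiv> hvar C"
abbreviation "\<sigma> a \<equiv> inv\<^bsub>H\<^esub> (Sigma_h C d q i a)"

sublocale H: cring H by (rule E.cring_laurent_ring)

lemma emb_hom: "\<iota> \<in> ring_hom E H"
  by (rule E.laurent_const_hom)

lemmas emb_closed = ring_hom_closed[OF emb_hom]
lemmas emb_mult = ring_hom_mult[OF emb_hom]
lemmas emb_add = ring_hom_add[OF emb_hom]
lemmas emb_one = ring_hom_one[OF emb_hom]
lemmas emb_uminus = ring_hom_uminus[OF E.ring_axioms H.ring_axioms emb_hom]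

lemma emb_minus: "x \<in> carrier E \<Longrightarrow> y \<in> carrier E \<Longrightarrow> \<iota> (x \<ominus>\<^bsub>E\<^esub> y) = \<iota> x \<ominus>\<^bsub>H\<^esub> \<iota> y"
  by (simp add: a_minus_def emb_add emb_uminus)

lemma emb_Y_hom: "\<iota> \<in> ring_hom Y_ring H"
proof (rule ring_hom_memI)
  have sub: "f \<in> carrier E" if "f \<in> carrier Y_ring" for f
    using that Y_ring_subset_Ye_ring[OF simple_cartan] by auto
  fix f g :: "'n series" assume fg: "f \<in> carrier Y_ring" "g \<in> carrier Y_ring"
  show "\<iota> f \<in> carrier H" using sub[OF fg(1)] by (rule emb_closed)
  show "\<iota> (f \<otimes>\<^bsub>Y_ring\<^esub> g) = \<iota> f \<otimes>\<^bsub>H\<^esub> \<iota> g"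
    using emb_mult[OF sub[OF fg(1)] sub[OF fg(2)]] by (simp add: Y_ring_simps Ye_ring_simps)
  show "\<iota> (f \<oplus>\<^bsub>Y_ring\<^esub> g) = \<iota> f \<oplus>\<^bsub>H\<^esub> \<iota> g"
    using emb_add[OF sub[OF fg(1)] sub[OF fg(2)]] by (simp add: Y_ring_simps Ye_ring_simps)
next
  show "\<iota> \<one>\<^bsub>Y_ring\<^esub> = \<one>\<^bsub>H\<^esub>"
    using emb_one by (simp add: Y_ring_simps Ye_ring_simps)
qed

lemma hvar_Unit: "h \<in> Units H"
  by (rule E.laurent_var_Unit)

lemma hvar_closed [simp]: "h \<in> carrier H" "inv\<^bsub>H\<^esub> h \<in> carrier H"
  using hvar_Unit by auto

lemma emb_Sigma_inverse: "\<iota> (\<Sigma> a) \<otimes>\<^bsub>H\<^esub> \<iota> (inv\<^bsub>E\<^esub> \<Sigma> a) = \<one>\<^bsub>H\<^esub>"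
  using emb_mult[OF Sigma_closed E.Units_inv_closed[OF Sigma_Unit], of a a]
  by (simp add: Sigma_Unit emb_one)

lemma Sigma_h_Unit: "Sigma_h C d q i a \<in> Units H"
proof -
  have "\<iota> (\<Sigma> a) \<in> Units H"
    using emb_Sigma_inverse[of a] H.m_comm[of "\<iota> (\<Sigma> a)" "\<iota> (inv\<^bsub>E\<^esub> \<Sigma> a)"]
      emb_closed[OF Sigma_closed] emb_closed[OF E.Units_inv_closed[OF Sigma_Unit]]
    unfolding Units_def by force
  then show ?thesis unfolding Sigma_h_def by (intro H.Units_m_closed hvar_Unit)
qed

lemma sigma_closed [simp]: "\<sigma> a \<in> carrier H" "Sigma_h C d q i a \<in> carrier H"
  using Sigma_h_Unit by auto

text \<open>Turns a division by Sigma into h times a generator of Y_{i,h}; the factor h in the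
  formulas for Theta has its origin here.\<close>

lemma hvar_sigma: "h \<otimes>\<^bsub>H\<^esub> \<sigma> a = \<iota> (inv\<^bsub>E\<^esub> \<Sigma> a)"
proof -
  have cl: "\<iota> (\<Sigma> a) \<in> carrier H" "\<iota> (inv\<^bsub>E\<^esub> \<Sigma> a) \<in> carrier H"
    using emb_closed[OF Sigma_closed] emb_closed[OF E.Units_inv_closed[OF Sigma_Unit]] by auto
  have "h \<otimes>\<^bsub>H\<^esub> \<sigma> a = h \<otimes>\<^bsub>H\<^esub> \<sigma> a \<otimes>\<^bsub>H\<^esub> (\<iota> (\<Sigma> a) \<otimes>\<^bsub>H\<^esub> \<iota> (inv\<^bsub>E\<^esub> \<Sigma> a))"
    by (simp add: emb_Sigma_inverse)
  also have "\<dots> = (Sigma_h C d q i a \<otimes>\<^bsub>H\<^esub> \<sigma> a) \<otimes>\<^bsub>H\<^esub> \<iota> (inv\<^bsub>E\<^esub> \<Sigma> a)"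
    unfolding Sigma_h_def[of C d q i a]
    using cl sigma_closed(1)[of a, unfolded Sigma_h_def] by (simp add: H.m_ac)
  also have "\<dots> = \<iota> (inv\<^bsub>E\<^esub> \<Sigma> a)"
    using cl by (simp add: Sigma_h_Unit)
  finally show ?thesis .
qed

lemma Sigma_h_recursion:
  "Sigma_h C d q i a = h \<oplus>\<^bsub>H\<^esub> \<iota> (mseries (- A a)) \<otimes>\<^bsub>H\<^esub> Sigma_h C d q i (a / Q ^ 2)"
proof -
  note cl = emb_closed[OF Sigma_closed] emb_closed[OF mseries_E]
  have "\<iota> (\<Sigma> a) = \<one>\<^bsub>H\<^esub> \<oplus>\<^bsub>H\<^esub> \<iota> (mseries (- A a)) \<otimes>\<^bsub>H\<^esub> \<iota> (\<Sigma> (a / Q ^ 2))"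
    by (subst Sigma_recursion) (simp add: emb_add emb_mult emb_one mseries_E Sigma_closed)
  then show ?thesis
    unfolding Sigma_h_def using cl by (simp add: H.r_distr H.m_ac)
qed

text \<open>The exact form, for formal h, of the relation that remains at h = 0; the error term is
  an element of Y_{i,h} times h. With s and t the values of Sigma~ at a q_i and a q_i^-1, multiply A
  / t by s / s and expand the numerator s by the recursion.\<close>

lemma sigma_relation:
  "\<iota> (mseries (A (a * Q))) \<otimes>\<^bsub>H\<^esub> \<sigma> (a / Q) = \<sigma> (a * Q) \<oplus>\<^bsub>H\<^esub>
     \<iota> (mseries (A (a * Q))) \<otimes>\<^bsub>H\<^esub> \<sigma> (a * Q) \<otimes>\<^bsub>H\<^esub> \<sigma> (a / Q) \<otimes>\<^bsub>H\<^esub> h"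
proof -
  define x x' s t where "x = \<iota> (mseries (A (a * Q)))" and "x' = \<iota> (mseries (- A (a * Q)))"
    and "s = Sigma_h C d q i (a * Q)" and "t = Sigma_h C d q i (a / Q)"
  have cl: "x \<in> carrier H" "x' \<in> carrier H" "s \<in> carrier H" "t \<in> carrier H"
    "inv\<^bsub>H\<^esub> s \<in> carrier H" "inv\<^bsub>H\<^esub> t \<in> carrier H"
    by (simp_all add: x_def x'_def s_def t_def emb_closed mseries_E)
  have st: "s \<otimes>\<^bsub>H\<^esub> inv\<^bsub>H\<^esub> s = \<one>\<^bsub>H\<^esub>" "t \<otimes>\<^bsub>H\<^esub> inv\<^bsub>H\<^esub> t = \<one>\<^bsub>H\<^esub>"
    by (simp_all add: s_def t_def Sigma_h_Unit)
  have xx': "x \<otimes>\<^bsub>H\<^esub> x' = \<one>\<^bsub>H\<^esub>"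
    unfolding x_def x'_def emb_mult[OF mseries_E mseries_E, symmetric] mseries_E_inverse by (rule emb_one)
  have rec: "s = h \<oplus>\<^bsub>H\<^esub> x' \<otimes>\<^bsub>H\<^esub> t"
    using Sigma_h_recursion[of "a * Q"] unfolding cstar_shift(3) s_def t_def x'_def .
  have "x \<otimes>\<^bsub>H\<^esub> inv\<^bsub>H\<^esub> t = x \<otimes>\<^bsub>H\<^esub> inv\<^bsub>H\<^esub> s \<otimes>\<^bsub>H\<^esub> inv\<^bsub>H\<^esub> t \<otimes>\<^bsub>H\<^esub> s"
  proof -
    have "x \<otimes>\<^bsub>H\<^esub> inv\<^bsub>H\<^esub> s \<otimes>\<^bsub>H\<^esub> inv\<^bsub>H\<^esub> t \<otimes>\<^bsub>H\<^esub> s = x \<otimes>\<^bsub>H\<^esub> inv\<^bsub>H\<^esub> t \<otimes>\<^bsub>H\<^esub> (s \<otimes>\<^bsub>H\<^esub> inv\<^bsub>H\<^esub> s)"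
      using cl by (simp add: H.m_ac)
    then show ?thesis using cl by (simp add: st)
  qed
  also have "\<dots> = x \<otimes>\<^bsub>H\<^esub> inv\<^bsub>H\<^esub> s \<otimes>\<^bsub>H\<^esub> inv\<^bsub>H\<^esub> t \<otimes>\<^bsub>H\<^esub> h
      \<oplus>\<^bsub>H\<^esub> (x \<otimes>\<^bsub>H\<^esub> x') \<otimes>\<^bsub>H\<^esub> (t \<otimes>\<^bsub>H\<^esub> inv\<^bsub>H\<^esub> t) \<otimes>\<^bsub>H\<^esub> inv\<^bsub>H\<^esub> s"
  proof -
    \<comment> \<open>Only the last factor \<open>s\<close> is to be expanded. Variables in place of
      the inverses leave a polynomial identity and keep the \<open>s\<close> inside an inverse
      intact.\<close>
    have "v \<otimes>\<^bsub>H\<^esub> w \<otimes>\<^bsub>H\<^esub> u \<otimes>\<^bsub>H\<^esub> (h \<oplus>\<^bsub>H\<^esub> x' \<otimes>\<^bsub>H\<^esub> t)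
      = v \<otimes>\<^bsub>H\<^esub> w \<otimes>\<^bsub>H\<^esub> u \<otimes>\<^bsub>H\<^esub> h \<oplus>\<^bsub>H\<^esub> (v \<otimes>\<^bsub>H\<^esub> x') \<otimes>\<^bsub>H\<^esub> (t \<otimes>\<^bsub>H\<^esub> u) \<otimes>\<^bsub>H\<^esub> w"
      if "v \<in> carrier H" "w \<in> carrier H" "u \<in> carrier H" for u v w
      using that cl hvar_closed(1) by algebra
    from this[OF cl(1,5,6)] show ?thesis unfolding rec[symmetric] .
  qed
  also have "\<dots> = inv\<^bsub>H\<^esub> s \<oplus>\<^bsub>H\<^esub> x \<otimes>\<^bsub>H\<^esub> inv\<^bsub>H\<^esub> s \<otimes>\<^bsub>H\<^esub> inv\<^bsub>H\<^esub> t \<otimes>\<^bsub>H\<^esub> h"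
    using cl by (simp add: st xx' H.a_comm)
  finally show ?thesis by (simp only: x_def s_def t_def)
qed

lemma Theta_h_other:
  assumes "j \<noteq> i"
  shows "Theta_h C d q i (mseries (Y_mon j a)) = \<iota> (mseries (Y_mon j a))"
    "Theta_h C d q i (mseries (- Y_mon j a)) = \<iota> (mseries (- Y_mon j a))"
  by (simp_all add: Theta_h_def Theta assms)

lemma Theta_h_gen:
  "Theta_h C d q i (mseries (Y_mon i a)) = \<iota> (mseries (Y_mon i a)) \<ominus>\<^bsub>H\<^esub> h \<otimes>\<^bsub>H\<^esub>
     (\<iota> (mseries (Y_mon i a)) \<otimes>\<^bsub>H\<^esub> \<sigma> (a / Q))"
proof -
  have cl: "\<iota> (mseries (Y_mon i a)) \<in> carrier H" by (rule emb_closed[OF mseries_E])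
  have "Theta_h C d q i (mseries (Y_mon i a)) = \<iota> (mseries (Y_mon i a)) \<ominus>\<^bsub>H\<^esub>
      \<iota> (mseries (Y_mon i a)) \<otimes>\<^bsub>H\<^esub> (h \<otimes>\<^bsub>H\<^esub> \<sigma> (a / Q))"
    by (simp add: Theta_h_def Theta(4) Y_image_eq emb_minus emb_mult mseries_E Sigma_Unit hvar_sigma)
  then show ?thesis using cl by (simp add: H.m_lcomm)
qed

lemma Theta_h_inv:
  "Theta_h C d q i (mseries (- Y_mon i a)) = \<iota> (mseries (- Y_mon i a)) \<oplus>\<^bsub>H\<^esub> h \<otimes>\<^bsub>H\<^esub>
     (\<iota> (mseries (- Y_mon i a)) \<otimes>\<^bsub>H\<^esub> \<iota> (mseries (A (a / Q))) \<otimes>\<^bsub>H\<^esub> \<sigma> (a / Q ^ 3))"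
proof -
  have cl: "\<iota> (mseries (- Y_mon i a)) \<in> carrier H" "\<iota> (mseries (A (a / Q))) \<in> carrier H"
    by (simp_all add: emb_closed mseries_E)
  have "Theta_h C d q i (mseries (- Y_mon i a)) = \<iota> (mseries (- Y_mon i a)) \<oplus>\<^bsub>H\<^esub>
     \<iota> (mseries (- Y_mon i a)) \<otimes>\<^bsub>H\<^esub> \<iota> (mseries (A (a / Q))) \<otimes>\<^bsub>H\<^esub> (h \<otimes>\<^bsub>H\<^esub> \<sigma> (a / Q ^ 3))"
    by (simp add: Theta_h_def Theta_inv emb_add emb_mult mseries_E Sigma_Unit hvar_sigma)
  then show ?thesis using cl by (simp add: H.m_ac)
qed

lemma Theta_h_hom: "Theta_h C d q i \<in> ring_hom Y_ring H"
  unfolding Theta_h_def[abs_def]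
  using ring_hom_closed[OF Theta(1)] ring_hom_mult[OF Theta(1)] ring_hom_add[OF Theta(1)]
    ring_hom_one[OF Theta(1)]
  by (intro ring_hom_memI) (simp_all add: emb_closed emb_mult emb_add emb_one)

end


section \<open>The difference quotient \<open>h\<^sup>-\<^sup>1(\<Theta> - id)\<close>\<close>

context cartan_datum
begin

abbreviation "K \<equiv> Yih_ring C d q i"
abbreviation "\<Theta>h \<equiv> Theta_h C d q i"

lemma K_simps:
  "x \<otimes>\<^bsub>K\<^esub> y = x \<otimes>\<^bsub>H\<^esub> y" "x \<oplus>\<^bsub>K\<^esub> y = x \<oplus>\<^bsub>H\<^esub> y"
  "\<one>\<^bsub>K\<^esub> = \<one>\<^bsub>H\<^esub>" "\<zero>\<^bsub>K\<^esub> = \<zero>\<^bsub>H\<^esub>"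
  by (simp_all add: Yih_ring_def)

lemma emb_Y_closed: "P \<in> carrier Y_ring \<Longrightarrow> \<iota> P \<in> carrier H"
  by (rule ring_hom_closed[OF emb_Y_hom])

lemma Theta_h_closed: "P \<in> carrier Y_ring \<Longrightarrow> \<Theta>h P \<in> carrier H"
  by (rule ring_hom_closed[OF Theta_h_hom])

lemma K_generators:
  "\<iota> ` carrier Y_ring \<union> {h} \<union> {\<sigma> a | a. True} \<subseteq> carrier H"
  using emb_Y_closed hvar_closed(1) sigma_closed(1) by blast

lemma carrier_K:
  "carrier K = generate_ring H (\<iota> ` carrier Y_ring \<union> {h} \<union> {\<sigma> a | a. True})"
  by (simp add: Yih_ring_def)

lemma cring_K: "cring K"
  using H.subcring_iff[OF H.generate_ring_incl[OF K_generators]]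
    H.subcringI'[OF H.generate_ring_is_subring[OF K_generators]]
  unfolding Yih_ring_def by blast

sublocale K: cring K by (rule cring_K)

lemma K_subset: "x \<in> carrier K \<Longrightarrow> x \<in> carrier H"
  unfolding carrier_K by (rule H.generate_ring_in_carrier[OF K_generators])

lemma K_closed:
  "P \<in> carrier Y_ring \<Longrightarrow> \<iota> P \<in> carrier K" "h \<in> carrier K" "\<sigma> a \<in> carrier K"
  "x \<in> carrier K \<Longrightarrow> y \<in> carrier K \<Longrightarrow> x \<otimes>\<^bsub>H\<^esub> y \<in> carrier K"
  "x \<in> carrier K \<Longrightarrow> y \<in> carrier K \<Longrightarrow> x \<oplus>\<^bsub>H\<^esub> y \<in> carrier K"
  "x \<in> carrier K \<Longrightarrow> \<ominus>\<^bsub>H\<^esub> x \<in> carrier K"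
  "\<zero>\<^bsub>H\<^esub> \<in> carrier K"
proof -
  show "\<iota> P \<in> carrier K" if "P \<in> carrier Y_ring"
    unfolding carrier_K using that by (blast intro: generate_ring.incl)
  show "h \<in> carrier K" "\<sigma> a \<in> carrier K"
    unfolding carrier_K by (blast intro: generate_ring.incl)+
  show "x \<otimes>\<^bsub>H\<^esub> y \<in> carrier K" "x \<oplus>\<^bsub>H\<^esub> y \<in> carrier K"
    if "x \<in> carrier K" "y \<in> carrier K" for x y
    using that unfolding carrier_K by (rule generate_ring.eng_mult generate_ring.eng_add)+
  show "\<ominus>\<^bsub>H\<^esub> x \<in> carrier K" if "x \<in> carrier K"
    using that unfolding carrier_K by (rule generate_ring.a_inv)
  show "\<zero>\<^bsub>H\<^esub> \<in> carrier K" using K.zero_closed by (simp only: K_simps)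
qed

text \<open>The additive inverse is defined through the carrier, so unlike the operations in
  \<open>K_simps\<close> it does not agree with that of \<open>H\<close> by mere unfolding.\<close>

lemma K_uminus: "x \<in> carrier K \<Longrightarrow> \<ominus>\<^bsub>K\<^esub> x = \<ominus>\<^bsub>H\<^esub> x"
  by (rule K.minus_equality) (simp_all add: K_simps K_closed K_subset H.l_neg)

text \<open>Formed in \<open>H\<close>, where h is invertible; that the values lie in
  \<open>K\<close> is the content of \<open>diff_quot_K\<close>.\<close>

definition diff_quot :: "'n series \<Rightarrow> int \<Rightarrow> 'n series" where
  "diff_quot P = inv\<^bsub>H\<^esub> h \<otimes>\<^bsub>H\<^esub> (\<Theta>h P \<ominus>\<^bsub>H\<^esub> \<iota> P)"

lemma diff_quot_H: "P \<in> carrier Y_ring \<Longrightarrow> diff_quot P \<in> carrier H"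
  unfolding diff_quot_def by (intro H.m_closed H.minus_closed hvar_closed emb_Y_closed Theta_h_closed)

lemma Theta_h_diff: "P \<in> carrier Y_ring \<Longrightarrow> \<Theta>h P \<ominus>\<^bsub>H\<^esub> \<iota> P = diff_quot P \<otimes>\<^bsub>H\<^esub> h"
proof -
  assume "P \<in> carrier Y_ring"
  then have cl: "\<Theta>h P \<ominus>\<^bsub>H\<^esub> \<iota> P \<in> carrier H"
    by (intro H.minus_closed emb_Y_closed Theta_h_closed)
  have "diff_quot P \<otimes>\<^bsub>H\<^esub> h = (inv\<^bsub>H\<^esub> h \<otimes>\<^bsub>H\<^esub> h) \<otimes>\<^bsub>H\<^esub> (\<Theta>h P \<ominus>\<^bsub>H\<^esub> \<iota> P)"
    unfolding diff_quot_def using cl hvar_closed by (simp only: H.m_ac H.m_closed)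
  then show ?thesis using cl hvar_Unit by (simp only: H.Units_l_inv H.l_one)
qed

text \<open>As h is a unit, x is determined by Theta(P) = P + h x. The rules for sums, products and
  generators are obtained by exhibiting such an x.\<close>

lemma diff_quotI:
  assumes "P \<in> carrier Y_ring" "x \<in> carrier H" "\<Theta>h P = \<iota> P \<oplus>\<^bsub>H\<^esub> h \<otimes>\<^bsub>H\<^esub> x"
  shows "diff_quot P = x"
proof -
  note cl = emb_Y_closed[OF assms(1)] assms(2) hvar_closed
  have "\<iota> P \<oplus>\<^bsub>H\<^esub> h \<otimes>\<^bsub>H\<^esub> x \<ominus>\<^bsub>H\<^esub> \<iota> P = h \<otimes>\<^bsub>H\<^esub> x" using cl by algebra
  then have "diff_quot P = (inv\<^bsub>H\<^esub> h \<otimes>\<^bsub>H\<^esub> h) \<otimes>\<^bsub>H\<^esub> x"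
    unfolding diff_quot_def assms(3) using cl by (simp only: H.m_assoc)
  then show ?thesis using cl hvar_Unit by (simp only: H.Units_l_inv H.l_one)
qed

lemma Theta_h_eq: 
  assumes "P \<in> carrier Y_ring"
  shows "\<Theta>h P = \<iota> P \<oplus>\<^bsub>H\<^esub> h \<otimes>\<^bsub>H\<^esub> diff_quot P"
proof -
  note cl = emb_Y_closed[OF assms] Theta_h_closed[OF assms] hvar_closed diff_quot_H[OF assms]
  have "\<Theta>h P = \<iota> P \<oplus>\<^bsub>H\<^esub> (\<Theta>h P \<ominus>\<^bsub>H\<^esub> \<iota> P)" using cl by algebra
  then show ?thesis unfolding Theta_h_diff[OF assms] using cl by (simp only: H.m_comm)
qed

lemma diff_quot_add:
  assumes P: "P \<in> carrier Y_ring" and R: "R \<in> carrier Y_ring"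
  shows "diff_quot (P \<oplus>\<^bsub>Y_ring\<^esub> R) = diff_quot P \<oplus>\<^bsub>H\<^esub> diff_quot R"
proof (rule diff_quotI)
  note cl = emb_Y_closed[OF P] emb_Y_closed[OF R] hvar_closed diff_quot_H[OF P] diff_quot_H[OF R]
  have "\<Theta>h (P \<oplus>\<^bsub>Y_ring\<^esub> R) = (\<iota> P \<oplus>\<^bsub>H\<^esub> h \<otimes>\<^bsub>H\<^esub> diff_quot P) \<oplus>\<^bsub>H\<^esub> (\<iota> R \<oplus>\<^bsub>H\<^esub> h \<otimes>\<^bsub>H\<^esub> diff_quot R)"
    by (simp only: ring_hom_add[OF Theta_h_hom P R] Theta_h_eq[OF P, symmetric] Theta_h_eq[OF R, symmetric])
  also have "\<dots> = (\<iota> P \<oplus>\<^bsub>H\<^esub> \<iota> R) \<oplus>\<^bsub>H\<^esub> h \<otimes>\<^bsub>H\<^esub> (diff_quot P \<oplus>\<^bsub>H\<^esub> diff_quot R)"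
    using cl by algebra
  finally show "\<Theta>h (P \<oplus>\<^bsub>Y_ring\<^esub> R) = \<iota> (P \<oplus>\<^bsub>Y_ring\<^esub> R) \<oplus>\<^bsub>H\<^esub> h \<otimes>\<^bsub>H\<^esub> (diff_quot P \<oplus>\<^bsub>H\<^esub> diff_quot R)"
    by (simp only: ring_hom_add[OF emb_Y_hom P R])
qed (use assms diff_quot_H in auto)

lemma diff_quot_mult:
  assumes P: "P \<in> carrier Y_ring" and R: "R \<in> carrier Y_ring"
  shows "diff_quot (P \<otimes>\<^bsub>Y_ring\<^esub> R) = \<Theta>h P \<otimes>\<^bsub>H\<^esub> diff_quot R \<oplus>\<^bsub>H\<^esub> \<iota> R \<otimes>\<^bsub>H\<^esub> diff_quot P"
proof (rule diff_quotI)
  note cl = emb_Y_closed[OF P] emb_Y_closed[OF R] hvar_closed diff_quot_H[OF P] diff_quot_H[OF R]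
    Theta_h_closed[OF P]
  show "\<Theta>h P \<otimes>\<^bsub>H\<^esub> diff_quot R \<oplus>\<^bsub>H\<^esub> \<iota> R \<otimes>\<^bsub>H\<^esub> diff_quot P \<in> carrier H"
    by (intro H.a_closed H.m_closed cl)
  have "\<Theta>h (P \<otimes>\<^bsub>Y_ring\<^esub> R) = \<Theta>h P \<otimes>\<^bsub>H\<^esub> (\<iota> R \<oplus>\<^bsub>H\<^esub> h \<otimes>\<^bsub>H\<^esub> diff_quot R)"
    by (simp only: ring_hom_mult[OF Theta_h_hom P R] Theta_h_eq[OF R, symmetric])
  also have "\<dots> = \<Theta>h P \<otimes>\<^bsub>H\<^esub> \<iota> R \<oplus>\<^bsub>H\<^esub> h \<otimes>\<^bsub>H\<^esub> (\<Theta>h P \<otimes>\<^bsub>H\<^esub> diff_quot R)"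
    using cl by algebra
  also have "\<Theta>h P \<otimes>\<^bsub>H\<^esub> \<iota> R = (\<iota> P \<oplus>\<^bsub>H\<^esub> h \<otimes>\<^bsub>H\<^esub> diff_quot P) \<otimes>\<^bsub>H\<^esub> \<iota> R"
    by (simp only: Theta_h_eq[OF P, symmetric])
  also have "(\<iota> P \<oplus>\<^bsub>H\<^esub> h \<otimes>\<^bsub>H\<^esub> diff_quot P) \<otimes>\<^bsub>H\<^esub> \<iota> R \<oplus>\<^bsub>H\<^esub> h \<otimes>\<^bsub>H\<^esub> (\<Theta>h P \<otimes>\<^bsub>H\<^esub> diff_quot R)
      = \<iota> P \<otimes>\<^bsub>H\<^esub> \<iota> R \<oplus>\<^bsub>H\<^esub> h \<otimes>\<^bsub>H\<^esub> (\<Theta>h P \<otimes>\<^bsub>H\<^esub> diff_quot R \<oplus>\<^bsub>H\<^esub> \<iota> R \<otimes>\<^bsub>H\<^esub> diff_quot P)"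
    using cl by algebra
  finally show "\<Theta>h (P \<otimes>\<^bsub>Y_ring\<^esub> R) = \<iota> (P \<otimes>\<^bsub>Y_ring\<^esub> R) \<oplus>\<^bsub>H\<^esub> h \<otimes>\<^bsub>H\<^esub>
      (\<Theta>h P \<otimes>\<^bsub>H\<^esub> diff_quot R \<oplus>\<^bsub>H\<^esub> \<iota> R \<otimes>\<^bsub>H\<^esub> diff_quot P)"
    by (simp only: ring_hom_mult[OF emb_Y_hom P R])
qed (rule Y.m_closed[OF P R])

lemma diff_quot_uminus:
  assumes P: "P \<in> carrier Y_ring"
  shows "diff_quot (\<ominus>\<^bsub>Y_ring\<^esub> P) = \<ominus>\<^bsub>H\<^esub> diff_quot P"
proof (rule diff_quotI)
  note cl = emb_Y_closed[OF P] hvar_closed diff_quot_H[OF P]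
  have "\<Theta>h (\<ominus>\<^bsub>Y_ring\<^esub> P) = \<ominus>\<^bsub>H\<^esub> (\<iota> P \<oplus>\<^bsub>H\<^esub> h \<otimes>\<^bsub>H\<^esub> diff_quot P)"
    by (simp only: ring_hom_uminus[OF Y.ring_axioms H.ring_axioms Theta_h_hom P] Theta_h_eq[OF P, symmetric])
  also have "\<dots> = \<ominus>\<^bsub>H\<^esub> \<iota> P \<oplus>\<^bsub>H\<^esub> h \<otimes>\<^bsub>H\<^esub> (\<ominus>\<^bsub>H\<^esub> diff_quot P)" using cl by algebra
  finally show "\<Theta>h (\<ominus>\<^bsub>Y_ring\<^esub> P) = \<iota> (\<ominus>\<^bsub>Y_ring\<^esub> P) \<oplus>\<^bsub>H\<^esub> h \<otimes>\<^bsub>H\<^esub> (\<ominus>\<^bsub>H\<^esub> diff_quot P)"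
    by (simp only: ring_hom_uminus[OF Y.ring_axioms H.ring_axioms emb_Y_hom P])
qed (use P diff_quot_H in auto)

section \<open>The difference quotient on the variables and their inverses, and its
  integrality\<close>

lemma diff_quot_other:
  assumes "j \<noteq> i"
  shows "diff_quot (mseries (Y_mon j a)) = \<zero>\<^bsub>H\<^esub>" "diff_quot (mseries (- Y_mon j a)) = \<zero>\<^bsub>H\<^esub>"
  by (rule diff_quotI;
      simp add: mseries_in_Y_ring Theta_h_other[OF assms] emb_Y_closed)+

lemma diff_quot_gen:
  "diff_quot (mseries (Y_mon i a)) = \<ominus>\<^bsub>H\<^esub> (\<iota> (mseries (Y_mon i a)) \<otimes>\<^bsub>H\<^esub> \<sigma> (a / Q))"
proof (rule diff_quotI[OF mseries_in_Y_ring])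
  note cl = emb_Y_closed[OF mseries_in_Y_ring, of "Y_mon i a"] sigma_closed(1)[of "a / Q"]
  show "\<ominus>\<^bsub>H\<^esub> (\<iota> (mseries (Y_mon i a)) \<otimes>\<^bsub>H\<^esub> \<sigma> (a / Q)) \<in> carrier H"
    by (intro H.a_inv_closed H.m_closed cl)
  show "\<Theta>h (mseries (Y_mon i a)) = \<iota> (mseries (Y_mon i a)) \<oplus>\<^bsub>H\<^esub> h \<otimes>\<^bsub>H\<^esub>
      (\<ominus>\<^bsub>H\<^esub> (\<iota> (mseries (Y_mon i a)) \<otimes>\<^bsub>H\<^esub> \<sigma> (a / Q)))"
    unfolding Theta_h_gen a_minus_def using cl by (simp only: H.r_minus hvar_closed H.m_closed)
qed

lemma diff_quot_inv:
  "diff_quot (mseries (- Y_mon i a)) =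
     \<iota> (mseries (- Y_mon i a)) \<otimes>\<^bsub>H\<^esub> \<iota> (mseries (A (a / Q))) \<otimes>\<^bsub>H\<^esub> \<sigma> (a / Q ^ 3)"
  by (rule diff_quotI[OF mseries_in_Y_ring _ Theta_h_inv])
    (intro H.m_closed emb_Y_closed mseries_in_Y_ring sigma_closed(1))

text \<open>The membership of \<open>diff_quot P\<close> is a premise because the lemma serves
  inside the induction for \<open>diff_quot_K\<close>: there the rule for products also involves
  Theta(P), with the difference quotient of P already under control.\<close>

lemma Theta_h_K: "P \<in> carrier Y_ring \<Longrightarrow> diff_quot P \<in> carrier K \<Longrightarrow> \<Theta>h P \<in> carrier K"
  by (simp only: Theta_h_eq[of P]) (intro K_closed)

lemma diff_quot_K: "P \<in> carrier Y_ring \<Longrightarrow> diff_quot P \<in> carrier K"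
proof (induction rule: Y_ring_induct)
  case (gen j a)
  show ?case
  proof (cases "j = i")
    case True
    show ?thesis unfolding True diff_quot_gen by (intro K_closed mseries_in_Y_ring)
  qed (simp only: diff_quot_other K_closed simp_thms)
next
  case (inv j a)
  show ?case
  proof (cases "j = i")
    case True
    show ?thesis unfolding True diff_quot_inv by (intro K_closed mseries_in_Y_ring)
  qed (simp only: diff_quot_other K_closed simp_thms)
next
  case (add P R)
  then show ?case unfolding diff_quot_add[OF add(1,2)] by (intro K_closed)
next
  case (uminus P)
  then show ?case unfolding diff_quot_uminus[OF uminus(1)] by (intro K_closed)
next
  case (mult P R)
  show ?case unfolding diff_quot_mult[OF mult(1,2)]
    by (intro K_closed Theta_h_K mult)
qed

lemma Theta_h_hom_K: "\<Theta>h \<in> ring_hom Y_ring K"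
  by (rule ring_hom_memI)
    (simp_all only: Theta_h_K diff_quot_K K_simps ring_hom_mult[OF Theta_h_hom] ring_hom_add[OF Theta_h_hom]
      ring_hom_one[OF Theta_h_hom])

lemma emb_hom_K: "\<iota> \<in> ring_hom Y_ring K"
  by (rule ring_hom_memI)
    (simp_all only: K_closed K_simps ring_hom_mult[OF emb_Y_hom] ring_hom_add[OF emb_Y_hom]
      ring_hom_one[OF emb_Y_hom])


section \<open>The specialization at \<open>h = 0\<close>\<close>

abbreviation "J \<equiv> h_ideal C d q i"
abbreviation "B \<equiv> K Quot J"
abbreviation "cl \<equiv> h_class C d q i"
abbreviation "M0 \<equiv> Yi0_module C d q i"

lemma ideal_J: "ideal J K"
  unfolding h_ideal_def by (rule K.cgenideal_ideal[OF K_closed(2)])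

lemma in_J: "x \<in> carrier K \<Longrightarrow> x \<otimes>\<^bsub>H\<^esub> h \<in> J"
  unfolding h_ideal_def cgenideal_def K_simps by blast

lemma Theta_h_diff_in_J: "P \<in> carrier Y_ring \<Longrightarrow> \<Theta>h P \<ominus>\<^bsub>H\<^esub> \<iota> P \<in> J"
  unfolding Theta_h_diff by (rule in_J[OF diff_quot_K])

sublocale B: cring B by (rule ideal.quotient_is_cring[OF ideal_J K.is_cring])

lemma cl_hom: "cl \<in> ring_hom K B"
  unfolding h_class_def[abs_def] by (rule ideal.rcos_ring_hom[OF ideal_J])

lemmas cl_closed = ring_hom_closed[OF cl_hom]

lemma cl_mult: "x \<in> carrier K \<Longrightarrow> y \<in> carrier K \<Longrightarrow> cl (x \<otimes>\<^bsub>H\<^esub> y) = cl x \<otimes>\<^bsub>B\<^esub> cl y"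
  using ring_hom_mult[OF cl_hom] by (simp only: K_simps)

lemma cl_add: "x \<in> carrier K \<Longrightarrow> y \<in> carrier K \<Longrightarrow> cl (x \<oplus>\<^bsub>H\<^esub> y) = cl x \<oplus>\<^bsub>B\<^esub> cl y"
  using ring_hom_add[OF cl_hom] by (simp only: K_simps)

lemma cl_uminus: "x \<in> carrier K \<Longrightarrow> cl (\<ominus>\<^bsub>H\<^esub> x) = \<ominus>\<^bsub>B\<^esub> cl x"
  using ring_hom_uminus[OF K.ring_axioms B.ring_axioms cl_hom] K_uminus by metis

lemma cl_zero: "cl \<zero>\<^bsub>H\<^esub> = \<zero>\<^bsub>B\<^esub>"
  using ring_hom_zero[OF cl_hom K.ring_axioms B.ring_axioms] by (simp only: K_simps)

lemma cl_hvar: "x \<in> carrier K \<Longrightarrow> cl (x \<otimes>\<^bsub>H\<^esub> h) = \<zero>\<^bsub>B\<^esub>"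
proof -
  assume "x \<in> carrier K"
  then have "x \<otimes>\<^bsub>H\<^esub> h \<in> J" by (rule in_J)
  then have "cl (x \<otimes>\<^bsub>H\<^esub> h) = J"
    unfolding h_class_def using ideal.Icarr[OF ideal_J] additive_subgroup.a_subgroup[OF ideal.axioms(1)[OF ideal_J]]
    by (intro K.a_coset_join2) auto
  then show ?thesis by (simp add: FactRing_def)
qed

lemma cl_Theta_h: "P \<in> carrier Y_ring \<Longrightarrow> cl (\<Theta>h P) = cl (\<iota> P)"
proof -
  assume P: "P \<in> carrier Y_ring"
  note c = K_closed(1)[OF P] K_closed(2) diff_quot_K[OF P]
  have "cl (\<Theta>h P) = cl (\<iota> P \<oplus>\<^bsub>H\<^esub> diff_quot P \<otimes>\<^bsub>H\<^esub> h)"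
    by (subst Theta_h_eq[OF P]) (simp only: H.m_comm[OF K_subset[OF c(2)] K_subset[OF c(3)]])
  also have "\<dots> = cl (\<iota> P) \<oplus>\<^bsub>B\<^esub> \<zero>\<^bsub>B\<^esub>"
    using c by (simp only: cl_add cl_hvar K_closed)
  also have "\<dots> = cl (\<iota> P)" using cl_closed[OF c(1)] by (simp only: B.r_zero)
  finally show ?thesis .
qed

lemma M0_simps:
  "carrier M0 = carrier B" "x \<oplus>\<^bsub>M0\<^esub> y = x \<oplus>\<^bsub>B\<^esub> y" "\<zero>\<^bsub>M0\<^esub> = \<zero>\<^bsub>B\<^esub>"
  "P \<odot>\<^bsub>M0\<^esub> x = cl (\<iota> P) \<otimes>\<^bsub>B\<^esub> x"
  by (simp_all add: Yi0_module_def ring.defs)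

lemma module_M0: "module Y_ring M0"
proof -
  have "(\<lambda>P. cl (\<iota> P)) \<in> ring_hom Y_ring B"
    using ring_hom_trans[OF emb_hom_K cl_hom] by (simp only: comp_def)
  from Y.module_restrict_scalars[OF B.is_cring this] show ?thesis
    unfolding Yi0_module_def .
qed

lemma diff_quot_derivation: "(\<lambda>P. cl (diff_quot P)) \<in> derivations Y_ring M0"
  unfolding derivations_def
proof (intro CollectI conjI ballI funcsetI)
  fix P :: "'n series" assume P: "P \<in> carrier Y_ring"
  show "cl (diff_quot P) \<in> carrier M0"
    using cl_closed[OF diff_quot_K[OF P]] by (simp only: M0_simps)
  fix R :: "'n series" assume R: "R \<in> carrier Y_ring"
  note c = diff_quot_K[OF P] diff_quot_K[OF R] K_closed(1)[OF P] K_closed(1)[OF R]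
    Theta_h_K[OF P diff_quot_K[OF P]]
  show "cl (diff_quot (P \<oplus>\<^bsub>Y_ring\<^esub> R)) = cl (diff_quot P) \<oplus>\<^bsub>M0\<^esub> cl (diff_quot R)"
    using c by (simp only: diff_quot_add[OF P R] cl_add M0_simps)
  show "cl (diff_quot (P \<otimes>\<^bsub>Y_ring\<^esub> R)) = P \<odot>\<^bsub>M0\<^esub> cl (diff_quot R) \<oplus>\<^bsub>M0\<^esub> R \<odot>\<^bsub>M0\<^esub> cl (diff_quot P)"
    using c by (simp only: diff_quot_mult[OF P R] cl_add cl_mult K_closed(4) M0_simps cl_Theta_h[OF P])
qed

end


section \<open>The screening operator\<close>

context cartan_datum
begin

abbreviation "F \<equiv> S_free :: ('n series, cstar \<Rightarrow> 'n series) module"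
abbreviation "N \<equiv> S_relations C d q i"
abbreviation "M1 \<equiv> Yi_module C d q i"
abbreviation "S \<equiv> screening C d q i"

sublocale F: module "Y_ring :: 'n series ring" F by (rule Y.module_free_module)
sublocale M0: module "Y_ring :: 'n series ring" M0 by (rule module_M0)

lemma submodule_N: "submodule N Y_ring F"
  unfolding S_relations_def
proof (rule F.submodule_hull)
  show "{free_gen Y_ring (a * Q ^ 2) \<ominus>\<^bsub>F\<^esub> (mseries (A (a * Q)) \<odot>\<^bsub>F\<^esub> free_gen Y_ring a) | a. True}
      \<subseteq> carrier F"
    by (auto intro!: F.minus_closed F.smult_closed Y.free_gen_closed mseries_in_Y_ring)
qed

sublocale M1: module "Y_ring :: 'n series ring" M1
  unfolding Yi_module_def by (rule F.module_quot_module[OF submodule_N])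

lemmas M1_add = F.quot_module_add_coset[OF submodule_N, folded Yi_module_def]
lemmas M1_smult = F.quot_module_smult_coset[OF submodule_N, folded Yi_module_def]
lemmas M1_coset = F.quot_module_coset[OF submodule_N, folded Yi_module_def]

lemma M1_zero: "N +>\<^bsub>F\<^esub> \<zero>\<^bsub>F\<^esub> = \<zero>\<^bsub>M1\<^esub>"
  using F.a_coset_add_zero[OF F.submoduleE(1)[OF submodule_N]]
  by (simp add: Yi_module_def quot_module_simps)

lemma S_gen_closed: "S_gen C d q i a \<in> carrier M1"
  unfolding S_gen_def by (rule M1_coset[OF Y.free_gen_closed])

text \<open>
  The lift of the screening operator to the free module: the coefficient of \<open>S\<^sub>a\<close> at a monomial is
  the exponent of \<open>Y\<^sub>i\<^sub>,\<^sub>a\<close> in it.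
\<close>

definition log_deriv :: "'n series \<Rightarrow> cstar \<Rightarrow> 'n series" where
  "log_deriv f = (\<lambda>a m. f m * Poly_Mapping.lookup m (i, a))"

text \<open>Only the variables that occur in the finitely many monomials of \<open>f\<close> have a
  nonzero coefficient.\<close>

lemma log_deriv_closed:
  assumes f: "f \<in> carrier Y_ring"
  shows "log_deriv f \<in> carrier F"
proof -
  have fin: "finite {m. f m \<noteq> 0}" using f by (simp add: Y_ring_simps)
  have "{a. log_deriv f a \<noteq> \<zero>\<^bsub>Y_ring\<^esub>} \<subseteq> snd ` (\<Union>m\<in>{m. f m \<noteq> 0}. Poly_Mapping.keys m)"
  proof
    fix a assume "a \<in> {a. log_deriv f a \<noteq> \<zero>\<^bsub>Y_ring\<^esub>}"
    then obtain m where "f m \<noteq> 0" "Poly_Mapping.lookup m (i, a) \<noteq> 0"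
      by (auto simp: log_deriv_def Y_ring_simps fun_eq_iff)
    then show "a \<in> snd ` (\<Union>m\<in>{m. f m \<noteq> 0}. Poly_Mapping.keys m)"
      by (intro image_eqI[of _ _ "(i, a)"]) (auto simp: in_keys_iff)
  qed
  then have "finite {a. log_deriv f a \<noteq> \<zero>\<^bsub>Y_ring\<^esub>}"
    by (rule finite_subset) (use fin in auto)
  moreover have "log_deriv f a \<in> carrier Y_ring" for a
    using finite_subset[OF _ fin, of "{m. log_deriv f a m \<noteq> 0}"]
    by (auto simp: Y_ring_simps log_deriv_def)
  ultimately show ?thesis by (simp add: free_module_simps)
qed

text \<open>Exponents are additive: that of Y_{i,a} in \<open>m\<close> is the sum of those in
  \<open>u\<close> and \<open>m - u\<close>, which splits every term of the convolution into
  two.\<close>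

lemma log_deriv_mult:
  assumes f: "f \<in> carrier Y_ring" and g: "g \<in> carrier Y_ring"
  shows "log_deriv (f \<otimes>\<^bsub>Y_ring\<^esub> g) = f \<odot>\<^bsub>F\<^esub> log_deriv g \<oplus>\<^bsub>F\<^esub> g \<odot>\<^bsub>F\<^esub> log_deriv f"
proof (intro ext)
  fix a m
  define U where "U = {u. f u \<noteq> 0}"
  have U: "finite U" using f by (simp add: U_def Y_ring_simps)
  have D: "log_deriv f a \<in> carrier Y_ring"
    using log_deriv_closed[OF f] by (simp add: free_module_simps)
  have "conv f g m * Poly_Mapping.lookup m (i, a)
      = (\<Sum>u\<in>U. f u * g (m - u) * Poly_Mapping.lookup m (i, a))"
    by (subst conv_eq_sum[OF U]) (auto simp: U_def sum_distrib_right)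
  also have "\<dots> = (\<Sum>u\<in>U. f u * log_deriv g a (m - u)) + (\<Sum>u\<in>U. log_deriv f a u * g (m - u))"
    by (simp add: sum.distrib[symmetric] log_deriv_def lookup_minus algebra_simps)
  also have "(\<Sum>u\<in>U. f u * log_deriv g a (m - u)) = conv f (log_deriv g a) m"
    by (rule conv_eq_sum[OF U, symmetric]) (simp add: U_def)
  also have "(\<Sum>u\<in>U. log_deriv f a u * g (m - u)) = conv (log_deriv f a) g m"
    by (rule conv_eq_sum[OF U, symmetric]) (simp add: U_def log_deriv_def)
  also have "conv (log_deriv f a) g = conv g (log_deriv f a)"
    using Y.m_comm[OF D g] by (simp only: Y_ring_simps(2))
  finally show "log_deriv (f \<otimes>\<^bsub>Y_ring\<^esub> g) a m = (f \<odot>\<^bsub>F\<^esub> log_deriv g \<oplus>\<^bsub>F\<^esub> g \<odot>\<^bsub>F\<^esub> log_deriv f) a m"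
    by (simp only: free_module_simps Y_ring_simps(2,3)) (simp only: log_deriv_def)
qed

lemma log_deriv_add: "log_deriv (f \<oplus>\<^bsub>Y_ring\<^esub> g) = log_deriv f \<oplus>\<^bsub>F\<^esub> log_deriv g"
  by (intro ext) (simp add: free_module_simps Y_ring_simps(3) log_deriv_def distrib_right)

lemma log_deriv_other: "j \<noteq> i \<Longrightarrow> log_deriv (mseries (Y_mon j a)) = \<zero>\<^bsub>F\<^esub>"
  by (intro ext)
    (simp add: log_deriv_def free_module_simps Y_ring_simps mseries_def Y_mon_def lookup_single when_def)

lemma log_deriv_gen: "log_deriv (mseries (Y_mon i a)) = mseries (Y_mon i a) \<odot>\<^bsub>F\<^esub> free_gen Y_ring a"
proof (intro ext)
  fix b m
  have "(mseries (Y_mon i a) \<odot>\<^bsub>F\<^esub> free_gen Y_ring a) b m = free_gen Y_ring a b (m - Y_mon i a)"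
    by (simp only: free_module_simps Y_ring_simps(2) conv_mseries)
  then show "log_deriv (mseries (Y_mon i a)) b m = (mseries (Y_mon i a) \<odot>\<^bsub>F\<^esub> free_gen Y_ring a) b m"
    by (auto simp: log_deriv_def free_gen_def Y_ring_simps mseries_def Y_mon_def lookup_single when_def)
qed

text \<open>The class of \<open>log_deriv\<close> meets the description, and by
  \<open>derivation_eqI\<close> nothing else does. The values prescribed at inverses of variables
  are forced by those at the variables.\<close>

lemma screening:
  "S \<in> derivations Y_ring M1"
  "j \<noteq> i \<Longrightarrow> S (mseries (Y_mon j a)) = \<zero>\<^bsub>M1\<^esub>"
  "S (mseries (Y_mon i a)) = mseries (Y_mon i a) \<odot>\<^bsub>M1\<^esub> S_gen C d q i a"
proof -
  define D where "D = (\<lambda>f\<in>carrier Y_ring. N +>\<^bsub>F\<^esub> log_deriv f)"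
  have D_eq: "D f = N +>\<^bsub>F\<^esub> log_deriv f" if "f \<in> carrier Y_ring" for f
    using that by (simp add: D_def)
  note D_mseries = D_eq[OF mseries_in_Y_ring]
  have D: "D \<in> derivations Y_ring M1"
    unfolding derivations_def
  proof (intro CollectI conjI ballI funcsetI)
    fix f :: "'n series" assume f: "f \<in> carrier Y_ring"
    show "D f \<in> carrier M1" unfolding D_eq[OF f] by (rule M1_coset[OF log_deriv_closed[OF f]])
    fix g :: "'n series" assume g: "g \<in> carrier Y_ring"
    note c = log_deriv_closed[OF f] log_deriv_closed[OF g]
    show "D (f \<oplus>\<^bsub>Y_ring\<^esub> g) = D f \<oplus>\<^bsub>M1\<^esub> D g"
      unfolding D_eq[OF f] D_eq[OF g] D_eq[OF Y.a_closed[OF f g]] log_deriv_add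
      by (rule M1_add[OF c, symmetric])
    show "D (f \<otimes>\<^bsub>Y_ring\<^esub> g) = f \<odot>\<^bsub>M1\<^esub> D g \<oplus>\<^bsub>M1\<^esub> g \<odot>\<^bsub>M1\<^esub> D f"
      unfolding D_eq[OF f] D_eq[OF g] D_eq[OF Y.m_closed[OF f g]] log_deriv_mult[OF f g]
      using c f g by (simp only: M1_smult M1_add F.smult_closed)
  qed
  have D_other: "D (mseries (Y_mon j a)) = \<zero>\<^bsub>M1\<^esub>" if "j \<noteq> i" for j a
    unfolding D_mseries log_deriv_other[OF that] by (rule M1_zero)
  have D_gen: "D (mseries (Y_mon i a)) = mseries (Y_mon i a) \<odot>\<^bsub>M1\<^esub> S_gen C d q i a" for a
    unfolding D_mseries log_deriv_gen S_gen_def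
    by (rule M1_smult[OF mseries_in_Y_ring Y.free_gen_closed, symmetric])
  have inverse: "mseries (Y_mon j a) \<otimes>\<^bsub>Y_ring\<^esub> mseries (- Y_mon j a) = \<one>\<^bsub>Y_ring\<^esub>" for j a
    by (simp add: mseries_mult Y_ring_simps(4))
  have D_inv: "D (mseries (- Y_mon j a)) = \<ominus>\<^bsub>M1\<^esub> ((mseries (- Y_mon j a) \<otimes>\<^bsub>Y_ring\<^esub> mseries (- Y_mon j a))
      \<odot>\<^bsub>M1\<^esub> D (mseries (Y_mon j a)))" for j a
    by (rule M1.derivation_inverse[OF D mseries_in_Y_ring mseries_in_Y_ring inverse])
  have D_inv_other: "D (mseries (- Y_mon j a)) = \<zero>\<^bsub>M1\<^esub>" if "j \<noteq> i" for j a
    unfolding D_inv D_other[OF that]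
    by (simp only: M1.smult_r_null[OF Y.m_closed[OF mseries_in_Y_ring mseries_in_Y_ring]] M1.M.minus_equality[OF M1.M.l_zero[OF M1.M.zero_closed] M1.M.zero_closed M1.M.zero_closed])
  have D_inv_gen: "D (mseries (- Y_mon i a)) =
      \<ominus>\<^bsub>M1\<^esub> (mseries (- Y_mon i a) \<odot>\<^bsub>M1\<^esub> S_gen C d q i a)" for a
  proof -
    \<comment> \<open>The factor Y^-2 from \<open>derivation_inverse\<close> meets the factor Y in
      D(Y) = Y S, which leaves Y^-1.\<close>
    have "mseries (- Y_mon i a) \<otimes>\<^bsub>Y_ring\<^esub> mseries (- Y_mon i a) \<otimes>\<^bsub>Y_ring\<^esub> mseries (Y_mon i a)
        = mseries (- Y_mon i a)"
      by (simp add: mseries_mult)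
    then show ?thesis
      unfolding D_inv D_gen
      using M1.smult_assoc1[OF Y.m_closed[OF mseries_in_Y_ring mseries_in_Y_ring] mseries_in_Y_ring S_gen_closed]
      by metis
  qed
  let ?P = "\<lambda>D. D \<in> extensional (carrier Y_ring) \<and> D \<in> derivations Y_ring M1 \<and>
     (\<forall>j a. j \<noteq> i \<longrightarrow> D (mseries (Y_mon j a)) = \<zero>\<^bsub>M1\<^esub> \<and> D (mseries (- Y_mon j a)) = \<zero>\<^bsub>M1\<^esub>) \<and>
     (\<forall>a. D (mseries (Y_mon i a)) = mseries (Y_mon i a) \<odot>\<^bsub>M1\<^esub> S_gen C d q i a \<and>
          D (mseries (- Y_mon i a)) = \<ominus>\<^bsub>M1\<^esub> (mseries (- Y_mon i a) \<odot>\<^bsub>M1\<^esub> S_gen C d q i a))"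
  have "?P D"
    by (intro conjI allI impI D D_other D_inv_other D_gen D_inv_gen) (simp add: D_def)
  moreover have "D' = D" if D': "?P D'" for D'
  proof (rule extensionalityI[of D' "carrier (Y_ring :: 'n series ring)" D])
    show "D' \<in> extensional (carrier Y_ring)" using D' by (elim conjE)
    show "D \<in> extensional (carrier Y_ring)" by (simp add: D_def)
    fix f :: "'n series" assume f: "f \<in> carrier Y_ring"
    show "D' f = D f"
    proof (rule derivation_eqI[OF M1.module_axioms _ D _ f])
      show "D' \<in> derivations Y_ring M1" using D' by (elim conjE)
      show "D' (mseries (Y_mon j a)) = D (mseries (Y_mon j a))" for j a
        using D' by (cases "j = i") (simp_all only: D_gen D_other simp_thms)
    qed
  qed
  ultimately have "?P S"
    unfolding screening_def by (rule theI)
  then show "S \<in> derivations Y_ring M1"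
    "j \<noteq> i \<Longrightarrow> S (mseries (Y_mon j a)) = \<zero>\<^bsub>M1\<^esub>"
    "S (mseries (Y_mon i a)) = mseries (Y_mon i a) \<odot>\<^bsub>M1\<^esub> S_gen C d q i a"
    by (simp_all only: simp_thms)
qed

lemma neg_sigma_K: "\<ominus>\<^bsub>H\<^esub> \<sigma> a \<in> carrier K"
  by (intro K_closed)

text \<open>Under S_a -> -\<sigma> (a / Q) this is the defining relation of Y_i: S at a Q^2 goes to
  -\<sigma> (a * Q), S at a goes to -\<sigma> (a / Q), and the multiple of h in
  \<open>sigma_relation\<close> vanishes in the quotient.\<close>

lemma cl_relation:
  "cl (\<ominus>\<^bsub>H\<^esub> \<sigma> (a * Q)) = cl (\<iota> (mseries (A (a * Q)))) \<otimes>\<^bsub>B\<^esub> cl (\<ominus>\<^bsub>H\<^esub> \<sigma> (a / Q))"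
proof -
  let ?A = "\<iota> (mseries (A (a * Q)))"
  note c = K_closed(1)[OF mseries_in_Y_ring, of "A (a * Q)"] K_closed(3)
  have "cl (?A \<otimes>\<^bsub>H\<^esub> \<sigma> (a / Q)) = cl (\<sigma> (a * Q)) \<oplus>\<^bsub>B\<^esub> \<zero>\<^bsub>B\<^esub>"
    unfolding sigma_relation using c by (simp only: cl_add cl_hvar K_closed)
  also have "\<dots> = cl (\<sigma> (a * Q))" by (simp only: B.r_zero[OF cl_closed[OF c(2)]])
  finally have "cl ?A \<otimes>\<^bsub>B\<^esub> cl (\<sigma> (a / Q)) = cl (\<sigma> (a * Q))"
    using c by (simp only: cl_mult)
  then show ?thesis
    using c by (simp only: cl_uminus B.r_minus[OF cl_closed cl_closed])
qed

text \<open>On the free module the images of the S_a can be prescribed at will. By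
  \<open>cl_relation\<close> the kernel contains the generating relations, hence the submodule they
  span, and the map descends to Y_i.\<close>

lemma specialization_map:
  obtains \<phi> where "\<phi> \<in> mod_hom Y_ring M1 M0"
    "\<forall>a. \<phi> (S_gen C d q i a) = cl (\<ominus>\<^bsub>H\<^esub> \<sigma> (a / Q))"
proof -
  have v: "cl (\<ominus>\<^bsub>H\<^esub> \<sigma> (a / Q)) \<in> carrier M0" for a
    unfolding M0_simps by (rule cl_closed[OF neg_sigma_K])
  obtain \<eta> where \<eta>: "\<eta> \<in> mod_hom Y_ring F M0"
    and \<eta>_gen: "\<forall>a. \<eta> (free_gen Y_ring a) = cl (\<ominus>\<^bsub>H\<^esub> \<sigma> (a / Q))"
    by (rule M0.free_module_lift[of "\<lambda>a. cl (\<ominus>\<^bsub>H\<^esub> \<sigma> (a / Q))"]) (use v in auto)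
  note \<eta>_add = \<eta>[unfolded mod_hom_def, simplified, THEN conjunct2, THEN conjunct1, rule_format]
  note \<eta>_smult = \<eta>[unfolded mod_hom_def, simplified, THEN conjunct2, THEN conjunct2, rule_format]
  have "N \<subseteq> {x \<in> carrier F. \<eta> x = \<zero>\<^bsub>M0\<^esub>}"
    unfolding S_relations_def
  proof (rule hull_minimal)
    show "submodule {x \<in> carrier F. \<eta> x = \<zero>\<^bsub>M0\<^esub>} Y_ring F"
      by (rule F.submodule_mod_hom_kernel[OF module_M0 \<eta>])
    show "{free_gen Y_ring (a * Q ^ 2) \<ominus>\<^bsub>F\<^esub> (mseries (A (a * Q)) \<odot>\<^bsub>F\<^esub> free_gen Y_ring a) | a. True}
      \<subseteq> {x \<in> carrier F. \<eta> x = \<zero>\<^bsub>M0\<^esub>}"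
    proof
      fix x assume "x \<in> {free_gen Y_ring (a * Q ^ 2) \<ominus>\<^bsub>F\<^esub> (mseries (A (a * Q)) \<odot>\<^bsub>F\<^esub> free_gen Y_ring a) | a. True}"
      then obtain a where x: "x = free_gen Y_ring (a * Q ^ 2) \<ominus>\<^bsub>F\<^esub> (mseries (A (a * Q)) \<odot>\<^bsub>F\<^esub> free_gen Y_ring a)"
        by blast
      define g r where "g = (free_gen Y_ring (a * Q ^ 2) :: cstar \<Rightarrow> 'n series)"
        and "r = mseries (A (a * Q)) \<odot>\<^bsub>F\<^esub> free_gen Y_ring a"
      have c: "g \<in> carrier F" "r \<in> carrier F"
        unfolding g_def r_def by (intro F.smult_closed Y.free_gen_closed mseries_in_Y_ring)+
      have "\<eta> r = cl (\<iota> (mseries (A (a * Q)))) \<otimes>\<^bsub>B\<^esub> cl (\<ominus>\<^bsub>H\<^esub> \<sigma> (a / Q))"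
        unfolding r_def by (simp only: \<eta>_smult[OF mseries_in_Y_ring Y.free_gen_closed] \<eta>_gen M0_simps)
      also have "\<dots> = \<eta> g"
        unfolding g_def by (simp only: \<eta>_gen cstar_shift(2) cl_relation)
      finally have "\<eta> x = \<eta> g \<oplus>\<^bsub>M0\<^esub> \<ominus>\<^bsub>M0\<^esub> \<eta> g"
        unfolding x g_def[symmetric] r_def[symmetric] a_minus_def
        using c by (simp only: \<eta>_add F.a_inv_closed F.mod_hom_uminus[OF module_M0 \<eta>])
      moreover have "\<eta> g \<in> carrier M0" using \<eta> c(1) by (auto simp: mod_hom_def)
      ultimately have "\<eta> x = \<zero>\<^bsub>M0\<^esub>" by (simp only: M0.r_neg)
      moreover have "x \<in> carrier F"
        unfolding x g_def[symmetric] r_def[symmetric] using c by (rule F.minus_closed)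
      ultimately show "x \<in> {x \<in> carrier F. \<eta> x = \<zero>\<^bsub>M0\<^esub>}" by blast
    qed
  qed
  then have ker: "\<And>x. x \<in> N \<Longrightarrow> \<eta> x = \<zero>\<^bsub>M0\<^esub>" by blast
  obtain \<phi> where \<phi>: "\<phi> \<in> mod_hom Y_ring M1 M0" "\<forall>x\<in>carrier F. \<phi> (N +>\<^bsub>F\<^esub> x) = \<eta> x"
    unfolding Yi_module_def by (rule F.quot_module_lift[OF submodule_N module_M0 \<eta> ker]) auto
  have "\<forall>a. \<phi> (S_gen C d q i a) = cl (\<ominus>\<^bsub>H\<^esub> \<sigma> (a / Q))"
    unfolding S_gen_def by (intro allI trans[OF bspec[OF \<phi>(2) Y.free_gen_closed] spec[OF \<eta>_gen]])
  with \<phi>(1) show thesis by (rule that)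
qed

lemma mod_hom_derivation:
  assumes \<phi>: "\<phi> \<in> mod_hom Y_ring M1 M0" and D: "D \<in> derivations Y_ring M1"
  shows "(\<lambda>P. \<phi> (D P)) \<in> derivations Y_ring M0"
  using \<phi> M1.derivationD[OF D] by (auto simp: derivations_def mod_hom_def)

lemma linear_term:
  assumes \<phi>: "\<phi> \<in> mod_hom Y_ring M1 M0"
    and gen: "\<forall>a. \<phi> (S_gen C d q i a) = cl (\<ominus>\<^bsub>H\<^esub> \<sigma> (a / Q))"
    and P: "P \<in> carrier Y_ring"
  shows "cl (diff_quot P) = \<phi> (S P)"
proof (rule derivation_eqI[OF module_M0 diff_quot_derivation mod_hom_derivation[OF \<phi> screening(1)] _ P])
  fix j a
  show "cl (diff_quot (mseries (Y_mon j a))) = \<phi> (S (mseries (Y_mon j a)))"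
  proof (cases "j = i")
    case True
    let ?y = "mseries (Y_mon i a)"
    note c = K_closed(1)[OF mseries_in_Y_ring, of "Y_mon i a"] K_closed(3)[of "a / Q"]
    have "\<phi> (S ?y) = ?y \<odot>\<^bsub>M0\<^esub> \<phi> (S_gen C d q i a)"
      using \<phi> S_gen_closed mseries_in_Y_ring unfolding screening(3) mod_hom_def by blast
    also have "\<dots> = cl (\<iota> ?y \<otimes>\<^bsub>H\<^esub> (\<ominus>\<^bsub>H\<^esub> \<sigma> (a / Q)))"
      using c by (simp only: gen M0_simps cl_mult neg_sigma_K)
    also have "\<dots> = cl (diff_quot ?y)"
      unfolding diff_quot_gen using c by (simp only: H.r_minus[OF K_subset K_subset])
    finally show ?thesis unfolding True by (rule sym)
  next
    case False
    have "\<phi> (S (mseries (Y_mon j a))) = \<zero>\<^bsub>M0\<^esub>"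
      unfolding screening(2)[OF False] by (rule M1.mod_hom_zero[OF module_M0 \<phi>])
    then show ?thesis
      unfolding diff_quot_other(1)[OF False] cl_zero M0_simps by (rule sym)
  qed
qed

end

theorem mainTheorem3:
  fixes C :: "'n::finite \<Rightarrow> 'n \<Rightarrow> int" and d :: "'n \<Rightarrow> nat" and q :: cstar and i :: 'n
  assumes "simple_cartan_matrix C"
    and "\<And>j. d j > 0"
    and "\<And>j k. int (d j) * C j k = int (d k) * C k j"
    and "Gcd (range d) = 1"
    and "\<And>k::nat. k > 0 \<Longrightarrow> q ^ k \<noteq> 1"
  shows
    "(\<forall>j a. j \<noteq> i \<longrightarrow>
        Theta_h C d q i (mseries (Y_mon j a)) = emb C (mseries (Y_mon j a)) \<and>
        Theta_h C d q i (mseries (- Y_mon j a)) = emb C (mseries (- Y_mon j a))) \<and>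
     (\<forall>a. Theta_h C d q i (mseries (Y_mon i a)) =
        emb C (mseries (Y_mon i a)) \<ominus>\<^bsub>Yeh_ring C\<^esub> hvar C \<otimes>\<^bsub>Yeh_ring C\<^esub>
          (emb C (mseries (Y_mon i a)) \<otimes>\<^bsub>Yeh_ring C\<^esub>
             inv\<^bsub>Yeh_ring C\<^esub> (Sigma_h C d q i (a / q ^ d i)))) \<and>
     (\<forall>a. Theta_h C d q i (mseries (- Y_mon i a)) =
        emb C (mseries (- Y_mon i a)) \<oplus>\<^bsub>Yeh_ring C\<^esub> hvar C \<otimes>\<^bsub>Yeh_ring C\<^esub>
          (emb C (mseries (- Y_mon i a)) \<otimes>\<^bsub>Yeh_ring C\<^esub> emb C (mseries (A_mon C d q i (a / q ^ d i)))
             \<otimes>\<^bsub>Yeh_ring C\<^esub> inv\<^bsub>Yeh_ring C\<^esub> (Sigma_h C d q i (a / (q ^ d i) ^ 3)))) \<and>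
     Theta_h C d q i \<in> ring_hom Y_ring (Yih_ring C d q i) \<and>
     (\<forall>P \<in> carrier Y_ring. Theta_h C d q i P \<ominus>\<^bsub>Yeh_ring C\<^esub> emb C P \<in> h_ideal C d q i) \<and>
     (\<exists>\<phi> \<in> mod_hom Y_ring (Yi_module C d q i) (Yi0_module C d q i).
        (\<forall>a. \<phi> (S_gen C d q i a) =
           h_class C d q i (\<ominus>\<^bsub>Yeh_ring C\<^esub> (inv\<^bsub>Yeh_ring C\<^esub> (Sigma_h C d q i (a / q ^ d i))))) \<and>
        (\<forall>P \<in> carrier Y_ring.
           h_class C d q i (inv\<^bsub>Yeh_ring C\<^esub> (hvar C) \<otimes>\<^bsub>Yeh_ring C\<^esub>
             (Theta_h C d q i P \<ominus>\<^bsub>Yeh_ring C\<^esub> emb C P)) =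
           \<phi> (screening C d q i P)))"
proof -
  interpret cartan_datum C d q i by unfold_locales (rule assms(1))
  obtain \<phi> where \<phi>: "\<phi> \<in> mod_hom Y_ring (Yi_module C d q i) (Yi0_module C d q i)"
    and gen: "\<forall>a. \<phi> (S_gen C d q i a) = h_class C d q i
      (\<ominus>\<^bsub>Yeh_ring C\<^esub> (inv\<^bsub>Yeh_ring C\<^esub> (Sigma_h C d q i (a / q ^ d i))))"
    by (rule specialization_map)
  show ?thesis
    by (intro conjI allI impI ballI bexI[OF _ \<phi>] Theta_h_other Theta_h_gen Theta_h_inv Theta_h_hom_K
        Theta_h_diff_in_J gen[rule_format] linear_term[OF \<phi> gen, unfolded diff_quot_def])
qed

end
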